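(* Let $\mathcal{V}$ be a finite set, let $\mathbb{M}$ be a Sperner family of $\mathcal{V}$, and for each $v\in\mathcal{V}$ let $\mathcal{X}_v$ be a set, let $\mathcal{F}_v$ be a reproducing kernel Krein space of functions on $\mathcal{X}_v$ with reproducing kernel $h_v$, and let $\mathcal{C}_v$, the vector space of constant functions on $\mathcal{X}_v$, be a reproducing kernel Krein space with reproducing kernel $c_v$, such that $\mathcal{F}_v\cap\mathcal{C}_v=\{0\}$. Then the hierarchical interaction space $\mathcal{F}_{\mathbb{M}}=\bigoplus_{\mathcal{M}\in\tilde{\mathbb{P}}(\mathbb{M})}\mathcal{T}_{\mathcal{M}}$ is the reproducing kernel Krein space (of functions on $\times_{v\in\mathcal{V}}\mathcal{X}_v$) with reproducing kernel $$h_{\mathbb{M}}(x,x')=\sum_{\mathcal{M}\in\tilde{\mathbb{P}}(\mathbb{M})}k_{\mathcal{M}}(x,x').$$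
   Context: All vector spaces are real. An inner product on a vector space $\mathcal{F}$ is a symmetric bilinear map $\langle\cdot,\cdot\rangle_{\mathcal{F}}:\mathcal{F}\times\mathcal{F}\to\mathbb{R}$ that is nondegenerate (if $\langle f,g\rangle_{\mathcal{F}}=0$ for all $g\in\mathcal{F}$ then $f=0$); it is not required to be positive definite. A Krein space is a vector space $\mathcal{F}$ with an inner product $\langle\cdot,\cdot\rangle_{\mathcal{F}}$ for which there exist two Hilbert spaces $\mathcal{H}_+,\mathcal{H}_-$ (linear subspaces of $\mathcal{F}$, each with its own positive definite inner product) with $\mathcal{H}_+\cap\mathcal{H}_-=\{0\}$, spanning $\mathcal{F}$, such that every $f\in\mathcal{F}$ decomposes as $f=f_++f_-$ with $f_\pm\in\mathcal{H}_\pm$, and $\langle f,f'\rangle_{\mathcal{F}}=\langle f_+,f'_+\rangle_{\mathcal{H}_+}-\langle f_-,f'_-\rangle_{\mathcal{H}_-}$ for all $f,f'\in\mathcal{F}$. The strong topology of $\mathcal{F}$ is the topology of the associated Hilbert space $\mathcal{H}_+\oplus\mathcal{H}_-$ with inner product $\langle f_+,f'_+\rangle_{\mathcal{H}_+}+\langle f_-,f'_-\rangle_{\mathcal{H}_-}$; it does not depend on the chosen decomposition. A Krein space $\mathcal{F}$ of functions $f:\mathcal{X}\to\mathbb{R}$ is a reproducing kernel Krein space (RKKS) if there is a symmetric function $h:\mathcal{X}\times\mathcal{X}\to\mathbb{R}$ such that for all $x\in\mathcal{X}$: $h(x,\cdot)\in\mathcal{F}$, and $f(x)=\langle f,h(x,\cdot)\rangle_{\mathcal{F}}$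 for all $f\in\mathcal{F}$. The function $h$ is called the reproducing kernel of $\mathcal{F}$. Direct sums: for RKKSs $\mathcal{F}_1,\mathcal{F}_2$ on the same set with $\mathcal{F}_1\cap\mathcal{F}_2=\{0\}$, $\mathcal{F}_1\oplus\mathcal{F}_2$ is the space of sums $f_1+f_2$ with inner product $\langle f_1+f_2,f_1'+f_2'\rangle=\langle f_1,f_1'\rangle_{\mathcal{F}_1}+\langle f_2,f_2'\rangle_{\mathcal{F}_2}$. This extends to finitely many summands by iteration. Tensor products: for RKKSs $\mathcal{F}_1,\mathcal{F}_2$ on $\mathcal{X}_1,\mathcal{X}_2$ with Krein decompositions into Hilbert spaces $\mathcal{H}_{i+},\mathcal{H}_{i-}$ ($i=1,2$), $\mathcal{F}_1\otimes\mathcal{F}_2$ is the Krein space of functions on $\mathcal{X}_1\times\mathcal{X}_2$ with positive part $(\mathcal{H}_{1+}\otimes\mathcal{H}_{2+})\oplus(\mathcal{H}_{1-}\otimes\mathcal{H}_{2-})$ and negative part $(\mathcal{H}_{1+}\otimes\mathcal{H}_{2-})\oplus(\mathcal{H}_{1-}\otimes\mathcal{H}_{2+})$, where the tensor products of (reproducing kernel) Hilbert spaces are the usual completed ones, realized as functions on $\mathcal{X}_1\times\mathcal{X}_2$ with $f_1\otimes f_2$ identified with $(x_1,x_2)\mapsto f_1(x_1)f_2(x_2)$. Equivalently, it is the Krein space of functions containing the algebraic tensor product densely in the strong topology, with inner product extending $\langle f_1\otimes f_2,g_1\otimes g_2\rangle=\langle f_1,g_1\rangle_{\mathcal{F}_1}\langle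 f_2,g_2\rangle_{\mathcal{F}_2}$. Tensor products of finitely many factors are obtained by iteration. For kernels, $(h_1\otimes h_2)((x_1,x_2),(x_1',x_2'))=h_1(x_1,x_1')h_2(x_2,x_2')$. Sperner families and interaction spaces: $\mathbb{P}(\mathcal{V})$ is the power set of $\mathcal{V}$. A Sperner family of $\mathcal{V}$ is a set $\mathbb{M}\subseteq\mathbb{P}(\mathcal{V})$ of subsets of $\mathcal{V}$ none of which contains another. For $\mathbb{M}\subseteq\mathbb{P}(\mathcal{V})$, $\tilde{\mathbb{P}}(\mathbb{M})=\bigcup_{\mathcal{M}\in\mathbb{M}}\mathbb{P}(\mathcal{M})$, with $\tilde{\mathbb{P}}(\emptyset)=\emptyset$. For $\mathcal{M}\subseteq\mathcal{V}$, $\mathcal{T}_{\mathcal{M}}=\bigotimes_{v\in\mathcal{V}}t_{\mathcal{M}}(v)$, where $t_{\mathcal{M}}(v)=\mathcal{F}_v$ if $v\in\mathcal{M}$ and $t_{\mathcal{M}}(v)=\mathcal{C}_v$ if $v\in\mathcal{V}\setminus\mathcal{M}$ (the product being taken in a fixed order of $\mathcal{V}$). The hierarchical interaction space is $\mathcal{F}_{\mathbb{M}}=\bigoplus_{\mathcal{M}\in\tilde{\mathbb{P}}(\mathbb{M})}\mathcal{T}_{\mathcal{M}}$, with the convention that the empty direct sum is $\{0\}$. Similarly $k_{\mathcal{M}}=\bigotimes_{v\in\mathcal{V}}u_{\mathcal{M}}(v)$, where $u_{\mathcal{M}}(v)=h_v$ if $v\in\mathcal{M}$ and $u_{\mathcal{M}}(v)=c_v$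 if $v\in\mathcal{V}\setminus\mathcal{M}$, i.e. $k_{\mathcal{M}}(x,x')=\prod_{v\in\mathcal{M}}h_v(x_v,x_v')\prod_{v\in\mathcal{V}\setminus\mathcal{M}}c_v(x_v,x_v')$ for $x=(x_v)_{v\in\mathcal{V}}$, $x'=(x'_v)_{v\in\mathcal{V}}$. An empty sum of kernels is $0$. *)

theory Defs
  imports "HOL-Analysis.Analysis" "HOL-Library.Function_Algebras"
begin

instantiation "fun" :: (type, real_vector) real_vector
begin

definition scaleR_fun_def: "r *\<^sub>R f = (\<lambda>x. r *\<^sub>R f x)"

instance
  by standard (simp_all add: scaleR_fun_def fun_eq_iff scaleR_add_left scaleR_add_right)

end

record 'f ip_space =
  vecs :: "'f set"
  ip :: "'f \<Rightarrow> 'f \<Rightarrow> real"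

text \<open>The values of \<^term>\<open>ip F\<close> outside \<^term>\<open>vecs F\<close> are irrelevant throughout.\<close>

definition inner_product_space :: "'f::real_vector ip_space \<Rightarrow> bool" where
  "inner_product_space F \<longleftrightarrow>
     subspace (vecs F) \<and>
     (\<forall>f\<in>vecs F. \<forall>g\<in>vecs F. ip F f g = ip F g f) \<and>
     (\<forall>f\<in>vecs F. \<forall>g\<in>vecs F. \<forall>k\<in>vecs F. ip F (f + g) k = ip F f k + ip F g k) \<and>
     (\<forall>a. \<forall>f\<in>vecs F. \<forall>g\<in>vecs F. ip F (a *\<^sub>R f) g = a * ip F f g) \<and>
     (\<forall>f\<in>vecs F. (\<forall>g\<in>vecs F. ip F f g = 0) \<longrightarrow> f = 0)"

text \<open>\<^locale>\<open>Metric_space\<close> demands a distance that is nonnegative and symmetric on the whole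
  type, hence the default value outside \<^term>\<open>vecs H\<close>.\<close>

definition ip_dist :: "'f::real_vector ip_space \<Rightarrow> 'f \<Rightarrow> 'f \<Rightarrow> real" where
  "ip_dist H f g = (if f \<in> vecs H \<and> g \<in> vecs H then sqrt (ip H (f - g) (f - g)) else 0)"

definition hilbert_space :: "'f::real_vector ip_space \<Rightarrow> bool" where
  "hilbert_space H \<longleftrightarrow>
     inner_product_space H \<and>
     (\<forall>f\<in>vecs H. f \<noteq> 0 \<longrightarrow> 0 < ip H f f) \<and>
     Metric_space.mcomplete (vecs H) (ip_dist H)"

definition krein_decomposition ::
    "'f::real_vector ip_space \<Rightarrow> 'f ip_space \<Rightarrow> 'f ip_space \<Rightarrow> bool" where
  "krein_decomposition F Hp Hm \<longleftrightarrow>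
     inner_product_space F \<and> hilbert_space Hp \<and> hilbert_space Hm \<and>
     vecs Hp \<subseteq> vecs F \<and> vecs Hm \<subseteq> vecs F \<and> vecs Hp \<inter> vecs Hm = {0} \<and>
     (\<forall>f\<in>vecs F. \<exists>fp\<in>vecs Hp. \<exists>fm\<in>vecs Hm. f = fp + fm) \<and>
     (\<forall>fp\<in>vecs Hp. \<forall>fm\<in>vecs Hm. \<forall>gp\<in>vecs Hp. \<forall>gm\<in>vecs Hm.
        ip F (fp + fm) (gp + gm) = ip Hp fp gp - ip Hm fm gm)"

definition krein_space :: "'f::real_vector ip_space \<Rightarrow> bool" where
  "krein_space F \<longleftrightarrow> (\<exists>Hp Hm. krein_decomposition F Hp Hm)"

text \<open>A real function on a set \<^term>\<open>X\<close> is represented by the total function that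
  extends it by \<^term>\<open>0::real\<close> outside \<^term>\<open>X\<close>, so that the pointwise operations on the
  function type are those of the functions on \<^term>\<open>X\<close>.\<close>

definition functions_on :: "'a set \<Rightarrow> ('a \<Rightarrow> real) set" where
  "functions_on X = {f. \<forall>x. x \<notin> X \<longrightarrow> f x = 0}"

definition restr :: "'a set \<Rightarrow> ('a \<Rightarrow> real) \<Rightarrow> 'a \<Rightarrow> real" where
  "restr X f = (\<lambda>x. if x \<in> X then f x else 0)"

definition constant_functions :: "'a set \<Rightarrow> ('a \<Rightarrow> real) set" where
  "constant_functions X = {restr X (\<lambda>_. a) | a. True}"

definition reproducing_kernel ::
    "'a set \<Rightarrow> ('a \<Rightarrow> real) ip_space \<Rightarrow> ('a \<Rightarrow> 'a \<Rightarrow> real) \<Rightarrow> bool" where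
  "reproducing_kernel X F h \<longleftrightarrow>
     vecs F \<subseteq> functions_on X \<and>
     (\<forall>x\<in>X. \<forall>y\<in>X. h x y = h y x) \<and>
     (\<forall>x\<in>X. restr X (h x) \<in> vecs F \<and> (\<forall>f\<in>vecs F. f x = ip F f (restr X (h x))))"

definition rkks :: "'a set \<Rightarrow> ('a \<Rightarrow> real) ip_space \<Rightarrow> ('a \<Rightarrow> 'a \<Rightarrow> real) \<Rightarrow> bool" where
  "rkks X F h \<longleftrightarrow> krein_space F \<and> reproducing_kernel X F h"

definition is_direct_sum ::
    "'f::real_vector ip_space \<Rightarrow> 'f ip_space \<Rightarrow> 'f ip_space \<Rightarrow> bool" where
  "is_direct_sum F1 F2 S \<longleftrightarrow>
     vecs F1 \<inter> vecs F2 = {0} \<and>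
     vecs S = {f1 + f2 | f1 f2. f1 \<in> vecs F1 \<and> f2 \<in> vecs F2} \<and>
     (\<forall>f1\<in>vecs F1. \<forall>f2\<in>vecs F2. \<forall>g1\<in>vecs F1. \<forall>g2\<in>vecs F2.
        ip S (f1 + f2) (g1 + g2) = ip F1 f1 g1 + ip F2 f2 g2)"

inductive is_direct_sum_over ::
    "('i \<Rightarrow> 'f::real_vector ip_space) \<Rightarrow> 'i set \<Rightarrow> 'f ip_space \<Rightarrow> bool"
  for T :: "'i \<Rightarrow> 'f::real_vector ip_space" where
  empty: "vecs S = {0} \<Longrightarrow> ip S 0 0 = 0 \<Longrightarrow> is_direct_sum_over T {} S"
| insert: "i \<notin> I \<Longrightarrow> is_direct_sum_over T I S \<Longrightarrow> is_direct_sum (T i) S S' \<Longrightarrow>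
    is_direct_sum_over T (insert i I) S'"

definition tensor_fun :: "('a \<Rightarrow> real) \<Rightarrow> ('b \<Rightarrow> real) \<Rightarrow> 'a \<times> 'b \<Rightarrow> real" where
  "tensor_fun f1 f2 = (\<lambda>(x1, x2). f1 x1 * f2 x2)"

text \<open>The completed tensor product, realized as functions. A completion alone would be
  determined only up to isometry; what fixes its realization as a space of functions is
  that point evaluations are continuous, i.e. that \<^term>\<open>H\<close> is a reproducing kernel Hilbert
  space. Its kernel is left unspecified.\<close>

definition is_hilbert_tensor ::
    "'a set \<Rightarrow> ('a \<Rightarrow> real) ip_space \<Rightarrow> 'b set \<Rightarrow> ('b \<Rightarrow> real) ip_space \<Rightarrow>
     ('a \<times> 'b \<Rightarrow> real) ip_space \<Rightarrow> bool" where
  "is_hilbert_tensor X1 H1 X2 H2 H \<longleftrightarrow>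
     hilbert_space H \<and> (\<exists>k. reproducing_kernel (X1 \<times> X2) H k) \<and>
     (\<forall>f1\<in>vecs H1. \<forall>f2\<in>vecs H2. tensor_fun f1 f2 \<in> vecs H) \<and>
     (\<forall>f1\<in>vecs H1. \<forall>f2\<in>vecs H2. \<forall>g1\<in>vecs H1. \<forall>g2\<in>vecs H2.
        ip H (tensor_fun f1 f2) (tensor_fun g1 g2) = ip H1 f1 g1 * ip H2 f2 g2) \<and>
     Metric_space.mtopology (vecs H) (ip_dist H) closure_of
       span {tensor_fun f1 f2 | f1 f2. f1 \<in> vecs H1 \<and> f2 \<in> vecs H2} = vecs H"

definition is_krein_tensor ::
    "'a set \<Rightarrow> ('a \<Rightarrow> real) ip_space \<Rightarrow> 'b set \<Rightarrow> ('b \<Rightarrow> real) ip_space \<Rightarrow>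
     ('a \<times> 'b \<Rightarrow> real) ip_space \<Rightarrow> bool" where
  "is_krein_tensor X1 F1 X2 F2 T \<longleftrightarrow>
     (\<exists>H1p H1m H2p H2m Hpp Hmm Hpm Hmp Tp Tm.
        krein_decomposition F1 H1p H1m \<and> krein_decomposition F2 H2p H2m \<and>
        is_hilbert_tensor X1 H1p X2 H2p Hpp \<and> is_hilbert_tensor X1 H1m X2 H2m Hmm \<and>
        is_hilbert_tensor X1 H1p X2 H2m Hpm \<and> is_hilbert_tensor X1 H1m X2 H2p Hmp \<and>
        is_direct_sum Hpp Hmm Tp \<and> is_direct_sum Hpm Hmp Tm \<and>
        krein_decomposition T Tp Tm)"

text \<open>Iterated products are carried from \<open>X v \<times> (\<Pi>\<^sub>E w\<in>W. X w)\<close> to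
  \<open>\<Pi>\<^sub>E w\<in>insert v W. X w\<close> along the bijection \<open>x \<mapsto> (x v, restrict x W)\<close>.\<close>

definition pull_back ::
    "('v \<Rightarrow> 'a set) \<Rightarrow> 'v \<Rightarrow> 'v set \<Rightarrow> ('a \<times> ('v \<Rightarrow> 'a) \<Rightarrow> real) \<Rightarrow> ('v \<Rightarrow> 'a) \<Rightarrow> real" where
  "pull_back X v W f = restr (Pi\<^sub>E (insert v W) X) (\<lambda>x. f (x v, restrict x W))"

text \<open>The empty product is the one-dimensional space of functions on the one-point set
  \<^term>\<open>Pi\<^sub>E {} X\<close>, the unit of the tensor product, with \<open>\<langle>1, 1\<rangle> = 1\<close>.\<close>

inductive is_tensor_product ::
    "('v \<Rightarrow> 'a set) \<Rightarrow> ('v \<Rightarrow> ('a \<Rightarrow> real) ip_space) \<Rightarrow> 'v list \<Rightarrow>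
     (('v \<Rightarrow> 'a) \<Rightarrow> real) ip_space \<Rightarrow> bool"
  for X :: "'v \<Rightarrow> 'a set" and F :: "'v \<Rightarrow> ('a \<Rightarrow> real) ip_space" where
  Nil: "vecs T = functions_on (Pi\<^sub>E {} X) \<Longrightarrow>
    (\<And>f g. f \<in> vecs T \<Longrightarrow> g \<in> vecs T \<Longrightarrow>
       ip T f g = f (\<lambda>_. undefined) * g (\<lambda>_. undefined)) \<Longrightarrow>
    is_tensor_product X F [] T"
| Cons: "is_tensor_product X F vs T \<Longrightarrow>
    is_krein_tensor (X v) (F v) (Pi\<^sub>E (set vs) X) T T' \<Longrightarrow>
    vecs T'' = pull_back X v (set vs) ` vecs T' \<Longrightarrow>
    (\<And>f g. f \<in> vecs T' \<Longrightarrow> g \<in> vecs T' \<Longrightarrow>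
       ip T'' (pull_back X v (set vs) f) (pull_back X v (set vs) g) = ip T' f g) \<Longrightarrow>
    is_tensor_product X F (v # vs) T''"

definition sperner_family :: "'v set \<Rightarrow> 'v set set \<Rightarrow> bool" where
  "sperner_family V MM \<longleftrightarrow> MM \<subseteq> Pow V \<and> (\<forall>A\<in>MM. \<forall>B\<in>MM. A \<subseteq> B \<longrightarrow> A = B)"

definition subsets_of_members :: "'v set set \<Rightarrow> 'v set set" where
  "subsets_of_members MM = (\<Union>M\<in>MM. Pow M)"

text \<open>The list \<^term>\<open>vs\<close> gives the order in which the tensor products are taken.\<close>

definition is_interaction_term ::
    "'v list \<Rightarrow> ('v \<Rightarrow> 'a set) \<Rightarrow> ('v \<Rightarrow> ('a \<Rightarrow> real) ip_space) \<Rightarrow>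
     ('v \<Rightarrow> ('a \<Rightarrow> real) ip_space) \<Rightarrow> 'v set \<Rightarrow> (('v \<Rightarrow> 'a) \<Rightarrow> real) ip_space \<Rightarrow> bool" where
  "is_interaction_term vs X F C M T \<longleftrightarrow>
     is_tensor_product X (\<lambda>v. if v \<in> M then F v else C v) vs T"

text \<open>No such \<^term>\<open>S\<close> exists unless the sum of the terms is direct.\<close>

definition is_interaction_space ::
    "'v list \<Rightarrow> ('v \<Rightarrow> 'a set) \<Rightarrow> ('v \<Rightarrow> ('a \<Rightarrow> real) ip_space) \<Rightarrow>
     ('v \<Rightarrow> ('a \<Rightarrow> real) ip_space) \<Rightarrow> 'v set set \<Rightarrow> (('v \<Rightarrow> 'a) \<Rightarrow> real) ip_space \<Rightarrow> bool" where
  "is_interaction_space vs X F C MM S \<longleftrightarrow>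
     (\<exists>T. (\<forall>M\<in>subsets_of_members MM. is_interaction_term vs X F C M (T M)) \<and>
          is_direct_sum_over T (subsets_of_members MM) S)"

definition interaction_kernel ::
    "'v set \<Rightarrow> ('v \<Rightarrow> 'a \<Rightarrow> 'a \<Rightarrow> real) \<Rightarrow> ('v \<Rightarrow> 'a \<Rightarrow> 'a \<Rightarrow> real) \<Rightarrow> 'v set \<Rightarrow>
     ('v \<Rightarrow> 'a) \<Rightarrow> ('v \<Rightarrow> 'a) \<Rightarrow> real" where
  "interaction_kernel V h c M x x' =
     (\<Prod>v\<in>M. h v (x v) (x' v)) * (\<Prod>v\<in>V - M. c v (x v) (x' v))"

end

theory Submission
  imports Defs
begin

text \<open>A Hilbert tensor product is obtained by completing the algebraic tensor product inside the
  space of functions. The completion consists of functions because a Cauchy sequence of finite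
  tensor sums that tends to zero pointwise tends to zero in norm: contracting it with \<open>k x\<close> for a
  kernel \<open>k\<close>, and then with a fixed vector, gives Cauchy sequences in the two complete factors.
  The same contractions show that the sections of an element of a tensor product lie in the
  factors. Hence the four Hilbert tensor products in a Krein tensor product are independent, and
  the kernel of the latter is \<open>(p\<^sub>1 - m\<^sub>1) (p\<^sub>2 - m\<^sub>2) = h\<^sub>1 h\<^sub>2\<close>. Moreover the section in the
  coordinate \<open>v\<close> of an element of the term of \<open>M\<close> lies in \<open>F v\<close> or \<open>C v\<close> according to whether
  \<open>v \<in> M\<close>; since \<open>F v \<inter> C v = {0}\<close>, the sum of the terms is direct, and kernels add up over a
  direct sum.\<close>

text \<open>The spaces are given by predicates and not by constructions: a Krein tensor product may
  start from any Krein decompositions of its factors, and the Hilbert tensor products in it come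
  with an unspecified kernel. So existence of one space and facts about all of them are separate
  tasks, and the latter rest on density and on the continuity of evaluations. Contraction with a
  vector is the adjoint of tensoring with it. It is kept as a relation: explicit on elementary
  tensors, additive, and stable under limits when the target is complete. The completion takes two
  contractions because pointwise convergence only controls pairings with products of two kernel
  functions. The first contraction turns it into norm convergence in the second factor, hence into
  convergence of the pairings with \<open>k x\<close> tensor any \<open>b\<close>, and these are the
  values of the second contraction. Indefiniteness is absorbed by reversing the sign on the negative
  part: a Krein decomposition becomes an ordinary direct sum of bilinear spaces, along which kernels
  both add and split.\<close>

lemma scaleR_fun_apply [simp]: "(r *\<^sub>R f) x = r *\<^sub>R f x"
  by (simp add: scaleR_fun_def)

section \<open>Indefinite and definite inner products\<close>

text \<open>Nondegeneracy is kept apart, so that Krein spaces, negated Hilbert spaces, direct sums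
  and the algebraic tensor product can share the same algebra.\<close>

locale bilinear_space =
  fixes H :: "'f::real_vector ip_space"
  assumes subspace: "subspace (vecs H)"
    and ip_commute: "\<And>f g. f \<in> vecs H \<Longrightarrow> g \<in> vecs H \<Longrightarrow> ip H f g = ip H g f"
    and ip_add_left: "\<And>f g k. f \<in> vecs H \<Longrightarrow> g \<in> vecs H \<Longrightarrow> k \<in> vecs H \<Longrightarrow>
      ip H (f + g) k = ip H f k + ip H g k"
    and ip_scale_left: "\<And>a f g. f \<in> vecs H \<Longrightarrow> g \<in> vecs H \<Longrightarrow> ip H (a *\<^sub>R f) g = a * ip H f g"
begin

lemma zero_mem [simp]: "0 \<in> vecs H"
  using subspace by (rule subspace_0)

lemma add_mem [simp]: "f \<in> vecs H \<Longrightarrow> g \<in> vecs H \<Longrightarrow> f + g \<in> vecs H"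
  using subspace by (rule subspace_add)

lemma scale_mem [simp]: "f \<in> vecs H \<Longrightarrow> a *\<^sub>R f \<in> vecs H"
  using subspace by (rule subspace_mul)

lemma diff_mem [simp]: "f \<in> vecs H \<Longrightarrow> g \<in> vecs H \<Longrightarrow> f - g \<in> vecs H"
  using subspace by (rule subspace_diff)

lemma minus_mem [simp]: "f \<in> vecs H \<Longrightarrow> - f \<in> vecs H"
  using subspace by (rule subspace_neg)

lemma ip_zero_left: "g \<in> vecs H \<Longrightarrow> ip H 0 g = 0"
  using ip_scale_left[of 0 g 0] by simp

lemma ip_zero_right: "g \<in> vecs H \<Longrightarrow> ip H g 0 = 0"
  using ip_zero_left[of g] ip_commute[of g 0] by simp

lemma ip_add_right: "f \<in> vecs H \<Longrightarrow> g \<in> vecs H \<Longrightarrow> k \<in> vecs H \<Longrightarrow>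
    ip H f (g + k) = ip H f g + ip H f k"
  using ip_add_left[of g k f] ip_commute[of f g] ip_commute[of f k] ip_commute[of f "g + k"] by simp

lemma ip_scale_right: "f \<in> vecs H \<Longrightarrow> g \<in> vecs H \<Longrightarrow> ip H f (a *\<^sub>R g) = a * ip H f g"
  using ip_scale_left[of g f a] ip_commute[of f g] ip_commute[of f "a *\<^sub>R g"] by simp

lemma ip_minus_left: "f \<in> vecs H \<Longrightarrow> g \<in> vecs H \<Longrightarrow> ip H (- f) g = - ip H f g"
  using ip_scale_left[of f g "-1"] by simp

lemma ip_minus_right: "f \<in> vecs H \<Longrightarrow> g \<in> vecs H \<Longrightarrow> ip H f (- g) = - ip H f g"
  using ip_scale_right[of f g "-1"] by simp

lemma ip_diff_left: "f \<in> vecs H \<Longrightarrow> g \<in> vecs H \<Longrightarrow> k \<in> vecs H \<Longrightarrow>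
    ip H (f - g) k = ip H f k - ip H g k"
  using ip_add_left[of f "- g" k] ip_minus_left[of g k] by simp

lemma ip_diff_right: "f \<in> vecs H \<Longrightarrow> g \<in> vecs H \<Longrightarrow> k \<in> vecs H \<Longrightarrow>
    ip H f (g - k) = ip H f g - ip H f k"
  using ip_add_right[of f g "- k"] ip_minus_right[of f k] by simp

lemmas ip_simps = ip_zero_left ip_zero_right ip_add_left ip_add_right ip_scale_left ip_scale_right
  ip_minus_left ip_minus_right ip_diff_left ip_diff_right

end

lemma inner_product_space_iff:
  "inner_product_space F \<longleftrightarrow>
    bilinear_space F \<and> (\<forall>f\<in>vecs F. (\<forall>g\<in>vecs F. ip F f g = 0) \<longrightarrow> f = 0)"
  unfolding inner_product_space_def bilinear_space_def Ball_def conj_assoc by (intro conj_cong refl) auto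

section \<open>Norms, Cauchy sequences and convergence for a semidefinite form\<close>

definition ip_norm :: "'f ip_space \<Rightarrow> 'f \<Rightarrow> real" where
  "ip_norm H f = sqrt (ip H f f)"

text \<open>Phrased with \<open>ip_norm\<close> and not with \<open>ip_dist\<close>, because
  \<open>Metric_space\<close> demands definiteness, while the algebraic tensor product is at first
  known only to be semidefinite.\<close>

definition cauchy_in :: "'f::real_vector ip_space \<Rightarrow> (nat \<Rightarrow> 'f) \<Rightarrow> bool" where
  "cauchy_in H s \<longleftrightarrow> (\<forall>n. s n \<in> vecs H) \<and>
     (\<forall>e>0. \<exists>N. \<forall>m\<ge>N. \<forall>n\<ge>N. ip_norm H (s m - s n) < e)"

definition conv_in :: "'f::real_vector ip_space \<Rightarrow> (nat \<Rightarrow> 'f) \<Rightarrow> 'f \<Rightarrow> bool" where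
  "conv_in H s f \<longleftrightarrow> (\<forall>n. s n \<in> vecs H) \<and> f \<in> vecs H \<and> (\<lambda>n. ip_norm H (s n - f)) \<longlonglongrightarrow> 0"

lemma cauchy_in_mem: "cauchy_in H s \<Longrightarrow> s n \<in> vecs H"
  by (simp add: cauchy_in_def)

lemma conv_in_mem: "conv_in H s f \<Longrightarrow> s n \<in> vecs H" "conv_in H s f \<Longrightarrow> f \<in> vecs H"
  by (simp_all add: conv_in_def)


lemma conv_in_ex:
  assumes "conv_in H s f" "e > 0"
  shows "\<exists>n. ip_norm H (s n - f) < e"
proof -
  have "\<forall>\<^sub>F n in sequentially. ip_norm H (s n - f) < e"
    using assms by (auto simp: conv_in_def intro: order_tendstoD)
  then show ?thesis by (auto simp: eventually_sequentially)
qed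

locale semi_hilbert = bilinear_space +
  assumes ip_nonneg: "\<And>f. f \<in> vecs H \<Longrightarrow> 0 \<le> ip H f f"
begin

abbreviation nrm where "nrm \<equiv> ip_norm H"

lemma nrm_nonneg [simp]: "f \<in> vecs H \<Longrightarrow> 0 \<le> nrm f"
  by (simp add: ip_norm_def ip_nonneg)

lemma nrm_square: "f \<in> vecs H \<Longrightarrow> (nrm f)\<^sup>2 = ip H f f"
  by (simp add: ip_norm_def ip_nonneg)

lemma nrm_zero [simp]: "nrm 0 = 0"
  by (simp add: ip_norm_def ip_zero_left)

lemma nrm_scale: "f \<in> vecs H \<Longrightarrow> nrm (a *\<^sub>R f) = \<bar>a\<bar> * nrm f"
  by (simp add: ip_norm_def ip_simps real_sqrt_mult mult.assoc[symmetric])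

lemma nrm_minus: "f \<in> vecs H \<Longrightarrow> nrm (- f) = nrm f"
  using nrm_scale[of f "-1"] by simp

lemma nrm_diff_commute: "f \<in> vecs H \<Longrightarrow> g \<in> vecs H \<Longrightarrow> nrm (f - g) = nrm (g - f)"
  using nrm_minus[of "f - g"] by simp

text \<open>The quadratic polynomial in \<open>t\<close> is nonnegative. If \<open>g\<close> has
  norm zero it is affine and bounded below, so its slope must vanish; this replaces
  definiteness.\<close>

lemma Cauchy_Schwarz_square:
  assumes f: "f \<in> vecs H" and g: "g \<in> vecs H"
  shows "(ip H f g)\<^sup>2 \<le> ip H f f * ip H g g"
proof -
  have q: "0 \<le> ip H f f + 2 * t * ip H f g + t\<^sup>2 * ip H g g" for t
    using ip_nonneg[of "f + t *\<^sub>R g"] f g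
    by (simp add: ip_simps ip_commute[OF g f] power2_eq_square algebra_simps)
  show ?thesis
  proof (cases "ip H g g = 0")
    case True
    have "ip H f g = 0"
    proof (rule ccontr)
      assume "ip H f g \<noteq> 0"
      \<comment> \<open>At the chosen \<open>t\<close> the polynomial takes the value -1.\<close>
      then show False
        using q[of "- (ip H f f + 1) / (2 * ip H f g)"] True by (simp add: field_simps)
    qed
    then show ?thesis using f g ip_nonneg by simp
  next
    case False
    then have "ip H g g > 0" using ip_nonneg[OF g] by simp
    then show ?thesis
      using q[of "- ip H f g / ip H g g"] by (simp add: field_simps power2_eq_square)
  qed
qed

lemma Cauchy_Schwarz:
  assumes "f \<in> vecs H" "g \<in> vecs H"
  shows "\<bar>ip H f g\<bar> \<le> nrm f * nrm g"
proof -
  have "\<bar>ip H f g\<bar> = sqrt ((ip H f g)\<^sup>2)" by simp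
  also have "\<dots> \<le> sqrt (ip H f f * ip H g g)"
    using Cauchy_Schwarz_square[OF assms] by (rule real_sqrt_le_mono)
  finally show ?thesis by (simp add: ip_norm_def real_sqrt_mult)
qed

lemma nrm_triangle:
  assumes f: "f \<in> vecs H" and g: "g \<in> vecs H"
  shows "nrm (f + g) \<le> nrm f + nrm g"
proof (rule power2_le_imp_le)
  have "(nrm (f + g))\<^sup>2 = ip H f f + 2 * ip H f g + ip H g g"
    using f g by (simp add: nrm_square ip_simps ip_commute[OF g f])
  also have "\<dots> \<le> (nrm f + nrm g)\<^sup>2"
    using Cauchy_Schwarz[OF f g] f g by (simp add: power2_sum nrm_square)
  finally show "(nrm (f + g))\<^sup>2 \<le> (nrm f + nrm g)\<^sup>2" .
qed (use f g in auto)

lemma nrm_triangle_diff: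
  assumes "f \<in> vecs H" "g \<in> vecs H" "k \<in> vecs H"
  shows "nrm (f - k) \<le> nrm (f - g) + nrm (g - k)"
  using nrm_triangle[of "f - g" "g - k"] assms by simp

lemma nrm_bound_diff:
  assumes "f \<in> vecs H" "g \<in> vecs H"
  shows "\<bar>nrm f - nrm g\<bar> \<le> nrm (f - g)"
  using nrm_triangle[of "f - g" g] nrm_triangle[of "g - f" f] assms nrm_diff_commute[of f g]
  by simp

text \<open>A Lipschitz bound along the sequence transfers the Cauchy property to any space
  \<open>K\<close>. This single transfer serves scaling, adjoints and the components in a direct
  sum.\<close>

lemma cauchy_in_le:
  assumes "cauchy_in H s" and "\<And>n. t n \<in> vecs K"
    and le: "\<And>m n. ip_norm K (t m - t n) \<le> B * nrm (s m - s n)"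
  shows "cauchy_in K t"
  unfolding cauchy_in_def
proof (intro conjI allI impI)
  fix e :: real assume e: "e > 0"
  define d where "d = e / (\<bar>B\<bar> + 1)"
  have d: "d > 0" using e by (simp add: d_def add_pos_nonneg)
  then obtain N where N: "\<And>m n. m \<ge> N \<Longrightarrow> n \<ge> N \<Longrightarrow> nrm (s m - s n) < d"
    using assms(1) unfolding cauchy_in_def by meson
  have "ip_norm K (t m - t n) < e" if "m \<ge> N" "n \<ge> N" for m n
  proof -
    have "ip_norm K (t m - t n) \<le> B * nrm (s m - s n)" by (rule le)
    also have "\<dots> \<le> (\<bar>B\<bar> + 1) * nrm (s m - s n)"
      using assms(1) by (intro mult_right_mono) (auto simp: cauchy_in_mem)
    also have "\<dots> < (\<bar>B\<bar> + 1) * d"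
      using N[OF that] by (intro mult_strict_left_mono) auto
    finally show ?thesis by (simp add: d_def)
  qed
  then show "\<exists>N. \<forall>m\<ge>N. \<forall>n\<ge>N. ip_norm K (t m - t n) < e" by blast
qed (rule assms(2))

lemma cauchy_in_scale:
  assumes "cauchy_in H s"
  shows "cauchy_in H (\<lambda>n. a *\<^sub>R s n)"
  by (rule cauchy_in_le[OF assms, where B = "\<bar>a\<bar>"])
     (use assms in \<open>auto simp: cauchy_in_mem nrm_scale simp flip: scaleR_diff_right\<close>)

lemma cauchy_in_add:
  assumes "cauchy_in H s" "cauchy_in H t"
  shows "cauchy_in H (\<lambda>n. s n + t n)"
  unfolding cauchy_in_def
proof (intro conjI allI impI)
  fix e :: real assume "e > 0"
  then have e2: "e / 2 > 0" by simp
  from assms e2 obtain M N where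
    M: "\<And>m n. m \<ge> M \<Longrightarrow> n \<ge> M \<Longrightarrow> nrm (s m - s n) < e / 2" and
    N: "\<And>m n. m \<ge> N \<Longrightarrow> n \<ge> N \<Longrightarrow> nrm (t m - t n) < e / 2"
    unfolding cauchy_in_def by meson
  have "nrm (s m + t m - (s n + t n)) < e" if "m \<ge> max M N" "n \<ge> max M N" for m n
    using nrm_triangle[of "s m - s n" "t m - t n"] M[of m n] N[of m n] that assms
    by (simp add: cauchy_in_mem add_diff_add)
  then show "\<exists>N. \<forall>m\<ge>N. \<forall>n\<ge>N. nrm (s m + t m - (s n + t n)) < e" by blast
qed (use assms in \<open>simp add: cauchy_in_mem\<close>)

lemma cauchy_in_diff:
  assumes "cauchy_in H s" "cauchy_in H t"
  shows "cauchy_in H (\<lambda>n. s n - t n)"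
  using cauchy_in_add[OF assms(1) cauchy_in_scale[OF assms(2), of "-1"]] by simp

lemma cauchy_in_const: "f \<in> vecs H \<Longrightarrow> cauchy_in H (\<lambda>_. f)"
  by (auto simp: cauchy_in_def)

lemma cauchy_in_convergent_nrm:
  assumes "cauchy_in H s"
  shows "convergent (\<lambda>n. nrm (s n))"
proof -
  have "Cauchy (\<lambda>n. nrm (s n))"
  proof (rule metric_CauchyI)
    fix e :: real assume "e > 0"
    then obtain N where "\<And>m n. m \<ge> N \<Longrightarrow> n \<ge> N \<Longrightarrow> nrm (s m - s n) < e"
      using assms unfolding cauchy_in_def by meson
    then show "\<exists>M. \<forall>m\<ge>M. \<forall>n\<ge>M. dist (nrm (s m)) (nrm (s n)) < e"
      using nrm_bound_diff assms unfolding dist_real_def by (meson cauchy_in_mem order_le_less_trans)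
  qed
  then show ?thesis by (rule Cauchy_convergent)
qed

text \<open>Polarization expresses the inner product by the squared norms of
  \<open>s n + t n\<close> and \<open>s n - t n\<close>, which converge because both sequences are
  Cauchy.\<close>

lemma cauchy_in_convergent_ip:
  assumes "cauchy_in H s" "cauchy_in H t"
  shows "convergent (\<lambda>n. ip H (s n) (t n))"
proof -
  obtain a b where "(\<lambda>n. nrm (s n + t n)) \<longlonglongrightarrow> a" "(\<lambda>n. nrm (s n - t n)) \<longlonglongrightarrow> b"
    using cauchy_in_convergent_nrm[OF cauchy_in_add[OF assms]]
      cauchy_in_convergent_nrm[OF cauchy_in_diff[OF assms]]
    unfolding convergent_def by blast
  then have "(\<lambda>n. ((nrm (s n + t n))\<^sup>2 - (nrm (s n - t n))\<^sup>2) / 4) \<longlonglongrightarrow> (a\<^sup>2 - b\<^sup>2) / 4"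
    by (intro tendsto_intros) auto
  moreover have "((nrm (s n + t n))\<^sup>2 - (nrm (s n - t n))\<^sup>2) / 4 = ip H (s n) (t n)" for n
    using assms[THEN cauchy_in_mem]
    by (simp add: nrm_square ip_simps ip_commute[of "t n" "s n"])
  ultimately show ?thesis by (auto simp: convergent_def)
qed

text \<open>The norms of a Cauchy sequence converge and so stay bounded. This matters before
  completion, when \<open>t\<close> may have no limit in \<open>H\<close>.\<close>

lemma ip_tendsto_0:
  assumes s: "(\<lambda>n. nrm (s n)) \<longlonglongrightarrow> 0" "\<And>n. s n \<in> vecs H" and t: "cauchy_in H t"
  shows "(\<lambda>n. ip H (s n) (t n)) \<longlonglongrightarrow> 0"
proof -
  obtain a where "(\<lambda>n. nrm (t n)) \<longlonglongrightarrow> a"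
    using cauchy_in_convergent_nrm[OF t] by (auto simp: convergent_def)
  with s(1) have "(\<lambda>n. nrm (s n) * nrm (t n)) \<longlonglongrightarrow> 0 * a"
    by (rule tendsto_mult)
  then have "(\<lambda>n. nrm (s n) * nrm (t n)) \<longlonglongrightarrow> 0" by simp
  then show ?thesis
    by (rule Lim_null_comparison[rotated])
       (use s(2) t in \<open>auto intro!: always_eventually Cauchy_Schwarz simp: cauchy_in_mem\<close>)
qed

lemma conv_in_cauchy:
  assumes "conv_in H s f"
  shows "cauchy_in H s"
  unfolding cauchy_in_def
proof (intro conjI allI impI)
  fix e :: real assume "e > 0"
  then have "e / 2 > 0" by simp
  then obtain N where N: "\<And>n. n \<ge> N \<Longrightarrow> nrm (s n - f) < e / 2"
    using assms unfolding conv_in_def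
    by (metis (mono_tags, lifting) eventually_sequentially order_tendstoD(2))
  have "nrm (s m - s n) < e" if "m \<ge> N" "n \<ge> N" for m n
    using nrm_triangle_diff[of "s m" f "s n"] N[OF that(1)] N[OF that(2)] assms
      nrm_diff_commute[of "s n" f] by (simp add: conv_in_mem)
  then show "\<exists>N. \<forall>m\<ge>N. \<forall>n\<ge>N. nrm (s m - s n) < e" by blast
qed (use assms in \<open>simp add: conv_in_mem\<close>)

lemma conv_in_ip:
  assumes s: "conv_in H s f" and g: "g \<in> vecs H"
  shows "(\<lambda>n. ip H (s n) g) \<longlonglongrightarrow> ip H f g"
proof -
  have "(\<lambda>n. ip H (s n - f) g) \<longlonglongrightarrow> 0"
    using ip_tendsto_0[of "\<lambda>n. s n - f" "\<lambda>_. g"] s g by (simp add: conv_in_def cauchy_in_const)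
  then have "(\<lambda>n. ip H (s n - f) g + ip H f g) \<longlonglongrightarrow> 0 + ip H f g"
    by (intro tendsto_intros)
  then show ?thesis using s g by (simp add: ip_diff_left conv_in_mem)
qed

end

section \<open>Definite forms: the associated metric, completeness and density\<close>

locale pre_hilbert = bilinear_space +
  assumes ip_pos: "\<And>f. f \<in> vecs H \<Longrightarrow> f \<noteq> 0 \<Longrightarrow> 0 < ip H f f"

sublocale pre_hilbert \<subseteq> semi_hilbert
proof
  show "0 \<le> ip H f f" if "f \<in> vecs H" for f
    using ip_pos[OF that] ip_zero_left[of 0] by (cases "f = 0") auto
qed

context pre_hilbert
begin

lemma nrm_eq_0_iff: "f \<in> vecs H \<Longrightarrow> nrm f = 0 \<longleftrightarrow> f = 0"
  using ip_pos[of f] by (cases "f = 0") (auto simp: ip_norm_def ip_zero_left)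

lemma ip_dist_eq: "ip_dist H f g = (if f \<in> vecs H \<and> g \<in> vecs H then nrm (f - g) else 0)"
  by (simp add: ip_dist_def ip_norm_def)

lemma Metric_space_ip_dist: "Metric_space (vecs H) (ip_dist H)"
proof
  show "ip_dist H x y = ip_dist H y x" for x y
    by (simp add: ip_dist_eq nrm_diff_commute)
  show "ip_dist H x z \<le> ip_dist H x y + ip_dist H y z"
    if "x \<in> vecs H" "y \<in> vecs H" "z \<in> vecs H" for x y z
    using that by (simp add: ip_dist_eq nrm_triangle_diff)
qed (auto simp: ip_dist_eq nrm_eq_0_iff)

sublocale M: Metric_space "vecs H" "ip_dist H"
  by (rule Metric_space_ip_dist)

lemma MCauchy_iff: "M.MCauchy s \<longleftrightarrow> cauchy_in H s"
proof (cases "\<forall>n. s n \<in> vecs H")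
  case True
  then show ?thesis by (auto simp: M.MCauchy_def cauchy_in_def ip_dist_eq)
next
  case False
  then show ?thesis by (auto simp: M.MCauchy_def cauchy_in_def)
qed

lemma limitin_iff: "(\<forall>n. s n \<in> vecs H) \<Longrightarrow> limitin M.mtopology s f sequentially \<longleftrightarrow> conv_in H s f"
  by (auto simp: M.limitin_metric_dist_null conv_in_def ip_dist_eq)

lemma mcomplete_iff: "M.mcomplete \<longleftrightarrow> (\<forall>s. cauchy_in H s \<longrightarrow> (\<exists>f. conv_in H s f))"
  unfolding M.mcomplete_def MCauchy_iff by (metis cauchy_in_mem limitin_iff)

lemma dense_iff:
  "M.mtopology closure_of S = vecs H \<longleftrightarrow>
     (\<forall>f\<in>vecs H. \<exists>s. (\<forall>n. s n \<in> S) \<and> conv_in H s f)"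
proof -
  have "(\<forall>r>0. \<exists>y\<in>S. y \<in> M.mball f r) \<longleftrightarrow> (\<exists>s. (\<forall>n. s n \<in> S) \<and> conv_in H s f)"
    if f: "f \<in> vecs H" for f
  proof
    assume "\<forall>r>0. \<exists>y\<in>S. y \<in> M.mball f r"
    then have "\<exists>y. y \<in> S \<and> y \<in> M.mball f (inverse (real (Suc n)))" for n
      by (metis inverse_positive_iff_positive of_nat_0_less_iff zero_less_Suc)
    then obtain s where s: "\<And>n. s n \<in> S" "\<And>n. s n \<in> M.mball f (inverse (real (Suc n)))"
      by metis
    have sH: "s n \<in> vecs H" for n using s(2)[of n] by (simp add: M.in_mball)
    have "norm (nrm (s n - f)) \<le> inverse (real (Suc n))" for n
      using s(2)[of n] f sH[of n] by (simp add: M.in_mball ip_dist_eq nrm_diff_commute)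
    then have "(\<lambda>n. nrm (s n - f)) \<longlonglongrightarrow> 0"
      by (intro Lim_null_comparison[OF always_eventually LIMSEQ_inverse_real_of_nat]) blast
    then show "\<exists>s. (\<forall>n. s n \<in> S) \<and> conv_in H s f"
      using s f by (auto simp: conv_in_def M.in_mball)
  next
    assume "\<exists>s. (\<forall>n. s n \<in> S) \<and> conv_in H s f"
    then obtain s where s: "\<And>n. s n \<in> S" "conv_in H s f" by blast
    show "\<forall>r>0. \<exists>y\<in>S. y \<in> M.mball f r"
    proof (intro allI impI)
      fix r :: real assume "r > 0"
      then obtain n where "nrm (s n - f) < r"
        using conv_in_ex[OF s(2)] by blast
      then show "\<exists>y\<in>S. y \<in> M.mball f r"
        using s f by (intro bexI[of _ "s n"])
          (auto simp: M.in_mball ip_dist_eq nrm_diff_commute conv_in_mem)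
    qed
  qed
  then have "M.mtopology closure_of S = {f \<in> vecs H. \<exists>s. (\<forall>n. s n \<in> S) \<and> conv_in H s f}"
    unfolding M.metric_closure_of by (intro Collect_cong) metis
  then show ?thesis by (simp only: set_eq_iff mem_Collect_eq) metis
qed

end

lemma pre_hilbertI:
  assumes "semi_hilbert H" and "\<And>f. f \<in> vecs H \<Longrightarrow> ip H f f = 0 \<Longrightarrow> f = 0"
  shows "pre_hilbert H"
proof -
  interpret semi_hilbert H by fact
  show ?thesis by standard (metis assms(2) ip_nonneg less_le)
qed

locale hilbert = pre_hilbert +
  assumes complete: "\<And>s. cauchy_in H s \<Longrightarrow> \<exists>f. conv_in H s f"

lemma hilbert_space_iff: "hilbert_space H \<longleftrightarrow> hilbert H"
proof
  assume H: "hilbert_space H"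
  then interpret pre_hilbert H
    unfolding hilbert_space_def inner_product_space_iff pre_hilbert_def pre_hilbert_axioms_def by blast
  show "hilbert H"
    using H by unfold_locales (simp add: hilbert_space_def mcomplete_iff)
next
  assume "hilbert H"
  then interpret hilbert H .
  show "hilbert_space H"
    unfolding hilbert_space_def inner_product_space_iff mcomplete_iff
    using bilinear_space_axioms ip_pos complete by (auto simp: nrm_eq_0_iff[symmetric] ip_norm_def)
qed

text \<open>Completeness can be tested on a dense set \<open>D\<close>: replacing the
  \<open>n\<close>-th term of a Cauchy sequence by a point of \<open>D\<close> at distance below
  \<open>1/(n+1)\<close> alters neither the Cauchy property nor the limit.\<close>

lemma (in pre_hilbert) hilbertI:
  assumes "\<And>f. f \<in> vecs H \<Longrightarrow> \<exists>s. (\<forall>n. s n \<in> D) \<and> conv_in H s f"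
    and "\<And>s. (\<And>n. s n \<in> D) \<Longrightarrow> cauchy_in H s \<Longrightarrow> \<exists>f. conv_in H s f"
  shows "hilbert H"
proof
  fix s assume s: "cauchy_in H s"
  have "\<exists>d. d \<in> D \<and> d \<in> vecs H \<and> nrm (d - s n) < inverse (real (Suc n))" for n
  proof -
    obtain t where t: "\<And>n. t n \<in> D" "conv_in H t (s n)"
      using assms(1)[OF cauchy_in_mem[OF s]] by blast
    obtain k where "nrm (t k - s n) < inverse (real (Suc n))"
      using conv_in_ex[OF t(2), of "inverse (real (Suc n))"] by auto
    with t(1)[of k] conv_in_mem(1)[OF t(2), of k] show ?thesis by metis
  qed
  then obtain t where t: "\<And>n. t n \<in> D" "\<And>n. t n \<in> vecs H"
      "\<And>n. nrm (t n - s n) < inverse (real (Suc n))"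
    by metis
  have lim: "(\<lambda>n. nrm (t n - s n)) \<longlonglongrightarrow> 0"
    by (rule Lim_null_comparison[OF _ LIMSEQ_inverse_real_of_nat], rule always_eventually)
       (use t s in \<open>simp add: less_imp_le cauchy_in_mem del: of_nat_Suc\<close>)
  then have "conv_in H (\<lambda>n. t n - s n) 0"
    using t s by (simp add: conv_in_def cauchy_in_mem)
  from cauchy_in_add[OF s conv_in_cauchy[OF this]] have "cauchy_in H t" by simp
  then obtain f where f: "conv_in H t f" using assms(2) t(1) by blast
  have "(\<lambda>n. nrm (t n - s n) + nrm (t n - f)) \<longlonglongrightarrow> 0 + 0"
    using lim f unfolding conv_in_def by (intro tendsto_intros) auto
  then have "(\<lambda>n. nrm (t n - s n) + nrm (t n - f)) \<longlonglongrightarrow> 0" by simp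
  then have "(\<lambda>n. nrm (s n - f)) \<longlonglongrightarrow> 0"
  proof (rule Lim_null_comparison[rotated], intro always_eventually allI)
    fix n
    show "norm (nrm (s n - f)) \<le> nrm (t n - s n) + nrm (t n - f)"
      using nrm_triangle_diff[of "s n" "t n" f] t(2) f s
      by (simp add: conv_in_mem cauchy_in_mem nrm_diff_commute[of "s n" "t n"])
  qed
  then show "\<exists>f. conv_in H s f" using s f by (auto simp: conv_in_def cauchy_in_mem)
qed

section \<open>Kernels and functional completion\<close>

lemma reproducing_kernelD:
  assumes "reproducing_kernel Z F k"
  shows reproducing_kernel_zero: "f \<in> vecs F \<Longrightarrow> x \<notin> Z \<Longrightarrow> f x = 0"
    and reproducing_kernel_commute: "x \<in> Z \<Longrightarrow> y \<in> Z \<Longrightarrow> k x y = k y x"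
    and reproducing_kernel_mem: "x \<in> Z \<Longrightarrow> restr Z (k x) \<in> vecs F"
    and reproducing_kernel_eval: "x \<in> Z \<Longrightarrow> f \<in> vecs F \<Longrightarrow> f x = ip F f (restr Z (k x))"
  using assms unfolding reproducing_kernel_def functions_on_def by blast+

lemma conv_in_pointwise:
  assumes "semi_hilbert H" and k: "reproducing_kernel Z H k" and s: "conv_in H s f"
  shows "(\<lambda>n. s n x) \<longlonglongrightarrow> f x"
proof -
  interpret semi_hilbert H by fact
  show ?thesis
  proof (cases "x \<in> Z")
    case True
    then show ?thesis
      using conv_in_ip[OF s reproducing_kernel_mem[OF k True]] s
        reproducing_kernel_eval[OF k True] by (simp add: conv_in_mem)
  next
    case False
    then show ?thesis using s by (simp add: reproducing_kernel_zero[OF k] conv_in_mem)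
  qed
qed

lemma cauchy_in_pointwise:
  assumes "semi_hilbert H" and k: "reproducing_kernel Z H k" and s: "cauchy_in H s"
  shows "convergent (\<lambda>n. s n x)"
proof -
  interpret semi_hilbert H by fact
  show ?thesis
  proof (cases "x \<in> Z")
    case True
    then show ?thesis
      using cauchy_in_convergent_ip[OF s cauchy_in_const[OF reproducing_kernel_mem[OF k True]]] s
        reproducing_kernel_eval[OF k True] by (simp add: cauchy_in_mem)
  next
    case False
    then show ?thesis using s by (simp add: reproducing_kernel_zero[OF k] cauchy_in_mem convergent_const)
  qed
qed

text \<open>The norm limit exists by completeness and agrees with the pointwise limit. In this form
  the completeness of the factors enters the criterion for the tensor product.\<close>

lemma cauchy_in_pointwise_zero:
  assumes "hilbert H" and k: "reproducing_kernel Z H k" and s: "cauchy_in H s" "\<And>x. (\<lambda>n. s n x) \<longlonglongrightarrow> 0"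
  shows "conv_in H s 0"
proof -
  interpret hilbert H by fact
  obtain f where f: "conv_in H s f" using complete[OF s(1)] by blast
  have "f x = 0" for x
    using conv_in_pointwise[OF semi_hilbert_axioms k f] s(2) by (rule LIMSEQ_unique)
  then have "f = 0" by auto
  with f show ?thesis by simp
qed

section \<open>Completion of a function space within the functions\<close>

definition approx :: "('a \<Rightarrow> real) ip_space \<Rightarrow> (nat \<Rightarrow> 'a \<Rightarrow> real) \<Rightarrow> ('a \<Rightarrow> real) \<Rightarrow> bool" where
  "approx E s f \<longleftrightarrow> cauchy_in E s \<and> (\<forall>x. (\<lambda>n. s n x) \<longlonglongrightarrow> f x)"

text \<open>The inner product is computed along sequences picked by \<open>SOME\<close>; under the
  assumption \<open>null\<close> of \<open>completable\<close> every other choice of sequences has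
  the same limit, see \<open>ip_completion_lim\<close>.\<close>

definition completion :: "('a \<Rightarrow> real) ip_space \<Rightarrow> ('a \<Rightarrow> real) ip_space" where
  "completion E = \<lparr>vecs = {f. \<exists>s. approx E s f},
     ip = \<lambda>f g. lim (\<lambda>n. ip E ((SOME s. approx E s f) n) ((SOME s. approx E s g) n))\<rparr>"

text \<open>Aronszajn's criterion for a completion to be realizable by functions.\<close>

locale completable = pre_hilbert E for E :: "('a \<Rightarrow> real) ip_space" +
  fixes Z :: "'a set" and K :: "'a \<Rightarrow> 'a \<Rightarrow> real"
  assumes kernel: "reproducing_kernel Z E K"
    and null: "\<And>s. cauchy_in E s \<Longrightarrow> (\<And>x. (\<lambda>n. s n x) \<longlonglongrightarrow> 0) \<Longrightarrow> (\<lambda>n. ip_norm E (s n)) \<longlonglongrightarrow> 0"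
begin

abbreviation "H \<equiv> completion E"

lemma mem_completion_iff: "f \<in> vecs H \<longleftrightarrow> (\<exists>s. approx E s f)"
  by (simp add: completion_def)

lemma approx_unique:
  assumes "approx E s f" "approx E t f"
  shows "(\<lambda>n. nrm (s n - t n)) \<longlonglongrightarrow> 0"
proof (rule null)
  show "(\<lambda>n. (s n - t n) x) \<longlonglongrightarrow> 0" for x
    using tendsto_diff[of "\<lambda>n. s n x" "f x" _ "\<lambda>n. t n x" "f x"] assms by (simp add: approx_def)
qed (use assms in \<open>auto simp: approx_def intro: cauchy_in_diff\<close>)

lemma ip_completion_lim:
  assumes s: "approx E s f" and t: "approx E t g"
  shows "(\<lambda>n. ip E (s n) (t n)) \<longlonglongrightarrow> ip H f g"
proof -
  define u v where "u = (SOME s. approx E s f)" and "v = (SOME s. approx E s g)"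
  have u: "approx E u f" unfolding u_def by (rule someI[of "\<lambda>s. approx E s f", OF s])
  have v: "approx E v g" unfolding v_def by (rule someI[of "\<lambda>s. approx E s g", OF t])
  have c: "cauchy_in E s" "cauchy_in E t" "cauchy_in E u" "cauchy_in E v"
    using s t u v by (simp_all add: approx_def)
  note m = c[THEN cauchy_in_mem]
  have "(\<lambda>n. ip E (u n) (v n)) \<longlonglongrightarrow> ip H f g"
    using cauchy_in_convergent_ip[OF c(3,4)]
    by (simp add: completion_def u_def v_def convergent_LIMSEQ_iff)
  moreover have "(\<lambda>n. ip E (s n - u n) (t n)) \<longlonglongrightarrow> 0"
    using ip_tendsto_0[OF approx_unique[OF s u] _ c(2)] m by simp
  moreover have "(\<lambda>n. ip E (t n - v n) (u n)) \<longlonglongrightarrow> 0"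
    using ip_tendsto_0[OF approx_unique[OF t v] _ c(3)] m by simp
  \<comment> \<open>Two corrections lead from the picked pair \<open>u\<close>, \<open>v\<close> to
    the given pair \<open>s\<close>, \<open>t\<close>. Each pairs a difference that tends to zero by
    \<open>approx_unique\<close> with a Cauchy sequence.\<close>
  ultimately have "(\<lambda>n. ip E (u n) (v n) + ip E (s n - u n) (t n) + ip E (t n - v n) (u n))
      \<longlonglongrightarrow> ip H f g + 0 + 0"
    by (intro tendsto_add)
  moreover have "ip E (u n) (v n) + ip E (s n - u n) (t n) + ip E (t n - v n) (u n) = ip E (s n) (t n)" for n
    using m by (simp add: ip_simps ip_commute[of "t n" "u n"] ip_commute[of "v n" "u n"])
  ultimately show ?thesis by simp
qed

lemma approx_const: "f \<in> vecs E \<Longrightarrow> approx E (\<lambda>_. f) f"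
  by (simp add: approx_def cauchy_in_const)

lemma approx_add: "approx E s f \<Longrightarrow> approx E t g \<Longrightarrow> approx E (\<lambda>n. s n + t n) (f + g)"
  by (auto simp: approx_def intro!: cauchy_in_add tendsto_add)

lemma approx_scale: "approx E s f \<Longrightarrow> approx E (\<lambda>n. a *\<^sub>R s n) (a *\<^sub>R f)"
  by (auto simp: approx_def intro!: cauchy_in_scale tendsto_mult_left)

lemma vecs_completion: "vecs E \<subseteq> vecs H"
  using approx_const mem_completion_iff by blast

lemma ip_completion: "f \<in> vecs E \<Longrightarrow> g \<in> vecs E \<Longrightarrow> ip H f g = ip E f g"
  using ip_completion_lim[OF approx_const approx_const, of f g] LIMSEQ_const_iff by metis

lemma bilinear_completion: "bilinear_space H"
proof
  show "subspace (vecs H)"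
  proof (rule subspaceI)
    show "0 \<in> vecs H" using vecs_completion zero_mem by blast
    show "f + g \<in> vecs H" if "f \<in> vecs H" "g \<in> vecs H" for f g
      using that approx_add unfolding mem_completion_iff by blast
    show "a *\<^sub>R f \<in> vecs H" if "f \<in> vecs H" for a f
      using that approx_scale unfolding mem_completion_iff by blast
  qed
next
  fix f g assume "f \<in> vecs H" "g \<in> vecs H"
  then obtain s t where s: "approx E s f" and t: "approx E t g"
    unfolding mem_completion_iff by blast
  then have m: "s n \<in> vecs E" "t n \<in> vecs E" for n by (auto simp: approx_def cauchy_in_mem)
  have "(\<lambda>n. ip E (s n) (t n)) \<longlonglongrightarrow> ip H g f"
    using ip_completion_lim[OF t s] m ip_commute by simp
  with ip_completion_lim[OF s t] show "ip H f g = ip H g f" by (rule LIMSEQ_unique)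
  have "(\<lambda>n. ip E (a *\<^sub>R s n) (t n)) \<longlonglongrightarrow> a * ip H f g" for a
    using tendsto_mult_left[OF ip_completion_lim[OF s t]] m by (simp add: ip_simps)
  with ip_completion_lim[OF approx_scale[OF s] t] show "ip H (a *\<^sub>R f) g = a * ip H f g" for a
    by (rule LIMSEQ_unique)
  fix k assume "k \<in> vecs H"
  then obtain r where r: "approx E r k" unfolding mem_completion_iff by blast
  then have "r n \<in> vecs E" for n by (auto simp: approx_def cauchy_in_mem)
  with m have "(\<lambda>n. ip E (s n + t n) (r n)) \<longlonglongrightarrow> ip H f k + ip H g k"
    using tendsto_add[OF ip_completion_lim[OF s r] ip_completion_lim[OF t r]] by (simp add: ip_simps)
  with ip_completion_lim[OF approx_add[OF s t] r] show "ip H (f + g) k = ip H f k + ip H g k"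
    by (rule LIMSEQ_unique)
qed

lemma approx_nrm:
  assumes "approx E s f"
  shows "(\<lambda>n. nrm (s n)) \<longlonglongrightarrow> ip_norm H f"
  unfolding ip_norm_def using ip_completion_lim[OF assms assms] by (rule tendsto_real_sqrt)

text \<open>While \<open>null\<close> makes the inner product well defined, definiteness comes from
  the kernel: if the limit norm is zero, the approximating sequence tends to zero in
  \<open>E\<close>, hence pointwise, and its pointwise limit \<open>f\<close> is zero.\<close>

lemma pre_hilbert_completion: "pre_hilbert H"
proof (rule pre_hilbertI)
  interpret C: bilinear_space H by (rule bilinear_completion)
  show "semi_hilbert H"
  proof
    fix f assume "f \<in> vecs H"
    then obtain s where s: "approx E s f" unfolding mem_completion_iff by blast
    then have "s n \<in> vecs E" for n by (auto simp: approx_def cauchy_in_mem)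
    with ip_completion_lim[OF s s] show "0 \<le> ip H f f"
      by (intro LIMSEQ_le_const) (auto simp: ip_nonneg)
  qed
  fix f assume f: "f \<in> vecs H" "ip H f f = 0"
  then obtain s where s: "approx E s f" unfolding mem_completion_iff by blast
  then have m: "s n \<in> vecs E" for n by (auto simp: approx_def cauchy_in_mem)
  have "(\<lambda>n. nrm (s n)) \<longlonglongrightarrow> 0"
    using approx_nrm[OF s] f by (simp add: ip_norm_def)
  then have "conv_in E s 0" using m by (simp add: conv_in_def)
  then have "(\<lambda>n. s n x) \<longlonglongrightarrow> 0" for x
    using conv_in_pointwise[OF semi_hilbert_axioms kernel] by fastforce
  moreover have "(\<lambda>n. s n x) \<longlonglongrightarrow> f x" for x
    using s by (simp add: approx_def)
  ultimately have "f x = 0" for x by (metis LIMSEQ_unique)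
  then show "f = 0" by auto
qed

lemma approx_conv_in:
  assumes s: "approx E s f"
  shows "conv_in H s f"
proof -
  interpret C: pre_hilbert H by (rule pre_hilbert_completion)
  have c: "cauchy_in E s" using s by (simp add: approx_def)
  have f: "f \<in> vecs H" using s mem_completion_iff by blast
  have m: "s n \<in> vecs E" "s n \<in> vecs H" for n
    using cauchy_in_mem[OF c] vecs_completion by auto
  have "(\<lambda>n. C.nrm (s n - f)) \<longlonglongrightarrow> 0"
  proof (rule LIMSEQ_I)
    fix e :: real assume "e > 0"
    then have "e / 2 > 0" by simp
    then obtain N where N: "\<And>m n. m \<ge> N \<Longrightarrow> n \<ge> N \<Longrightarrow> nrm (s m - s n) < e / 2"
      using c unfolding cauchy_in_def by meson
    have "C.nrm (s n - f) \<le> e / 2" if n: "n \<ge> N" for n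
    proof -
      \<comment> \<open>For fixed \<open>n\<close> the differences \<open>s n - s k\<close>
        approximate \<open>s n - f\<close>, whose norm is thus a limit in \<open>k\<close> of norms
        that are eventually below \<open>e / 2\<close>.\<close>
      have "approx E (\<lambda>k. s n + (-1) *\<^sub>R s k) (s n + (-1) *\<^sub>R f)"
        by (intro approx_add approx_scale approx_const s m)
      then have "(\<lambda>k. nrm (s n - s k)) \<longlonglongrightarrow> C.nrm (s n - f)"
        using approx_nrm by fastforce
      then show ?thesis
        by (rule LIMSEQ_le_const2) (use N n in \<open>auto intro!: exI[of _ N] simp: less_imp_le\<close>)
    qed
    then show "\<exists>no. \<forall>n\<ge>no. norm (C.nrm (s n - f) - 0) < e"
      using \<open>e > 0\<close> m f by (intro exI[of _ N]) fastforce
  qed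
  then show ?thesis using m f by (simp add: conv_in_def)
qed

lemma dense_completion: "f \<in> vecs H \<Longrightarrow> \<exists>s. (\<forall>n. s n \<in> vecs E) \<and> conv_in H s f"
  using approx_conv_in unfolding mem_completion_iff approx_def by (meson cauchy_in_mem)

text \<open>By density only sequences from \<open>E\<close> have to be considered. They are Cauchy
  in \<open>E\<close> as well, converge pointwise because evaluations are continuous, and their
  limits belong to the completion by construction.\<close>

lemma hilbert_completion: "hilbert H"
proof -
  interpret C: pre_hilbert H by (rule pre_hilbert_completion)
  show ?thesis
  proof (rule C.hilbertI)
    fix s assume m: "\<And>n. s n \<in> vecs E" and s: "cauchy_in H s"
    have "cauchy_in E s"
      using s m by (simp add: cauchy_in_def ip_norm_def ip_completion)
    moreover have "\<exists>f. \<forall>x. (\<lambda>n. s n x) \<longlonglongrightarrow> f x"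
      using cauchy_in_pointwise[OF semi_hilbert_axioms kernel \<open>cauchy_in E s\<close>] unfolding convergent_def by metis
    ultimately show "\<exists>f. conv_in H s f"
      using approx_conv_in unfolding approx_def by blast
  qed (use dense_completion in auto)
qed

lemma reproducing_kernel_completion: "reproducing_kernel Z H K"
  unfolding reproducing_kernel_def
proof (intro conjI ballI)
  show "vecs H \<subseteq> functions_on Z"
  proof
    fix f assume "f \<in> vecs H"
    then obtain s where s: "approx E s f" unfolding mem_completion_iff by blast
    have "f x = 0" if "x \<notin> Z" for x
    proof -
      have "s n x = 0" for n
        using s reproducing_kernel_zero[OF kernel _ that] by (auto simp: approx_def cauchy_in_mem)
      then have "(\<lambda>n. s n x) \<longlonglongrightarrow> 0" by simp
      with s show ?thesis unfolding approx_def by (metis LIMSEQ_unique)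
    qed
    then show "f \<in> functions_on Z" by (simp add: functions_on_def)
  qed
next
  show "K x y = K y x" if "x \<in> Z" "y \<in> Z" for x y
    using reproducing_kernel_commute[OF kernel that] .
next
  fix x assume x: "x \<in> Z"
  note kx = reproducing_kernel_mem[OF kernel x]
  show "restr Z (K x) \<in> vecs H" using kx vecs_completion by blast
  fix f assume "f \<in> vecs H"
  then obtain s where s: "approx E s f" unfolding mem_completion_iff by blast
  then have "(\<lambda>n. s n x) \<longlonglongrightarrow> ip H f (restr Z (K x))"
    using ip_completion_lim[OF s approx_const[OF kx]] reproducing_kernel_eval[OF kernel x]
    by (simp add: approx_def cauchy_in_mem)
  with s show "f x = ip H f (restr Z (K x))"
    unfolding approx_def by (metis LIMSEQ_unique)
qed

end

section \<open>Hilbert tensor products\<close>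

locale bounded_map = D: pre_hilbert D + E: semi_hilbert E
  for D :: "'d::real_vector ip_space" and E :: "'e::real_vector ip_space" +
  fixes \<tau> :: "'d \<Rightarrow> 'e" and B :: real
  assumes bound_nonneg: "0 \<le> B"
    and map_mem [simp]: "\<And>u. u \<in> vecs D \<Longrightarrow> \<tau> u \<in> vecs E"
    and map_bound: "\<And>u. u \<in> vecs D \<Longrightarrow> ip_norm E (\<tau> u) \<le> B * ip_norm D u"
begin

text \<open>A relation, because \<open>D\<close> is not assumed complete here and an
  \<open>f\<close> may have no image. Existence is collected on generators by
  \<open>adj_span\<close> and carried to limits by \<open>adj_limit\<close>. When
  \<open>\<tau>\<close> is tensoring with a fixed vector, \<open>g\<close> is the contraction of
  \<open>f\<close> with that vector.\<close>

definition adj :: "'e \<Rightarrow> 'd \<Rightarrow> bool" where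
  "adj f g \<longleftrightarrow> f \<in> vecs E \<and> g \<in> vecs D \<and> (\<forall>u\<in>vecs D. ip D g u = ip E f (\<tau> u))"

lemma adjD: "adj f g \<Longrightarrow> g \<in> vecs D" "adj f g \<Longrightarrow> u \<in> vecs D \<Longrightarrow> ip D g u = ip E f (\<tau> u)"
  by (simp_all add: adj_def)

lemma adj_zero: "adj 0 0"
  by (simp add: adj_def D.ip_simps E.ip_simps)

lemma adj_add: "adj f g \<Longrightarrow> adj f' g' \<Longrightarrow> adj (f + f') (g + g')"
  by (simp add: adj_def D.ip_simps E.ip_simps)

lemma adj_scale: "adj f g \<Longrightarrow> adj (a *\<^sub>R f) (a *\<^sub>R g)"
  by (simp add: adj_def D.ip_simps E.ip_simps)

lemma adj_diff: "adj f g \<Longrightarrow> adj f' g' \<Longrightarrow> adj (f - f') (g - g')"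
  by (simp add: adj_def D.ip_simps E.ip_simps)

text \<open>Testing the defining identity at \<open>g\<close> itself and applying Cauchy-Schwarz
  bounds the squared norm of \<open>g\<close> by \<open>B\<close> times the norms of
  \<open>f\<close> and \<open>g\<close>; one factor cancels.\<close>

lemma adj_bound:
  assumes "adj f g"
  shows "D.nrm g \<le> B * E.nrm f"
proof -
  have m: "f \<in> vecs E" "g \<in> vecs D" using assms by (auto simp: adj_def)
  have "(D.nrm g)\<^sup>2 = ip E f (\<tau> g)"
    using assms m by (simp add: D.nrm_square adj_def)
  also have "\<dots> \<le> E.nrm f * E.nrm (\<tau> g)"
    using E.Cauchy_Schwarz[of f "\<tau> g"] m by simp
  also have "\<dots> \<le> E.nrm f * (B * D.nrm g)"
    using m by (intro mult_left_mono map_bound) auto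
  finally have le: "D.nrm g * D.nrm g \<le> (B * E.nrm f) * D.nrm g"
    by (simp add: power2_eq_square mult_ac)
  show ?thesis
  proof (cases "D.nrm g > 0")
    case True
    with le show ?thesis by simp
  next
    case False
    with m have "D.nrm g = 0" using D.nrm_nonneg[of g] by linarith
    then show ?thesis using m bound_nonneg by simp
  qed
qed

lemma adj_span:
  assumes "\<And>d. d \<in> S \<Longrightarrow> \<exists>g. adj d g" and "f \<in> span S"
  shows "\<exists>g. adj f g"
  using assms(2)
proof (induction rule: span_induct_alt)
  case base
  show ?case using adj_zero by blast
next
  case (step c x y)
  then show ?case using assms(1) adj_add adj_scale by blast
qed

lemma adj_cauchy:
  assumes "cauchy_in E s" and "\<And>n. adj (s n) (t n)"
  shows "cauchy_in D t"
  by (rule E.cauchy_in_le[OF assms(1)]) (use assms(2) adj_diff adj_bound adjD in blast)+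

text \<open>By \<open>adj_bound\<close> the images of a convergent sequence are Cauchy, so
  completeness of \<open>D\<close> supplies \<open>g\<close>, and both sides of the defining
  identity are continuous.\<close>

lemma adj_limit:
  assumes "hilbert D" and s: "conv_in E s f" and t: "\<And>n. adj (s n) (t n)"
  shows "\<exists>g. adj f g"
proof -
  obtain g where g: "conv_in D t g"
    using hilbert.complete[OF assms(1) adj_cauchy[OF E.conv_in_cauchy[OF s] t]] by blast
  have "ip D g u = ip E f (\<tau> u)" if u: "u \<in> vecs D" for u
  proof (rule LIMSEQ_unique)
    show "(\<lambda>n. ip D (t n) u) \<longlonglongrightarrow> ip D g u" using g u by (rule D.conv_in_ip)
    show "(\<lambda>n. ip D (t n) u) \<longlonglongrightarrow> ip E f (\<tau> u)"
      using E.conv_in_ip[OF s map_mem[OF u]] adjD(2)[OF t u] by simp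
  qed
  with conv_in_mem(2)[OF g] conv_in_mem(2)[OF s] show ?thesis unfolding adj_def by blast
qed

end

subsection \<open>The algebraic tensor product\<close>

lemma tensor_fun_apply [simp]: "tensor_fun f g (x, y) = f x * g y"
  by (simp add: tensor_fun_def)

definition tensor_sum :: "(('a \<Rightarrow> real) \<times> ('b \<Rightarrow> real)) list \<Rightarrow> 'a \<times> 'b \<Rightarrow> real" where
  "tensor_sum L = (\<Sum>(a, b)\<leftarrow>L. tensor_fun a b)"

definition gram :: "('a \<Rightarrow> real) ip_space \<Rightarrow> ('b \<Rightarrow> real) ip_space \<Rightarrow>
    (('a \<Rightarrow> real) \<times> ('b \<Rightarrow> real)) list \<Rightarrow> (('a \<Rightarrow> real) \<times> ('b \<Rightarrow> real)) list \<Rightarrow> real" where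
  "gram H1 H2 L M = (\<Sum>(a, b)\<leftarrow>L. \<Sum>(c, d)\<leftarrow>M. ip H1 a c * ip H2 b d)"

text \<open>The elements are functions, but the inner product is computed from representing lists
  picked by \<open>SOME\<close>. That it depends on the functions alone is
  \<open>gram_cong2\<close>.\<close>

definition alg_tensor ::
    "('a \<Rightarrow> real) ip_space \<Rightarrow> ('b \<Rightarrow> real) ip_space \<Rightarrow> ('a \<times> 'b \<Rightarrow> real) ip_space" where
  "alg_tensor H1 H2 = \<lparr>vecs = tensor_sum ` lists (vecs H1 \<times> vecs H2),
     ip = \<lambda>f g. gram H1 H2 (SOME L. L \<in> lists (vecs H1 \<times> vecs H2) \<and> tensor_sum L = f)
       (SOME L. L \<in> lists (vecs H1 \<times> vecs H2) \<and> tensor_sum L = g)\<rparr>"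

lemma tensor_sum_simps [simp]:
  "tensor_sum [] = 0"
  "tensor_sum ((a, b) # L) = tensor_fun a b + tensor_sum L"
  "tensor_sum (L @ M) = tensor_sum L + tensor_sum M"
  by (simp_all add: tensor_sum_def)

locale two_pre_hilbert = H1: pre_hilbert H1 + H2: pre_hilbert H2
  for H1 :: "('a \<Rightarrow> real) ip_space" and H2 :: "('b \<Rightarrow> real) ip_space"
begin

abbreviation "reps \<equiv> lists (vecs H1 \<times> vecs H2)"
abbreviation "G \<equiv> gram H1 H2"
abbreviation "A \<equiv> alg_tensor H1 H2"

lemma gram_simps:
  "G [] M = 0" "G ((a, b) # L) M = (\<Sum>(c, d)\<leftarrow>M. ip H1 a c * ip H2 b d) + G L M"
  "G (L @ L') M = G L M + G L' M"
  by (simp_all add: gram_def)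

lemma gram_commute:
  assumes "L \<in> reps" "M \<in> reps"
  shows "G L M = G M L"
proof -
  have r: "G M [] = 0" for M by (induction M) (auto simp: gram_def)
  have c: "G M ((a, b) # L) = (\<Sum>(c, d)\<leftarrow>M. ip H1 c a * ip H2 d b) + G M L" for M a b L
    by (induction M) (auto simp: gram_def algebra_simps)
  have s: "(\<Sum>(c, d)\<leftarrow>M. ip H1 a c * ip H2 b d) = (\<Sum>(c, d)\<leftarrow>M. ip H1 c a * ip H2 d b)"
    if "a \<in> vecs H1" "b \<in> vecs H2" for a b
    using assms(2) that
    by (induction M) (auto simp: H1.ip_commute[of a] H2.ip_commute[of b])
  show ?thesis
    using assms(1) by (induction L) (auto simp: r c s gram_simps)
qed

text \<open>The right-hand side shows that the left-hand side depends on the list only through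
  the function that it represents.\<close>

lemma sum_list_contraction:
  assumes "M \<in> reps" "a \<in> vecs H1" "b \<in> vecs H2"
  shows "(\<Sum>(c, d)\<leftarrow>M. ip H1 a c * ip H2 b d) =
    ip H1 a (\<lambda>x. ip H2 b (\<lambda>y. tensor_sum M (x, y)))"
proof -
  have 1: "(\<lambda>y. tensor_sum M (x, y)) \<in> vecs H2" if "M \<in> reps" for x M
    using that
  proof (induction M)
    case Nil
    have "(\<lambda>y. 0) = (0 :: 'b \<Rightarrow> real)" by auto
    then show ?case by simp
  next
    case (Cons p M)
    then obtain c d where p: "p = (c, d)" "c \<in> vecs H1" "d \<in> vecs H2" by auto
    have "(\<lambda>y. tensor_sum (p # M) (x, y)) = c x *\<^sub>R d + (\<lambda>y. tensor_sum M (x, y))"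
      by (auto simp: p)
    then show ?case using Cons p by simp
  qed
  \<comment> \<open>Membership of the contracted function in \<open>H1\<close> is part of the
    induction, since \<open>ip H1 a\<close> can be expanded over the next summand only inside
    \<open>H1\<close>.\<close>
  have "(\<lambda>x. ip H2 b (\<lambda>y. tensor_sum M (x, y))) \<in> vecs H1 \<and> (\<Sum>(c, d)\<leftarrow>M. ip H1 a c * ip H2 b d) =
    ip H1 a (\<lambda>x. ip H2 b (\<lambda>y. tensor_sum M (x, y)))"
    using assms(1)
  proof (induction M)
    case Nil
    have "(\<lambda>y. 0) = (0 :: 'b \<Rightarrow> real)" "(\<lambda>y. 0) = (0 :: 'a \<Rightarrow> real)" by auto
    then show ?case using assms by (simp add: H1.ip_simps H2.ip_simps)
  next
    case (Cons p M)
    then obtain c d where p: "p = (c, d)" "c \<in> vecs H1" "d \<in> vecs H2" by auto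
    have e: "(\<lambda>y. tensor_sum (p # M) (x, y)) = c x *\<^sub>R d + (\<lambda>y. tensor_sum M (x, y))" for x
      by (auto simp: p)
    have "(\<lambda>x. ip H2 b (\<lambda>y. tensor_sum (p # M) (x, y))) =
        ip H2 b d *\<^sub>R c + (\<lambda>x. ip H2 b (\<lambda>y. tensor_sum M (x, y)))"
      unfolding e using 1[of M] Cons p assms by (auto simp: H2.ip_simps)
    then show ?case using Cons p assms by (simp add: H1.ip_simps)
  qed
  then show ?thesis by simp
qed

lemma gram_cong:
  assumes "L \<in> reps" "M \<in> reps" "M' \<in> reps" "tensor_sum M = tensor_sum M'"
  shows "G L M = G L M'"
  using assms(1)
proof (induction L)
  case (Cons p L)
  then obtain a b where p: "p = (a, b)" "a \<in> vecs H1" "b \<in> vecs H2" by (cases p) auto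
  then show ?case
    using Cons sum_list_contraction[OF assms(2) p(2,3)] sum_list_contraction[OF assms(3) p(2,3)]
    by (simp add: gram_simps assms(4))
qed (simp add: gram_simps)

lemma gram_cong2:
  assumes "L \<in> reps" "L' \<in> reps" "M \<in> reps" "M' \<in> reps"
    and "tensor_sum L = tensor_sum L'" "tensor_sum M = tensor_sum M'"
  shows "G L M = G L' M'"
  using assms gram_cong gram_commute by metis

lemma mem_alg_tensor: "f \<in> vecs A \<longleftrightarrow> (\<exists>L\<in>reps. tensor_sum L = f)"
  by (auto simp: alg_tensor_def)

lemma ip_alg_tensor:
  assumes "L \<in> reps" "M \<in> reps"
  shows "ip A (tensor_sum L) (tensor_sum M) = G L M"
proof -
  let ?P = "\<lambda>N L. L \<in> reps \<and> tensor_sum L = tensor_sum N"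
  have "?P L (SOME L'. ?P L L')" "?P M (SOME L'. ?P M L')"
    using someI[of "?P L" L] someI[of "?P M" M] assms by auto
  then show ?thesis
    using assms by (auto simp: alg_tensor_def intro: gram_cong2)
qed

lemma gram_scale:
  "G (map (\<lambda>(a, b). (r *\<^sub>R a, b)) L) M = r * G L M" if "L \<in> reps" "M \<in> reps"
proof -
  have "(\<Sum>(c, d)\<leftarrow>M. ip H1 (r *\<^sub>R a) c * ip H2 b d) = r * (\<Sum>(c, d)\<leftarrow>M. ip H1 a c * ip H2 b d)"
    if "a \<in> vecs H1" for a b
    using \<open>M \<in> reps\<close> that by (induction M) (auto simp: H1.ip_simps algebra_simps)
  with that(1) show ?thesis by (induction L) (auto simp: gram_simps algebra_simps)
qed

lemma tensor_sum_scale: "tensor_sum (map (\<lambda>(a, b). (r *\<^sub>R a, b)) L) = r *\<^sub>R tensor_sum L"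
  by (induction L) (auto simp: fun_eq_iff algebra_simps)

lemma reps_scale: "L \<in> reps \<Longrightarrow> map (\<lambda>(a, b). (r *\<^sub>R a, b)) L \<in> reps"
  by (induction L) auto

text \<open>Orthogonalizing the other first factors against the first one splits off a
  nonnegative term and shortens the list.\<close>

lemma gram_nonneg:
  assumes "L \<in> reps"
  shows "0 \<le> G L L"
  using assms
proof (induction L rule: length_induct)
  case (1 L)
  show ?case
  proof (cases L)
    case Nil
    then show ?thesis by (simp add: gram_simps)
  next
    case (Cons p L')
    then obtain a b where p: "p = (a, b)" and a: "a \<in> vecs H1" and b: "b \<in> vecs H2"
      using 1 by (cases p) auto
    have L': "L' \<in> reps" using 1 Cons by auto
    show ?thesis
    proof (cases "a = 0")
      case True
      have "tensor_sum L = tensor_sum L'"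
        using True by (auto simp: Cons p fun_eq_iff)
      then have "G L L = G L' L'" using L' 1 by (auto intro: gram_cong2)
      then show ?thesis using 1 L' Cons by auto
    next
      case False
      then have aa: "ip H1 a a > 0" using H1.ip_pos a by blast
      \<comment> \<open>\<open>q c\<close> is the coefficient of the projection of \<open>c\<close>
        onto \<open>a\<close>. The components along \<open>a\<close> are collected in the second
        factor \<open>b'\<close>, and what remains is the list \<open>N\<close>, whose first factors
        are orthogonal to \<open>a\<close>.\<close>
      define q where "q c = ip H1 a c / ip H1 a a" for c
      define N where "N = map (\<lambda>(c, d). (c - q c *\<^sub>R a, d)) L'"
      define b' where "b' = b + (\<Sum>(c, d)\<leftarrow>L'. q c *\<^sub>R d)"
      have ortho: "c - q c *\<^sub>R a \<in> vecs H1" "ip H1 a (c - q c *\<^sub>R a) = 0" if "c \<in> vecs H1" for c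
        using that a aa by (simp_all only: H1.diff_mem H1.scale_mem) (simp add: H1.ip_simps q_def)
      have N: "N \<in> reps" using L' unfolding N_def
        by (simp only: in_lists_conv_set set_map) (auto simp del: minus_apply intro!: ortho)
      have "(\<Sum>(c, d)\<leftarrow>L'. q c *\<^sub>R d) \<in> vecs H2" using L'
      proof (induction L')
        case (Cons r L')
        then show ?case
          by (cases r) (simp only: list.map sum_list.Cons case_prod_conv H2.add_mem H2.scale_mem
              Cons_in_lists_iff mem_Sigma_iff)
      qed (simp only: list.map sum_list.Nil H2.zero_mem)
      then have b': "b' \<in> vecs H2" using b by (simp add: b'_def)
      have "tensor_sum L' = tensor_fun a (\<Sum>(c, d)\<leftarrow>L'. q c *\<^sub>R d) + tensor_sum N"
        unfolding N_def by (induction L') (auto simp: fun_eq_iff algebra_simps)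
      then have "tensor_sum L = tensor_sum ((a, b') # N)"
        by (auto simp: Cons p b'_def fun_eq_iff algebra_simps)
      then have "G L L = G ((a, b') # N) ((a, b') # N)"
        using 1 N a b' by (intro gram_cong2) auto
      also have "\<dots> = ip H1 a a * ip H2 b' b' + (\<Sum>(c, d)\<leftarrow>N. ip H1 a c * ip H2 b' d) + G N ((a, b') # N)"
        by (simp add: gram_simps)
      also have "G N ((a, b') # N) = (\<Sum>(c, d)\<leftarrow>N. ip H1 a c * ip H2 b' d) + G N N"
        using gram_commute[of N "(a, b') # N"] N a b' by (simp add: gram_simps)
      also have "(\<Sum>(c, d)\<leftarrow>N. ip H1 a c * ip H2 b' d) = 0"
        using L' unfolding N_def
      proof (induction L')
        case (Cons r L')
        then obtain c d where r: "r = (c, d)" "c \<in> vecs H1" "L' \<in> reps" by (cases r) auto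
        then show ?case
          by (simp only: Cons.IH list.map sum_list.Cons case_prod_conv ortho(2) mult_zero_left add_0_left)
      qed simp
      finally have "G L L = ip H1 a a * ip H2 b' b' + G N N" by simp
      moreover have "0 \<le> G N N"
        using 1 N Cons by (auto simp: N_def)
      ultimately show ?thesis using aa H2.ip_nonneg[OF b'] by simp
    qed
  qed
qed

lemma semi_hilbert_alg_tensor: "semi_hilbert A"
proof
  have add: "tensor_sum L + tensor_sum M = tensor_sum (L @ M)" for L M :: "(('a \<Rightarrow> real) \<times> ('b \<Rightarrow> real)) list"
    by simp
  show "subspace (vecs A)"
  proof (rule subspaceI)
    show "0 \<in> vecs A" unfolding mem_alg_tensor by (rule bexI[of _ "[]"]) auto
    show "f + g \<in> vecs A" if "f \<in> vecs A" "g \<in> vecs A" for f g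
      using that unfolding mem_alg_tensor by (metis add append_in_lists_conv)
    show "r *\<^sub>R f \<in> vecs A" if "f \<in> vecs A" for r f
      using that unfolding mem_alg_tensor by (metis reps_scale tensor_sum_scale)
  qed
  fix f g assume "f \<in> vecs A" "g \<in> vecs A"
  then obtain L M where f: "f = tensor_sum L" "L \<in> reps" and g: "g = tensor_sum M" "M \<in> reps"
    unfolding mem_alg_tensor by metis
  show "ip A f g = ip A g f"
    using f g gram_commute by (simp add: ip_alg_tensor)
  show "ip A (r *\<^sub>R f) g = r * ip A f g" for r
    unfolding f g tensor_sum_scale[symmetric] using f g
    by (simp only: ip_alg_tensor reps_scale gram_scale)
  show "0 \<le> ip A f f"
    using f gram_nonneg by (simp add: ip_alg_tensor)
  fix k assume "k \<in> vecs A"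
  then obtain N where k: "k = tensor_sum N" "N \<in> reps" unfolding mem_alg_tensor by metis
  show "ip A (f + g) k = ip A f k + ip A g k"
    using f g k by (simp add: ip_alg_tensor add gram_simps del: tensor_sum_simps)
qed

lemma tensor_mem_alg_tensor: "a \<in> vecs H1 \<Longrightarrow> b \<in> vecs H2 \<Longrightarrow> tensor_fun a b \<in> vecs A"
  unfolding mem_alg_tensor by (rule bexI[of _ "[(a, b)]"]) auto

lemma ip_tensor_alg_tensor:
  "a \<in> vecs H1 \<Longrightarrow> b \<in> vecs H2 \<Longrightarrow> c \<in> vecs H1 \<Longrightarrow> d \<in> vecs H2 \<Longrightarrow>
    ip A (tensor_fun a b) (tensor_fun c d) = ip H1 a c * ip H2 b d"
  using ip_alg_tensor[of "[(a, b)]" "[(c, d)]"] by (simp add: gram_def)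

lemma vecs_alg_tensor:
  "vecs A = span {tensor_fun a b | a b. a \<in> vecs H1 \<and> b \<in> vecs H2}" (is "_ = span ?S")
proof
  have "tensor_sum L \<in> span ?S" if "L \<in> reps" for L
    using that
  proof (induction L)
    case (Cons p L)
    then have "tensor_sum [p] \<in> ?S" by (cases p) auto
    moreover have "tensor_sum L \<in> span ?S" using Cons by simp
    ultimately have "tensor_sum [p] + tensor_sum L \<in> span ?S"
      by (intro span_add) (auto intro: span_base)
    then show ?case by (cases p) (simp only: tensor_sum_simps add_0_right)
  qed (simp only: tensor_sum_simps span_zero)
  then show "vecs A \<subseteq> span ?S" unfolding subset_iff mem_alg_tensor by blast
  show "span ?S \<subseteq> vecs A"
    using semi_hilbert_alg_tensor tensor_mem_alg_tensor
    by (intro span_minimal) (auto simp: semi_hilbert_def bilinear_space_def)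
qed

end

subsection \<open>The completed tensor product\<close>

text \<open>Writing \<open>ip H (s n) (s n)\<close> as
  \<open>ip H (s n) (s n - s N) + ip H (s n) (s N)\<close> shows that the limit \<open>L\<close> of
  the norms satisfies \<open>L * L \<le> L * e\<close> for every \<open>e > 0\<close>. Only pairings
  with terms of the sequence itself enter, so the argument works in an incomplete space.\<close>

lemma (in semi_hilbert) cauchy_in_null:
  assumes s: "cauchy_in H s" and w: "\<And>m. (\<lambda>n. ip H (s n) (s m)) \<longlonglongrightarrow> 0"
  shows "(\<lambda>n. nrm (s n)) \<longlonglongrightarrow> 0"
proof -
  obtain L where L: "(\<lambda>n. nrm (s n)) \<longlonglongrightarrow> L"
    using cauchy_in_convergent_nrm[OF s] by (auto simp: convergent_def)
  have m: "s n \<in> vecs H" for n using s by (rule cauchy_in_mem)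
  have "L \<ge> 0"
    using L m by (intro LIMSEQ_le_const[OF L]) auto
  have "L * L \<le> L * e" if "e > 0" for e
  proof -
    from that obtain N where N: "\<And>m n. m \<ge> N \<Longrightarrow> n \<ge> N \<Longrightarrow> nrm (s m - s n) < e"
      using s \<open>e > 0\<close> unfolding cauchy_in_def by meson
    have "(\<lambda>n. nrm (s n) * nrm (s n) - ip H (s n) (s N)) \<longlonglongrightarrow> L * L - 0"
      by (intro tendsto_intros L w)
    moreover have "(\<lambda>n. nrm (s n) * e) \<longlonglongrightarrow> L * e"
      by (intro tendsto_intros L)
    moreover have "nrm (s n) * nrm (s n) - ip H (s n) (s N) \<le> nrm (s n) * e" if "n \<ge> N" for n
    proof -
      have "nrm (s n) * nrm (s n) - ip H (s n) (s N) = ip H (s n) (s n - s N)"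
        using m nrm_square[OF m[of n]] by (simp add: ip_simps power2_eq_square)
      also have "\<dots> \<le> nrm (s n) * nrm (s n - s N)"
        using Cauchy_Schwarz[OF m[of n] diff_mem[OF m[of n] m[of N]]] by simp
      also have "\<dots> \<le> nrm (s n) * e"
        using m N[OF that order_refl] by (intro mult_left_mono) auto
      finally show ?thesis .
    qed
    ultimately show ?thesis
      using LIMSEQ_le[of _ "L * L - 0" _ "L * e"] by auto
  qed
  then have "L \<le> e" if "e > 0" for e
    using that \<open>L \<ge> 0\<close> by (cases "L = 0") auto
  then have "L \<le> 0" by (rule field_le_epsilon[of L 0, simplified])
  with L \<open>L \<ge> 0\<close> show ?thesis by simp
qed

abbreviation tensors where
  "tensors H1 H2 \<equiv> {tensor_fun f1 f2 | f1 f2. f1 \<in> vecs H1 \<and> f2 \<in> vecs H2}"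

definition kernel_tensor ::
    "('a \<Rightarrow> 'a \<Rightarrow> real) \<Rightarrow> ('b \<Rightarrow> 'b \<Rightarrow> real) \<Rightarrow> 'a \<times> 'b \<Rightarrow> 'a \<times> 'b \<Rightarrow> real" where
  "kernel_tensor k1 k2 = (\<lambda>(x, y) (x', y'). k1 x x' * k2 y y')"

lemma restr_kernel_tensor:
  "restr (X \<times> Y) (kernel_tensor k1 k2 (x, y)) = tensor_fun (restr X (k1 x)) (restr Y (k2 y))"
  by (auto simp: restr_def kernel_tensor_def tensor_fun_def fun_eq_iff)

text \<open>\<open>E\<close> may be any space that contains the elementary tensors with the product
  form. Contractions are thus treated once for the algebraic tensor product and for every completed
  one.\<close>

locale tensor_space = two_pre_hilbert H1 H2 + E: semi_hilbert E
  for H1 :: "('a \<Rightarrow> real) ip_space" and H2 :: "('b \<Rightarrow> real) ip_space"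
    and E :: "('a \<times> 'b \<Rightarrow> real) ip_space" +
  assumes tensor_mem: "\<And>a b. a \<in> vecs H1 \<Longrightarrow> b \<in> vecs H2 \<Longrightarrow> tensor_fun a b \<in> vecs E"
    and ip_tensor: "\<And>a b c d. a \<in> vecs H1 \<Longrightarrow> b \<in> vecs H2 \<Longrightarrow> c \<in> vecs H1 \<Longrightarrow> d \<in> vecs H2 \<Longrightarrow>
      ip E (tensor_fun a b) (tensor_fun c d) = ip H1 a c * ip H2 b d"
begin

lemma nrm_tensor: "a \<in> vecs H1 \<Longrightarrow> b \<in> vecs H2 \<Longrightarrow> E.nrm (tensor_fun a b) = H1.nrm a * H2.nrm b"
  by (simp add: ip_norm_def ip_tensor real_sqrt_mult)

lemma bounded_map_left: "b \<in> vecs H2 \<Longrightarrow> bounded_map H1 E (\<lambda>a. tensor_fun a b) (H2.nrm b)"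
  by unfold_locales (auto simp: tensor_mem nrm_tensor)

lemma bounded_map_right: "a \<in> vecs H1 \<Longrightarrow> bounded_map H2 E (tensor_fun a) (H1.nrm a)"
  by unfold_locales (auto simp: tensor_mem nrm_tensor)

text \<open>Contracting \<open>tensor_fun p q\<close> with \<open>b\<close> gives
  \<open>ip H2 q b\<close> times \<open>p\<close>; finite sums follow by linearity.\<close>

lemma adj_left_span:
  assumes b: "b \<in> vecs H2" and f: "f \<in> span (tensors H1 H2)"
  shows "\<exists>g. bounded_map.adj H1 E (\<lambda>a. tensor_fun a b) f g"
proof -
  interpret T: bounded_map H1 E "\<lambda>a. tensor_fun a b" "H2.nrm b"
    using b by (rule bounded_map_left)
  show ?thesis
  proof (rule T.adj_span[OF _ f])
    fix d assume "d \<in> tensors H1 H2"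
    then obtain p q where d: "d = tensor_fun p q" "p \<in> vecs H1" "q \<in> vecs H2" by blast
    then have "T.adj d (ip H2 q b *\<^sub>R p)"
      using b unfolding T.adj_def
      by (auto simp: ip_tensor tensor_mem H1.ip_scale_left intro!: H1.scale_mem simp del: scaleR_fun_apply)
    then show "\<exists>g. T.adj d g" by blast
  qed
qed

lemma adj_right_span:
  assumes a: "a \<in> vecs H1" and f: "f \<in> span (tensors H1 H2)"
  shows "\<exists>g. bounded_map.adj H2 E (tensor_fun a) f g"
proof -
  interpret T: bounded_map H2 E "tensor_fun a" "H1.nrm a"
    using a by (rule bounded_map_right)
  show ?thesis
  proof (rule T.adj_span[OF _ f])
    fix d assume "d \<in> tensors H1 H2"
    then obtain p q where d: "d = tensor_fun p q" "p \<in> vecs H1" "q \<in> vecs H2" by blast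
    then have "T.adj d (ip H1 p a *\<^sub>R q)"
      using a unfolding T.adj_def
      by (auto simp: ip_tensor tensor_mem H2.ip_scale_left intro!: H2.scale_mem simp del: scaleR_fun_apply)
    then show "\<exists>g. T.adj d g" by blast
  qed
qed

end

lemma reproducing_kernelI:
  assumes "vecs F \<subseteq> functions_on Z"
    and "\<And>x y. x \<in> Z \<Longrightarrow> y \<in> Z \<Longrightarrow> k x y = k y x"
    and "\<And>x. x \<in> Z \<Longrightarrow> restr Z (k x) \<in> vecs F"
    and "\<And>x f. x \<in> Z \<Longrightarrow> f \<in> vecs F \<Longrightarrow> f x = ip F f (restr Z (k x))"
  shows "reproducing_kernel Z F k"
  using assms unfolding reproducing_kernel_def by blast

locale rk_tensor_space = tensor_space H1 H2 E
  for H1 :: "('a \<Rightarrow> real) ip_space" and H2 :: "('b \<Rightarrow> real) ip_space"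
    and E :: "('a \<times> 'b \<Rightarrow> real) ip_space" +
  fixes X1 :: "'a set" and k1 :: "'a \<Rightarrow> 'a \<Rightarrow> real" and X2 :: "'b set" and k2 :: "'b \<Rightarrow> 'b \<Rightarrow> real"
  assumes kernel1: "reproducing_kernel X1 H1 k1" and kernel2: "reproducing_kernel X2 H2 k2"
begin

lemma eval_span:
  assumes x: "x \<in> X1" and y: "y \<in> X2" and f: "f \<in> span (tensors H1 H2)"
  shows "f (x, y) = ip E f (tensor_fun (restr X1 (k1 x)) (restr X2 (k2 y)))"
proof -
  note kx = reproducing_kernel_mem[OF kernel1 x] and ky = reproducing_kernel_mem[OF kernel2 y]
  let ?k = "tensor_fun (restr X1 (k1 x)) (restr X2 (k2 y))"
  have k: "?k \<in> vecs E" using kx ky by (rule tensor_mem)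
  have "f \<in> vecs E \<and> f (x, y) = ip E f ?k"
    using f
  proof (induction rule: span_induct_alt)
    case base
    have "0 \<in> vecs E \<and> (0 :: 'a \<times> 'b \<Rightarrow> real) (x, y) = ip E 0 ?k"
      using k by (simp add: E.ip_zero_left)
    then show ?case .
  next
    case (step c t f)
    then obtain p q where t: "t = tensor_fun p q" "p \<in> vecs H1" "q \<in> vecs H2" by blast
    then have "t (x, y) = ip E t ?k"
      using kx ky by (simp add: ip_tensor reproducing_kernel_eval[OF kernel1 x] reproducing_kernel_eval[OF kernel2 y])
    moreover have tE: "t \<in> vecs E" using t by (simp add: tensor_mem)
    moreover have "c *\<^sub>R t + f \<in> vecs E" using step tE by (intro E.add_mem E.scale_mem) auto
    moreover have "ip E (c *\<^sub>R t + f) ?k = c * ip E t ?k + ip E f ?k"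
      using step tE k E.scale_mem[OF tE] by (simp only: E.ip_add_left E.ip_scale_left)
    ultimately have "c *\<^sub>R t + f \<in> vecs E \<and> (c *\<^sub>R t + f) (x, y) = ip E (c *\<^sub>R t + f) ?k"
      using step by simp
    then show ?case .
  qed
  then show ?thesis by simp
qed

lemma span_functions_on: "span (tensors H1 H2) \<subseteq> functions_on (X1 \<times> X2)"
proof (rule span_minimal)
  show "tensors H1 H2 \<subseteq> functions_on (X1 \<times> X2)"
    using reproducing_kernel_zero[OF kernel1] reproducing_kernel_zero[OF kernel2]
    by (auto simp: functions_on_def tensor_fun_def)
  show "subspace (functions_on (X1 \<times> X2))"
    by (auto simp: subspace_def functions_on_def)
qed

lemma kernel_commute:
  "p \<in> X1 \<times> X2 \<Longrightarrow> q \<in> X1 \<times> X2 \<Longrightarrow> kernel_tensor k1 k2 p q = kernel_tensor k1 k2 q p"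
  using reproducing_kernel_commute[OF kernel1] reproducing_kernel_commute[OF kernel2]
  by (auto simp: kernel_tensor_def)

lemma kernel_mem: "p \<in> X1 \<times> X2 \<Longrightarrow> restr (X1 \<times> X2) (kernel_tensor k1 k2 p) \<in> vecs E"
  using reproducing_kernel_mem[OF kernel1] reproducing_kernel_mem[OF kernel2]
  by (auto simp: restr_kernel_tensor tensor_mem)

text \<open>Contracting with \<open>k1 x\<close> and then with a fixed vector reduces the criterion for the
  completion to completeness of the two factors.\<close>

lemma span_null:
  assumes "hilbert H1" "hilbert H2" and s: "cauchy_in E s" "\<And>n. s n \<in> span (tensors H1 H2)"
    and pw: "\<And>z. (\<lambda>n. s n z) \<longlonglongrightarrow> 0"
  shows "(\<lambda>n. E.nrm (s n)) \<longlonglongrightarrow> 0"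
proof -
  have sE: "s n \<in> vecs E" for n using s(1) by (rule cauchy_in_mem)
  have 1: "(\<lambda>n. ip E (s n) (tensor_fun (restr X1 (k1 x)) b)) \<longlonglongrightarrow> 0"
    if x: "x \<in> X1" and b: "b \<in> vecs H2" for x b
  proof -
    note kx = reproducing_kernel_mem[OF kernel1 x]
    interpret T: bounded_map H2 E "tensor_fun (restr X1 (k1 x))" "H1.nrm (restr X1 (k1 x))"
      using kx by (rule bounded_map_right)
    obtain g where g: "\<And>n. T.adj (s n) (g n)"
      using adj_right_span[OF kx s(2)] by metis
    have "(\<lambda>n. g n y) \<longlonglongrightarrow> 0" for y
    proof (cases "y \<in> X2")
      case True
      have "g n y = s n (x, y)" for n
        using reproducing_kernel_eval[OF kernel2 True T.adjD(1)[OF g]]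
          T.adjD(2)[OF g reproducing_kernel_mem[OF kernel2 True]] eval_span[OF x True s(2)] by simp
      then show ?thesis using pw by simp
    next
      case False
      then show ?thesis using reproducing_kernel_zero[OF kernel2 T.adjD(1)[OF g]] by simp
    qed
    then have "conv_in H2 g 0"
      by (intro cauchy_in_pointwise_zero[OF \<open>hilbert H2\<close> kernel2] T.adj_cauchy[OF s(1) g])
    from H2.conv_in_ip[OF this b] show ?thesis
      using T.adjD(2)[OF g b] b by (simp add: H2.ip_zero_left)
  qed
  \<comment> \<open>The value at \<open>x\<close> of the contraction with \<open>b\<close> is a
    pairing covered by \<open>1\<close>, so pointwise convergence to zero is now available for every
    \<open>b\<close> and not only for kernel functions.\<close>
  have 2: "(\<lambda>n. ip E (s n) (tensor_fun a b)) \<longlonglongrightarrow> 0"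
    if a: "a \<in> vecs H1" and b: "b \<in> vecs H2" for a b
  proof -
    interpret T: bounded_map H1 E "\<lambda>a. tensor_fun a b" "H2.nrm b"
      using b by (rule bounded_map_left)
    obtain g where g: "\<And>n. T.adj (s n) (g n)"
      using adj_left_span[OF b s(2)] by metis
    have "(\<lambda>n. g n x) \<longlonglongrightarrow> 0" for x
    proof (cases "x \<in> X1")
      case True
      have "g n x = ip E (s n) (tensor_fun (restr X1 (k1 x)) b)" for n
        using reproducing_kernel_eval[OF kernel1 True T.adjD(1)[OF g]]
          T.adjD(2)[OF g reproducing_kernel_mem[OF kernel1 True]] by simp
      then show ?thesis using 1[OF True b] by simp
    next
      case False
      then show ?thesis using reproducing_kernel_zero[OF kernel1 T.adjD(1)[OF g]] by simp
    qed
    then have "conv_in H1 g 0"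
      by (intro cauchy_in_pointwise_zero[OF \<open>hilbert H1\<close> kernel1] T.adj_cauchy[OF s(1) g])
    from H1.conv_in_ip[OF this a] show ?thesis
      using T.adjD(2)[OF g a] a by (simp add: H1.ip_zero_left)
  qed
  have "f \<in> vecs E \<and> (\<lambda>n. ip E (s n) f) \<longlonglongrightarrow> 0" if "f \<in> span (tensors H1 H2)" for f
    using that
  proof (induction rule: span_induct_alt)
    case base
    show ?case using sE by (simp only: E.zero_mem E.ip_zero_right tendsto_const)
  next
    case (step c t f)
    then obtain p q where t: "t = tensor_fun p q" "p \<in> vecs H1" "q \<in> vecs H2" by blast
    have tE: "t \<in> vecs E" using t by (simp add: tensor_mem)
    have "(\<lambda>n. c * ip E (s n) t + ip E (s n) f) \<longlonglongrightarrow> c * 0 + 0"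
      using 2[OF t(2,3)] t(1) step by (intro tendsto_intros) auto
    moreover have "ip E (s n) (c *\<^sub>R t + f) = c * ip E (s n) t + ip E (s n) f" for n
      using step tE sE E.scale_mem[OF tE] by (simp only: E.ip_add_right E.ip_scale_right)
    moreover have "c *\<^sub>R t + f \<in> vecs E" using step tE by (intro E.add_mem E.scale_mem) auto
    ultimately have "c *\<^sub>R t + f \<in> vecs E \<and> (\<lambda>n. ip E (s n) (c *\<^sub>R t + f)) \<longlonglongrightarrow> 0"
      by (simp only: mult_zero_right add_0_right)
    then show ?case .
  qed
  then show ?thesis using s by (intro E.cauchy_in_null) auto
qed

end

lemma ex_hilbert_tensor:
  assumes H1: "hilbert_space H1" and k1: "reproducing_kernel X1 H1 k1"
    and H2: "hilbert_space H2" and k2: "reproducing_kernel X2 H2 k2"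
  shows "\<exists>H. is_hilbert_tensor X1 H1 X2 H2 H"
proof -
  interpret H1: hilbert H1 using H1 by (simp add: hilbert_space_iff)
  interpret H2: hilbert H2 using H2 by (simp add: hilbert_space_iff)
  interpret two_pre_hilbert H1 H2 ..
  interpret A: semi_hilbert A by (rule semi_hilbert_alg_tensor)
  interpret A: rk_tensor_space H1 H2 A X1 k1 X2 k2
    by unfold_locales (simp_all add: tensor_mem_alg_tensor ip_tensor_alg_tensor k1 k2)
  have k: "reproducing_kernel (X1 \<times> X2) A (kernel_tensor k1 k2)"
    using A.eval_span A.span_functions_on A.kernel_commute A.kernel_mem
    by (intro reproducing_kernelI) (auto simp: vecs_alg_tensor restr_kernel_tensor)
  \<comment> \<open>Definiteness is read off from the kernel: by Cauchy-Schwarz a function of norm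
    zero is orthogonal to every kernel function, so it vanishes at every point.\<close>
  have "pre_hilbert A"
  proof (rule pre_hilbertI[OF A.semi_hilbert_axioms])
    fix f assume f: "f \<in> vecs A" "ip A f f = 0"
    have "f z = 0" for z
    proof (cases "z \<in> X1 \<times> X2")
      case True
      then show ?thesis
        using A.Cauchy_Schwarz[OF f(1) reproducing_kernel_mem[OF k True]] f(2)
          reproducing_kernel_eval[OF k True f(1)] by (simp add: ip_norm_def)
    next
      case False
      then show ?thesis using reproducing_kernel_zero[OF k f(1)] by simp
    qed
    then show "f = 0" by auto
  qed
  then interpret A: pre_hilbert A .
  interpret C: completable A "X1 \<times> X2" "kernel_tensor k1 k2"
    using k A.span_null[OF H1.hilbert_axioms H2.hilbert_axioms]
    by unfold_locales (simp_all add: cauchy_in_mem flip: vecs_alg_tensor)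
  interpret H: hilbert C.H by (rule C.hilbert_completion)
  have "is_hilbert_tensor X1 H1 X2 H2 C.H"
    unfolding is_hilbert_tensor_def
  proof (intro conjI ballI)
    show "hilbert_space C.H" by (simp add: hilbert_space_iff H.hilbert_axioms)
    show "\<exists>k. reproducing_kernel (X1 \<times> X2) C.H k" using C.reproducing_kernel_completion by blast
    show "tensor_fun a b \<in> vecs C.H" if "a \<in> vecs H1" "b \<in> vecs H2" for a b
      using tensor_mem_alg_tensor[OF that] C.vecs_completion by blast
    show "ip C.H (tensor_fun a b) (tensor_fun c d) = ip H1 a c * ip H2 b d"
      if "a \<in> vecs H1" "b \<in> vecs H2" "c \<in> vecs H1" "d \<in> vecs H2" for a b c d
      using that by (simp add: C.ip_completion tensor_mem_alg_tensor ip_tensor_alg_tensor)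
    show "H.M.mtopology closure_of span (tensors H1 H2) = vecs C.H"
      unfolding H.dense_iff vecs_alg_tensor[symmetric] using C.dense_completion by blast
  qed
  then show ?thesis ..
qed

lemma hilbert_tensor_limit:
  assumes "is_hilbert_tensor X1 H1 X2 H2 H" and "f \<in> vecs H"
  shows "\<exists>s. (\<forall>n. s n \<in> span (tensors H1 H2)) \<and> conv_in H s f"
proof -
  interpret H: hilbert H using assms by (simp add: is_hilbert_tensor_def hilbert_space_iff)
  show ?thesis using assms H.dense_iff unfolding is_hilbert_tensor_def by blast
qed

locale hilbert_tensor = H1: hilbert H1 + H2: hilbert H2
  for H1 :: "('a \<Rightarrow> real) ip_space" and H2 :: "('b \<Rightarrow> real) ip_space"
    and H :: "('a \<times> 'b \<Rightarrow> real) ip_space"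
    and X1 :: "'a set" and k1 :: "'a \<Rightarrow> 'a \<Rightarrow> real" and X2 :: "'b set" and k2 :: "'b \<Rightarrow> 'b \<Rightarrow> real" +
  assumes kernel1: "reproducing_kernel X1 H1 k1" and kernel2: "reproducing_kernel X2 H2 k2"
    and tensor: "is_hilbert_tensor X1 H1 X2 H2 H"

sublocale hilbert_tensor \<subseteq> H: hilbert H
  using tensor by (simp add: is_hilbert_tensor_def hilbert_space_iff)

sublocale hilbert_tensor \<subseteq> rk_tensor_space H1 H2 H X1 k1 X2 k2
  using tensor kernel1 kernel2 by unfold_locales (auto simp: is_hilbert_tensor_def)

context hilbert_tensor
begin

text \<open>The definition grants some kernel \<open>k\<close>, which yields pointwise convergence
  and vanishing outside \<open>X1 \<times> X2\<close>. The product kernel reproduces on the span,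
  and both sides of that identity pass to the limit.\<close>

lemma reproducing_kernel: "reproducing_kernel (X1 \<times> X2) H (kernel_tensor k1 k2)"
proof (rule reproducing_kernelI)
  obtain k where k: "reproducing_kernel (X1 \<times> X2) H k"
    using tensor by (auto simp: is_hilbert_tensor_def)
  then show "vecs H \<subseteq> functions_on (X1 \<times> X2)" by (simp add: reproducing_kernel_def)
  fix z f assume z: "z \<in> X1 \<times> X2" and f: "f \<in> vecs H"
  then obtain x y where xy: "z = (x, y)" "x \<in> X1" "y \<in> X2" by blast
  obtain s where s: "\<And>n. s n \<in> span (tensors H1 H2)" "conv_in H s f"
    using hilbert_tensor_limit[OF tensor f] by blast
  have "(\<lambda>n. s n z) \<longlonglongrightarrow> f z"
    using conv_in_pointwise[OF H.semi_hilbert_axioms k s(2)] .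
  moreover have "(\<lambda>n. s n z) \<longlonglongrightarrow> ip H f (restr (X1 \<times> X2) (kernel_tensor k1 k2 z))"
    using H.conv_in_ip[OF s(2) kernel_mem[OF z]] eval_span[OF xy(2,3) s(1)]
    by (simp add: xy(1) restr_kernel_tensor)
  ultimately show "f z = ip H f (restr (X1 \<times> X2) (kernel_tensor k1 k2 z))"
    by (rule LIMSEQ_unique)
qed (fact kernel_commute kernel_mem)+

text \<open>The section at \<open>y\<close> is the contraction of \<open>f\<close> with
  \<open>k2 y\<close>: pairing it with \<open>k1 x\<close> returns \<open>f (x, y)\<close>. The
  contraction exists for limits of finite sums because \<open>H1\<close> is complete.\<close>

lemma section_left:
  assumes f: "f \<in> vecs H"
  shows "(\<lambda>x. f (x, y)) \<in> vecs H1"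
proof (cases "y \<in> X2")
  case True
  note ky = reproducing_kernel_mem[OF kernel2 True]
  interpret T: bounded_map H1 H "\<lambda>a. tensor_fun a (restr X2 (k2 y))" "H2.nrm (restr X2 (k2 y))"
    using ky by (rule bounded_map_left)
  obtain s where s: "\<And>n. s n \<in> span (tensors H1 H2)" "conv_in H s f"
    using hilbert_tensor_limit[OF tensor f] by blast
  obtain t where "\<And>n. T.adj (s n) (t n)" using adj_left_span[OF ky s(1)] by metis
  then obtain g where g: "T.adj f g" using T.adj_limit[OF H1.hilbert_axioms s(2)] by blast
  have "f (x, y) = g x" for x
  proof (cases "x \<in> X1")
    case x: True
    with True have "f (x, y) = ip H f (tensor_fun (restr X1 (k1 x)) (restr X2 (k2 y)))"
      using reproducing_kernel_eval[OF reproducing_kernel _ f, of "(x, y)"]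
      by (simp add: restr_kernel_tensor)
    then show ?thesis
      using T.adjD(2)[OF g reproducing_kernel_mem[OF kernel1 x]]
        reproducing_kernel_eval[OF kernel1 x T.adjD(1)[OF g]] by simp
  next
    case False
    then show ?thesis
      using reproducing_kernel_zero[OF reproducing_kernel f, of "(x, y)"]
        reproducing_kernel_zero[OF kernel1 T.adjD(1)[OF g] False] by simp
  qed
  then have "(\<lambda>x. f (x, y)) = g" by auto
  then show ?thesis using T.adjD(1)[OF g] by simp
next
  case False
  then have "(\<lambda>x. f (x, y)) = 0"
    using reproducing_kernel_zero[OF reproducing_kernel f] by auto
  then show ?thesis by (simp only: H1.zero_mem)
qed

lemma section_right:
  assumes f: "f \<in> vecs H"
  shows "(\<lambda>y. f (x, y)) \<in> vecs H2"
proof (cases "x \<in> X1")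
  case True
  note kx = reproducing_kernel_mem[OF kernel1 True]
  interpret T: bounded_map H2 H "tensor_fun (restr X1 (k1 x))" "H1.nrm (restr X1 (k1 x))"
    using kx by (rule bounded_map_right)
  obtain s where s: "\<And>n. s n \<in> span (tensors H1 H2)" "conv_in H s f"
    using hilbert_tensor_limit[OF tensor f] by blast
  obtain t where "\<And>n. T.adj (s n) (t n)" using adj_right_span[OF kx s(1)] by metis
  then obtain g where g: "T.adj f g" using T.adj_limit[OF H2.hilbert_axioms s(2)] by blast
  have "f (x, y) = g y" for y
  proof (cases "y \<in> X2")
    case y: True
    with True have "f (x, y) = ip H f (tensor_fun (restr X1 (k1 x)) (restr X2 (k2 y)))"
      using reproducing_kernel_eval[OF reproducing_kernel _ f, of "(x, y)"]
      by (simp add: restr_kernel_tensor)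
    then show ?thesis
      using T.adjD(2)[OF g reproducing_kernel_mem[OF kernel2 y]]
        reproducing_kernel_eval[OF kernel2 y T.adjD(1)[OF g]] by simp
  next
    case False
    then show ?thesis
      using reproducing_kernel_zero[OF reproducing_kernel f, of "(x, y)"]
        reproducing_kernel_zero[OF kernel2 T.adjD(1)[OF g] False] by simp
  qed
  then have "(\<lambda>y. f (x, y)) = g" by auto
  then show ?thesis using T.adjD(1)[OF g] by simp
next
  case False
  then have "(\<lambda>y. f (x, y)) = 0"
    using reproducing_kernel_zero[OF reproducing_kernel f] by auto
  then show ?thesis by (simp only: H2.zero_mem)
qed

end

section \<open>Direct sums and Krein spaces\<close>

lemma direct_sum_unique:
  assumes "subspace U" "subspace W" "U \<inter> W = {0}"
    and "f1 \<in> U" "f2 \<in> W" "g1 \<in> U" "g2 \<in> W" and e: "f1 + f2 = g1 + g2"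
  shows "f1 = g1 \<and> f2 = g2"
proof -
  from e have "f1 - g1 = g2 - f2" by (simp add: algebra_simps)
  moreover have "f1 - g1 \<in> U" "g2 - f2 \<in> W" using assms by (auto intro: subspace_diff)
  ultimately have "f1 - g1 \<in> U \<inter> W" by simp
  then have "f1 - g1 = 0" using assms(3) by blast
  then have "f1 = g1" by (simp only: right_minus_eq)
  with e show ?thesis by simp
qed

lemma ex_direct_sum:
  assumes F1: "subspace (vecs F1)" and F2: "subspace (vecs F2)" and 0: "vecs F1 \<inter> vecs F2 = {0}"
  shows "\<exists>S. is_direct_sum F1 F2 S"
proof -
  \<comment> \<open>The projection onto \<open>F1\<close> along \<open>F2\<close>. On the sum,
    \<open>THE\<close> is justified by uniqueness of the components.\<close>
  define P where "P f = (THE f1. f1 \<in> vecs F1 \<and> f - f1 \<in> vecs F2)" for f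
  have P: "P (f1 + f2) = f1" if f: "f1 \<in> vecs F1" "f2 \<in> vecs F2" for f1 f2
    unfolding P_def
  proof (rule the_equality)
    show "f1 \<in> vecs F1 \<and> f1 + f2 - f1 \<in> vecs F2" using f by simp
    fix g assume g: "g \<in> vecs F1 \<and> f1 + f2 - g \<in> vecs F2"
    have "g + (f1 + f2 - g) = f1 + f2" by simp
    from direct_sum_unique[OF F1 F2 0 _ _ f this] g show "g = f1" by blast
  qed
  have "is_direct_sum F1 F2 \<lparr>vecs = {f1 + f2 | f1 f2. f1 \<in> vecs F1 \<and> f2 \<in> vecs F2},
      ip = \<lambda>f g. ip F1 (P f) (P g) + ip F2 (f - P f) (g - P g)\<rparr>"
    unfolding is_direct_sum_def using 0 by (simp add: P)
  then show ?thesis ..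
qed

text \<open>Only bilinearity is asked of the summands, so that one of them may be a negated Hilbert
  space.\<close>

locale direct_sum = F1: bilinear_space F1 + F2: bilinear_space F2
  for F1 F2 S :: "'f::real_vector ip_space" +
  assumes direct_sum: "is_direct_sum F1 F2 S"
begin

lemma mem_iff: "f \<in> vecs S \<longleftrightarrow> (\<exists>f1\<in>vecs F1. \<exists>f2\<in>vecs F2. f = f1 + f2)"
  using direct_sum by (auto simp: is_direct_sum_def)

lemma ip_sum:
  "f1 \<in> vecs F1 \<Longrightarrow> f2 \<in> vecs F2 \<Longrightarrow> g1 \<in> vecs F1 \<Longrightarrow> g2 \<in> vecs F2 \<Longrightarrow>
    ip S (f1 + f2) (g1 + g2) = ip F1 f1 g1 + ip F2 f2 g2"
  using direct_sum by (auto simp: is_direct_sum_def)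

lemma mem_sum: "f1 \<in> vecs F1 \<Longrightarrow> f2 \<in> vecs F2 \<Longrightarrow> f1 + f2 \<in> vecs S"
  using mem_iff by blast

lemma mem_left: "f \<in> vecs F1 \<Longrightarrow> f \<in> vecs S"
  using mem_sum[of f 0] by simp

lemma mem_right: "f \<in> vecs F2 \<Longrightarrow> f \<in> vecs S"
  using mem_sum[of 0 f] by simp

lemma ip_left: "f \<in> vecs F1 \<Longrightarrow> g1 \<in> vecs F1 \<Longrightarrow> g2 \<in> vecs F2 \<Longrightarrow> ip S f (g1 + g2) = ip F1 f g1"
  using ip_sum[of f 0 g1 g2] by (simp add: F2.ip_zero_left)

lemma bilinear: "bilinear_space S"
proof
  show "subspace (vecs S)"
  proof (rule subspaceI)
    show "0 \<in> vecs S" using mem_left[OF F1.zero_mem] .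
  next
    fix f g assume "f \<in> vecs S" "g \<in> vecs S"
    then obtain f1 f2 g1 g2 where "f = f1 + f2" "g = g1 + g2"
      "f1 \<in> vecs F1" "f2 \<in> vecs F2" "g1 \<in> vecs F1" "g2 \<in> vecs F2"
      unfolding mem_iff by blast
    then show "f + g \<in> vecs S"
      using mem_sum[of "f1 + g1" "f2 + g2"] by (simp add: algebra_simps)
  next
    fix f a assume "f \<in> vecs S"
    then obtain f1 f2 where "f = f1 + f2" "f1 \<in> vecs F1" "f2 \<in> vecs F2"
      unfolding mem_iff by blast
    then show "a *\<^sub>R f \<in> vecs S"
      using mem_sum[of "a *\<^sub>R f1" "a *\<^sub>R f2"] by (simp add: scaleR_add_right)
  qed
next
  fix f g assume "f \<in> vecs S" "g \<in> vecs S"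
  then obtain f1 f2 g1 g2 where f: "f = f1 + f2" "f1 \<in> vecs F1" "f2 \<in> vecs F2"
    and g: "g = g1 + g2" "g1 \<in> vecs F1" "g2 \<in> vecs F2"
    unfolding mem_iff by blast
  show "ip S f g = ip S g f"
    using f g by (simp add: ip_sum F1.ip_commute[of f1] F2.ip_commute[of f2])
  show "ip S (a *\<^sub>R f) g = a * ip S f g" for a
    using f g by (simp add: ip_sum scaleR_add_right F1.ip_simps F2.ip_simps algebra_simps)
  fix k assume "k \<in> vecs S"
  then obtain k1 k2 where k: "k = k1 + k2" "k1 \<in> vecs F1" "k2 \<in> vecs F2"
    unfolding mem_iff by blast
  have "f + g = (f1 + g1) + (f2 + g2)" by (simp add: f g algebra_simps)
  then have "ip S (f + g) k = ip F1 (f1 + g1) k1 + ip F2 (f2 + g2) k2"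
    using f g k by (simp only: ip_sum F1.add_mem F2.add_mem)
  then show "ip S (f + g) k = ip S f k + ip S g k"
    using f g k by (simp add: ip_sum F1.ip_add_left F2.ip_add_left)
qed

end

text \<open>The squared norm on the sum is the sum of the squared norms of the components, so Cauchy
  sequences and limits can be handled componentwise.\<close>

lemma direct_sum_hilbert:
  assumes "hilbert H1" "hilbert H2" and S: "is_direct_sum H1 H2 S"
  shows "hilbert S"
proof -
  interpret H1: hilbert H1 by fact
  interpret H2: hilbert H2 by fact
  interpret direct_sum H1 H2 S using S by unfold_locales
  interpret S: bilinear_space S by (rule bilinear)
  interpret S: pre_hilbert S
  proof
    fix f assume f: "f \<in> vecs S" "f \<noteq> 0"
    then obtain f1 f2 where f': "f = f1 + f2" "f1 \<in> vecs H1" "f2 \<in> vecs H2"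
      unfolding mem_iff by blast
    with f(2) have "f1 \<noteq> 0 \<or> f2 \<noteq> 0" by auto
    then show "0 < ip S f f"
      using f' H1.ip_pos[of f1] H2.ip_pos[of f2] H1.ip_nonneg[of f1] H2.ip_nonneg[of f2]
      by (auto simp: ip_sum add_pos_nonneg add_nonneg_pos)
  qed
  have nrm: "S.nrm (f1 + f2) = sqrt ((H1.nrm f1)\<^sup>2 + (H2.nrm f2)\<^sup>2)"
    if "f1 \<in> vecs H1" "f2 \<in> vecs H2" for f1 f2
    using that by (simp add: ip_norm_def ip_sum H1.ip_nonneg H2.ip_nonneg)
  show ?thesis
  proof
    fix s assume s: "cauchy_in S s"
    then have "\<exists>f1 f2. f1 \<in> vecs H1 \<and> f2 \<in> vecs H2 \<and> s n = f1 + f2" for n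
      using cauchy_in_mem[OF s, of n] unfolding mem_iff by blast
    then obtain p q where pq: "\<And>n. p n \<in> vecs H1" "\<And>n. q n \<in> vecs H2" "\<And>n. s n = p n + q n"
      by metis
    have d: "S.nrm (s m - s n) = sqrt ((H1.nrm (p m - p n))\<^sup>2 + (H2.nrm (q m - q n))\<^sup>2)" for m n
      using nrm[of "p m - p n" "q m - q n"] pq by (simp add: algebra_simps)
    have "H1.nrm (p m - p n) \<le> 1 * S.nrm (s m - s n)" "H2.nrm (q m - q n) \<le> 1 * S.nrm (s m - s n)" for m n
      unfolding d by (simp_all add: real_le_rsqrt)
    with pq(1,2) have "cauchy_in H1 p" "cauchy_in H2 q"
      by (blast intro: S.cauchy_in_le[OF s])+
    then obtain f g where f: "conv_in H1 p f" and g: "conv_in H2 q g"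
      using H1.complete H2.complete by metis
    note mem = conv_in_mem(2)[OF f] conv_in_mem(2)[OF g]
    have "(\<lambda>n. sqrt ((H1.nrm (p n - f))\<^sup>2 + (H2.nrm (q n - g))\<^sup>2)) \<longlonglongrightarrow> sqrt (0\<^sup>2 + 0\<^sup>2)"
      using f g by (intro tendsto_intros) (auto simp: conv_in_def)
    moreover have "S.nrm (s n - (f + g)) = sqrt ((H1.nrm (p n - f))\<^sup>2 + (H2.nrm (q n - g))\<^sup>2)" for n
      using nrm[of "p n - f" "q n - g"] pq mem by (simp add: algebra_simps)
    ultimately have "conv_in S s (f + g)"
      using cauchy_in_mem[OF s] mem mem_sum by (simp add: conv_in_def)
    then show "\<exists>f. conv_in S s f" ..
  qed
qed

lemma reproducing_kernel_cong:
  assumes "reproducing_kernel Z F k" and "\<And>x y. x \<in> Z \<Longrightarrow> y \<in> Z \<Longrightarrow> k x y = k' x y"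
  shows "reproducing_kernel Z F k'"
proof -
  have "restr Z (k x) = restr Z (k' x)" if "x \<in> Z" for x
    using assms(2) that by (auto simp: restr_def)
  then show ?thesis using assms by (auto simp: reproducing_kernel_def)
qed

lemma direct_sum_kernel:
  assumes "bilinear_space F1" "bilinear_space F2" and S: "is_direct_sum F1 F2 S"
    and k1: "reproducing_kernel Z F1 k1" and k2: "reproducing_kernel Z F2 k2"
  shows "reproducing_kernel Z S (\<lambda>x y. k1 x y + k2 x y)"
proof -
  interpret F1: bilinear_space F1 by fact
  interpret F2: bilinear_space F2 by fact
  interpret direct_sum F1 F2 S using S by unfold_locales
  have r: "restr Z (\<lambda>y. k1 x y + k2 x y) = restr Z (k1 x) + restr Z (k2 x)" for x
    by (auto simp: restr_def fun_eq_iff)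
  show ?thesis
  proof (rule reproducing_kernelI)
    show "vecs S \<subseteq> functions_on Z"
      using k1 k2 by (auto simp: mem_iff functions_on_def reproducing_kernel_zero)
    show "k1 x y + k2 x y = k1 y x + k2 y x" if "x \<in> Z" "y \<in> Z" for x y
      using reproducing_kernel_commute[OF k1 that] reproducing_kernel_commute[OF k2 that] by simp
  next
    fix x assume x: "x \<in> Z"
    note kx = reproducing_kernel_mem[OF k1 x] reproducing_kernel_mem[OF k2 x]
    show "restr Z (\<lambda>y. k1 x y + k2 x y) \<in> vecs S"
      unfolding r using kx by (rule mem_sum)
    fix f assume "f \<in> vecs S"
    then obtain f1 f2 where "f = f1 + f2" "f1 \<in> vecs F1" "f2 \<in> vecs F2"
      unfolding mem_iff by blast
    then show "f x = ip S f (restr Z (\<lambda>y. k1 x y + k2 x y))"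
      unfolding r using kx
      by (simp add: ip_sum reproducing_kernel_eval[OF k1 x] reproducing_kernel_eval[OF k2 x])
  qed
qed

lemma direct_sum_commute:
  assumes "is_direct_sum F1 F2 S"
  shows "is_direct_sum F2 F1 S"
  unfolding is_direct_sum_def
proof (intro conjI ballI)
  show "vecs F2 \<inter> vecs F1 = {0}"
    using assms unfolding is_direct_sum_def by (metis Int_commute)
  show "vecs S = {f2 + f1 |f2 f1. f2 \<in> vecs F2 \<and> f1 \<in> vecs F1}"
  proof -
    have "vecs S = {f1 + f2 |f1 f2. f1 \<in> vecs F1 \<and> f2 \<in> vecs F2}"
      using assms unfolding is_direct_sum_def by blast
    also have "\<dots> = {f2 + f1 |f2 f1. f2 \<in> vecs F2 \<and> f1 \<in> vecs F1}"
      by (subst add.commute) blast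
    finally show ?thesis .
  qed
  show "ip S (f2 + f1) (g2 + g1) = ip F2 f2 g2 + ip F1 f1 g1"
    if "f2 \<in> vecs F2" "f1 \<in> vecs F1" "g2 \<in> vecs F2" "g1 \<in> vecs F1" for f1 f2 g1 g2
    using assms that unfolding is_direct_sum_def
    by (simp only: add.commute[of f2] add.commute[of g2] add.commute[of "ip F2 f2 g2"])
qed

text \<open>A vector of \<open>F1\<close> is orthogonal to the part \<open>q x\<close> of the kernel
  function, so \<open>p x\<close> alone represents evaluation at \<open>x\<close> on
  \<open>F1\<close>. Symmetry follows from \<open>p x y = ip F1 (p x) (p y)\<close>.\<close>

lemma direct_sum_kernel_left:
  assumes "bilinear_space F1" "bilinear_space F2" and S: "is_direct_sum F1 F2 S"
    and k: "reproducing_kernel Z S k"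
    and pq: "\<And>x. x \<in> Z \<Longrightarrow> p x \<in> vecs F1" "\<And>x. x \<in> Z \<Longrightarrow> q x \<in> vecs F2"
      "\<And>x. x \<in> Z \<Longrightarrow> restr Z (k x) = p x + q x"
  shows "reproducing_kernel Z F1 p"
proof -
  interpret F1: bilinear_space F1 by fact
  interpret F2: bilinear_space F2 by fact
  interpret direct_sum F1 F2 S using S by unfold_locales
  have zero: "f x = 0" if "f \<in> vecs F1" "x \<notin> Z" for f x
    using reproducing_kernel_zero[OF k mem_left[OF that(1)] that(2)] .
  have p: "restr Z (p x) = p x" if "x \<in> Z" for x
    using zero[OF pq(1)[OF that]] by (auto simp: restr_def)
  have eval: "f x = ip F1 f (p x)" if "x \<in> Z" "f \<in> vecs F1" for f x
    using reproducing_kernel_eval[OF k that(1) mem_left[OF that(2)]] that pq by (simp add: ip_left)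
  show ?thesis
  proof (rule reproducing_kernelI)
    show "vecs F1 \<subseteq> functions_on Z" using zero by (auto simp: functions_on_def)
    show "p x y = p y x" if "x \<in> Z" "y \<in> Z" for x y
      using eval[of y "p x"] eval[of x "p y"] that pq F1.ip_commute[of "p x" "p y"] by simp
  qed (auto simp: p pq eval)
qed

text \<open>The Krein decompositions in a tensor product are arbitrary, and nothing in them says
  that their Hilbert spaces have kernels; splitting the given kernel provides these.\<close>

lemma direct_sum_kernels:
  assumes F: "bilinear_space F1" "bilinear_space F2" and S: "is_direct_sum F1 F2 S"
    and k: "reproducing_kernel Z S k"
  shows "\<exists>k1 k2. reproducing_kernel Z F1 k1 \<and> reproducing_kernel Z F2 k2 \<and>
    (\<forall>x\<in>Z. \<forall>y\<in>Z. k x y = k1 x y + k2 x y)"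
proof -
  have "\<exists>p q. p \<in> vecs F1 \<and> q \<in> vecs F2 \<and> restr Z (k x) = p + q" if "x \<in> Z" for x
    using reproducing_kernel_mem[OF k that] S unfolding is_direct_sum_def by blast
  then obtain p q where pq: "\<And>x. x \<in> Z \<Longrightarrow> p x \<in> vecs F1" "\<And>x. x \<in> Z \<Longrightarrow> q x \<in> vecs F2"
      "\<And>x. x \<in> Z \<Longrightarrow> restr Z (k x) = p x + q x"
    by metis
  have "reproducing_kernel Z F1 p" using direct_sum_kernel_left[OF F S k pq] .
  moreover have "reproducing_kernel Z F2 q"
    using direct_sum_kernel_left[OF F(2,1) direct_sum_commute[OF S] k, of q p] pq
    by (simp add: add.commute)
  moreover have "k x y = p x y + q x y" if "x \<in> Z" "y \<in> Z" for x y
    using fun_cong[OF pq(3)[OF that(1)], of y] that by (simp add: restr_def)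
  ultimately show ?thesis by blast
qed

section \<open>Krein decompositions as direct sums with one sign reversed\<close>

definition neg_ip :: "'f ip_space \<Rightarrow> 'f ip_space" where
  "neg_ip H = \<lparr>vecs = vecs H, ip = \<lambda>f g. - ip H f g\<rparr>"

lemma neg_ip_simps [simp]: "vecs (neg_ip H) = vecs H" "ip (neg_ip H) f g = - ip H f g"
  by (simp_all add: neg_ip_def)

lemma bilinear_neg_ip: "bilinear_space H \<Longrightarrow> bilinear_space (neg_ip H)"
  by (simp add: bilinear_space_def)

lemma reproducing_kernel_neg_ip:
  assumes "bilinear_space H"
  shows "reproducing_kernel Z H k \<Longrightarrow> reproducing_kernel Z (neg_ip H) (\<lambda>x y. - k x y)"
    and "reproducing_kernel Z (neg_ip H) k \<Longrightarrow> reproducing_kernel Z H (\<lambda>x y. - k x y)"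
proof -
  interpret bilinear_space H by fact
  have r: "restr Z (\<lambda>y. - k x y) = - restr Z (k x)" for x
    by (auto simp: restr_def fun_eq_iff)
  show "reproducing_kernel Z H k \<Longrightarrow> reproducing_kernel Z (neg_ip H) (\<lambda>x y. - k x y)"
    and "reproducing_kernel Z (neg_ip H) k \<Longrightarrow> reproducing_kernel Z H (\<lambda>x y. - k x y)"
    unfolding reproducing_kernel_def r by (auto simp: ip_minus_right)
qed

lemma krein_decomposition_iff:
  "krein_decomposition F Hp Hm \<longleftrightarrow> hilbert Hp \<and> hilbert Hm \<and> is_direct_sum Hp (neg_ip Hm) F"
proof
  assume K: "krein_decomposition F Hp Hm"
  then interpret bilinear_space F by (simp add: krein_decomposition_def inner_product_space_iff)
  show "hilbert Hp \<and> hilbert Hm \<and> is_direct_sum Hp (neg_ip Hm) F"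
    unfolding is_direct_sum_def neg_ip_simps
  proof (intro conjI ballI)
    show "vecs F = {f1 + f2 |f1 f2. f1 \<in> vecs Hp \<and> f2 \<in> vecs Hm}"
    proof (intro equalityI subsetI)
      fix f assume "f \<in> vecs F"
      then show "f \<in> {f1 + f2 |f1 f2. f1 \<in> vecs Hp \<and> f2 \<in> vecs Hm}"
        using K unfolding krein_decomposition_def by blast
    next
      fix f assume "f \<in> {f1 + f2 |f1 f2. f1 \<in> vecs Hp \<and> f2 \<in> vecs Hm}"
      then obtain p m where "f = p + m" "p \<in> vecs Hp" "m \<in> vecs Hm" by blast
      moreover have "vecs Hp \<subseteq> vecs F" "vecs Hm \<subseteq> vecs F"
        using K by (simp_all add: krein_decomposition_def)
      ultimately show "f \<in> vecs F" by (metis add_mem subsetD)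
    qed
    show "ip F (f1 + f2) (g1 + g2) = ip Hp f1 g1 + - ip Hm f2 g2"
      if "f1 \<in> vecs Hp" "f2 \<in> vecs Hm" "g1 \<in> vecs Hp" "g2 \<in> vecs Hm" for f1 f2 g1 g2
      using K that by (simp add: krein_decomposition_def)
  qed (use K in \<open>simp_all add: krein_decomposition_def hilbert_space_iff\<close>)
next
  assume A: "hilbert Hp \<and> hilbert Hm \<and> is_direct_sum Hp (neg_ip Hm) F"
  then interpret Hp: hilbert Hp + Hm: hilbert Hm by simp_all
  interpret N: bilinear_space "neg_ip Hm" by (rule bilinear_neg_ip) unfold_locales
  interpret direct_sum Hp "neg_ip Hm" F using A by unfold_locales simp
  interpret F: bilinear_space F by (rule bilinear)
  have "f = 0" if f: "f \<in> vecs F" "\<forall>g\<in>vecs F. ip F f g = 0" for f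
  proof -
    obtain p m where pm: "f = p + m" "p \<in> vecs Hp" "m \<in> vecs Hm" using f(1) unfolding mem_iff by auto
    \<comment> \<open>Nondegeneracy: \<open>p - m\<close> is the image of \<open>f\<close> under the
      fundamental symmetry, so its pairing with \<open>f\<close> is the value of the definite form
      at \<open>f\<close>.\<close>
    have "ip F f (p - m) = ip Hp p p + ip Hm m m"
      using ip_sum[of p m p "- m"] pm by (simp add: Hm.ip_minus_right)
    moreover have "p - m \<in> vecs F" using mem_sum[of p "- m"] pm by simp
    ultimately have "ip Hp p p + ip Hm m m = 0" using f(2) by simp
    then have "ip Hp p p = 0" "ip Hm m m = 0"
      using Hp.ip_nonneg[OF pm(2)] Hm.ip_nonneg[OF pm(3)] by linarith+
    then show ?thesis using Hp.ip_pos[of p] Hm.ip_pos[of m] pm by fastforce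
  qed
  then have "inner_product_space F"
    unfolding inner_product_space_iff using F.bilinear_space_axioms by blast
  then show "krein_decomposition F Hp Hm"
    unfolding krein_decomposition_def hilbert_space_iff
  proof (intro conjI ballI)
    show "vecs Hp \<inter> vecs Hm = {0}" using A by (simp add: is_direct_sum_def)
    show "\<exists>fp\<in>vecs Hp. \<exists>fm\<in>vecs Hm. f = fp + fm" if "f \<in> vecs F" for f
      using that unfolding mem_iff neg_ip_simps .
    show "ip F (fp + fm) (gp + gm) = ip Hp fp gp - ip Hm fm gm"
      if "fp \<in> vecs Hp" "fm \<in> vecs Hm" "gp \<in> vecs Hp" "gm \<in> vecs Hm" for fp fm gp gm
      using that by (simp add: ip_sum)
  qed (use A mem_left mem_right in auto)
qed

lemma krein_decomposition_bilinear: "krein_decomposition F Hp Hm \<Longrightarrow> bilinear_space F"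
  by (simp add: krein_decomposition_def inner_product_space_iff)

lemma krein_space_bilinear: "krein_space F \<Longrightarrow> bilinear_space F"
  unfolding krein_space_def using krein_decomposition_bilinear by blast

lemma hilbert_bilinear: "hilbert H \<Longrightarrow> bilinear_space H"
  by (simp add: hilbert_def pre_hilbert_def)

lemma krein_kernels:
  assumes K: "krein_decomposition F Hp Hm" and k: "reproducing_kernel Z F k"
  shows "\<exists>kp km. reproducing_kernel Z Hp kp \<and> reproducing_kernel Z Hm km \<and>
    (\<forall>x\<in>Z. \<forall>y\<in>Z. k x y = kp x y - km x y)"
proof -
  have H: "bilinear_space Hp" "bilinear_space Hm" and S: "is_direct_sum Hp (neg_ip Hm) F"
    using K by (simp_all add: krein_decomposition_iff hilbert_bilinear)
  obtain kp km where "reproducing_kernel Z Hp kp" "reproducing_kernel Z (neg_ip Hm) km"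
    "\<forall>x\<in>Z. \<forall>y\<in>Z. k x y = kp x y + km x y"
    using direct_sum_kernels[OF H(1) bilinear_neg_ip[OF H(2)] S k] by blast
  then show ?thesis
    using reproducing_kernel_neg_ip(2)[OF H(2)]
    by (intro exI[of _ kp] exI[of _ "\<lambda>x y. - km x y"]) simp
qed

lemma krein_kernel:
  assumes K: "krein_decomposition F Hp Hm"
    and k: "reproducing_kernel Z Hp kp" "reproducing_kernel Z Hm km"
  shows "reproducing_kernel Z F (\<lambda>x y. kp x y - km x y)"
proof -
  have H: "bilinear_space Hp" "bilinear_space Hm" and S: "is_direct_sum Hp (neg_ip Hm) F"
    using K by (simp_all add: krein_decomposition_iff hilbert_bilinear)
  show ?thesis
    using direct_sum_kernel[OF H(1) bilinear_neg_ip[OF H(2)] S k(1)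
        reproducing_kernel_neg_ip(1)[OF H(2) k(2)]] by simp
qed

lemma ex_krein_decomposition:
  assumes "hilbert Hp" "hilbert Hm" "vecs Hp \<inter> vecs Hm = {0}"
  shows "\<exists>F. krein_decomposition F Hp Hm"
proof -
  have "subspace (vecs Hp)" "subspace (vecs (neg_ip Hm))"
    using assms(1,2)[THEN hilbert_bilinear] by (simp_all add: bilinear_space_def)
  then obtain F where "is_direct_sum Hp (neg_ip Hm) F"
    using ex_direct_sum[of Hp "neg_ip Hm"] assms(3) unfolding neg_ip_simps by blast
  then show ?thesis using assms(1,2) unfolding krein_decomposition_iff by blast
qed

lemma krein_decomposition_mem:
  assumes "krein_decomposition F Hp Hm"
  shows "fp \<in> vecs Hp \<Longrightarrow> fm \<in> vecs Hm \<Longrightarrow> fp + fm \<in> vecs F"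
    and "f \<in> vecs F \<Longrightarrow> \<exists>fp\<in>vecs Hp. \<exists>fm\<in>vecs Hm. f = fp + fm"
    and "vecs Hp \<inter> vecs Hm = {0}"
  using assms unfolding krein_decomposition_iff is_direct_sum_def neg_ip_simps by blast+

text \<open>The two positive parts together form the positive part of the sum, and likewise the
  negative parts. All four are independent because \<open>F1\<close> and \<open>F2\<close> are, and
  because the two parts of each of them are.\<close>

lemma direct_sum_krein:
  assumes "krein_space F1" "krein_space F2" and S: "is_direct_sum F1 F2 S"
  shows "krein_space S"
proof -
  obtain P1 M1 P2 M2 where K1: "krein_decomposition F1 P1 M1" and K2: "krein_decomposition F2 P2 M2"
    using assms by (auto simp: krein_space_def)
  interpret P1: hilbert P1 + M1: hilbert M1 + P2: hilbert P2 + M2: hilbert M2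
    using K1 K2 by (simp_all add: krein_decomposition_iff)
  interpret F1: bilinear_space F1 using K1 by (rule krein_decomposition_bilinear)
  interpret F2: bilinear_space F2 using K2 by (rule krein_decomposition_bilinear)
  interpret N1: bilinear_space "neg_ip M1" by (rule bilinear_neg_ip) unfold_locales
  interpret N2: bilinear_space "neg_ip M2" by (rule bilinear_neg_ip) unfold_locales
  interpret S1: direct_sum P1 "neg_ip M1" F1 using K1 by unfold_locales (simp add: krein_decomposition_iff)
  interpret S2: direct_sum P2 "neg_ip M2" F2 using K2 by unfold_locales (simp add: krein_decomposition_iff)
  interpret S: direct_sum F1 F2 S using S by unfold_locales
  have 0: "vecs F1 \<inter> vecs F2 = {0}" using S by (simp add: is_direct_sum_def)
  have unique: "p1 = 0 \<and> m1 = 0 \<and> p2 = 0 \<and> m2 = 0"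
    if m: "p1 \<in> vecs P1" "m1 \<in> vecs M1" "p2 \<in> vecs P2" "m2 \<in> vecs M2"
      and e: "p1 + m1 + (p2 + m2) = 0" for p1 m1 p2 m2
  proof -
    have "p1 + m1 = 0 \<and> p2 + m2 = 0"
      by (rule direct_sum_unique[OF F1.subspace F2.subspace 0])
         (use m S1.mem_sum[of p1 m1] S2.mem_sum[of p2 m2] e in auto)
    then show ?thesis
      using direct_sum_unique[OF P1.subspace M1.subspace krein_decomposition_mem(3)[OF K1], of p1 m1 0 0]
        direct_sum_unique[OF P2.subspace M2.subspace krein_decomposition_mem(3)[OF K2], of p2 m2 0 0] m
      by simp
  qed
  have "vecs P1 \<inter> vecs P2 = {0}" "vecs M1 \<inter> vecs M2 = {0}"
    using 0 S1.mem_left S2.mem_left S1.mem_right S2.mem_right by fastforce+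
  then obtain P M where P: "is_direct_sum P1 P2 P" and M: "is_direct_sum M1 M2 M"
    using ex_direct_sum[OF P1.subspace P2.subspace] ex_direct_sum[OF M1.subspace M2.subspace] by metis
  interpret P: direct_sum P1 P2 P using P by unfold_locales
  interpret M: direct_sum M1 M2 M using M by unfold_locales
  have "krein_decomposition S P M"
    unfolding krein_decomposition_iff
  proof (intro conjI)
    show "hilbert P" "hilbert M" using direct_sum_hilbert P M by (blast intro: P1.hilbert_axioms
        P2.hilbert_axioms M1.hilbert_axioms M2.hilbert_axioms)+
    show "is_direct_sum P (neg_ip M) S"
      unfolding is_direct_sum_def neg_ip_simps
    proof (intro conjI ballI)
      show "vecs P \<inter> vecs M = {0}"
      proof (intro equalityI subsetI)
        fix f assume "f \<in> vecs P \<inter> vecs M"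
        then obtain p1 p2 m1 m2 where f: "f = p1 + p2" "f = m1 + m2"
          "p1 \<in> vecs P1" "m1 \<in> vecs M1" "p2 \<in> vecs P2" "m2 \<in> vecs M2"
          unfolding P.mem_iff M.mem_iff Int_iff by blast
        then have "p1 + - m1 + (p2 + - m2) = 0" by (simp add: algebra_simps)
        with unique[of p1 "- m1" p2 "- m2"] f show "f \<in> {0}" by simp
      next
        fix f :: 'a assume "f \<in> {0}"
        then show "f \<in> vecs P \<inter> vecs M"
          using P.mem_left[OF P1.zero_mem] M.mem_left[OF M1.zero_mem] by simp
      qed
      show "vecs S = {f1 + f2 |f1 f2. f1 \<in> vecs P \<and> f2 \<in> vecs M}"
      proof (intro equalityI subsetI)
        fix f assume "f \<in> vecs S"
        then obtain f1 f2 where f12: "f = f1 + f2" "f1 \<in> vecs F1" "f2 \<in> vecs F2"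
          unfolding S.mem_iff by blast
        then obtain p1 m1 p2 m2 where "f1 = p1 + m1" "f2 = p2 + m2" and
          m: "p1 \<in> vecs P1" "m1 \<in> vecs M1" "p2 \<in> vecs P2" "m2 \<in> vecs M2"
          unfolding S1.mem_iff S2.mem_iff neg_ip_simps by blast
        with f12(1) have f: "f = p1 + m1 + (p2 + m2)" by simp
        then have "f = (p1 + p2) + (m1 + m2)" by (simp add: algebra_simps)
        then show "f \<in> {f1 + f2 |f1 f2. f1 \<in> vecs P \<and> f2 \<in> vecs M}"
          using P.mem_sum[OF m(1,3)] M.mem_sum[OF m(2,4)] by blast
      next
        fix f assume "f \<in> {f1 + f2 |f1 f2. f1 \<in> vecs P \<and> f2 \<in> vecs M}"
        then obtain p1 m1 p2 m2 where f: "f = (p1 + p2) + (m1 + m2)"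
          "p1 \<in> vecs P1" "m1 \<in> vecs M1" "p2 \<in> vecs P2" "m2 \<in> vecs M2"
          unfolding P.mem_iff M.mem_iff by blast
        then have e: "f = p1 + m1 + (p2 + m2)" by (simp add: algebra_simps)
        show "f \<in> vecs S"
          unfolding e using f S1.mem_sum[of p1 m1] S2.mem_sum[of p2 m2] by (intro S.mem_sum) simp_all
      qed
    next
      fix f1 f2 g1 g2
      assume "f1 \<in> vecs P" "f2 \<in> vecs M" "g1 \<in> vecs P" "g2 \<in> vecs M"
      then obtain p1 p2 m1 m2 q1 q2 n1 n2 where f: "f1 = p1 + p2" "f2 = m1 + m2" "g1 = q1 + q2" "g2 = n1 + n2"
        and m: "p1 \<in> vecs P1" "m1 \<in> vecs M1" "p2 \<in> vecs P2" "m2 \<in> vecs M2"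
          "q1 \<in> vecs P1" "n1 \<in> vecs M1" "q2 \<in> vecs P2" "n2 \<in> vecs M2"
        unfolding P.mem_iff M.mem_iff by metis
      have "ip S (f1 + f2) (g1 + g2) = ip S ((p1 + m1) + (p2 + m2)) ((q1 + n1) + (q2 + n2))"
        by (simp add: f algebra_simps)
      also have "\<dots> = ip F1 (p1 + m1) (q1 + n1) + ip F2 (p2 + m2) (q2 + n2)"
        using m S1.mem_sum S2.mem_sum by (simp add: S.ip_sum)
      also have "\<dots> = (ip P1 p1 q1 - ip M1 m1 n1) + (ip P2 p2 q2 - ip M2 m2 n2)"
        using m by (simp add: S1.ip_sum S2.ip_sum)
      also have "\<dots> = ip P f1 g1 + - ip M f2 g2"
        using m by (simp add: f P.ip_sum M.ip_sum)
      finally show "ip S (f1 + f2) (g1 + g2) = ip P f1 g1 + - ip M f2 g2" .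
    qed
  qed
  then show ?thesis by (auto simp: krein_space_def)
qed

lemma direct_sum_rkks:
  assumes "rkks Z F1 k1" "rkks Z F2 k2" "is_direct_sum F1 F2 S"
  shows "rkks Z S (\<lambda>x y. k1 x y + k2 x y)"
  using assms direct_sum_krein direct_sum_kernel krein_space_bilinear unfolding rkks_def by blast

section \<open>Krein tensor products\<close>

lemma hilbert_tensorI:
  assumes "hilbert H1" "hilbert H2" "reproducing_kernel X1 H1 k1" "reproducing_kernel X2 H2 k2"
    and "is_hilbert_tensor X1 H1 X2 H2 H"
  shows "hilbert_tensor H1 H2 H X1 k1 X2 k2"
  using assms by (simp add: hilbert_tensor_def hilbert_tensor_axioms_def)

text \<open>The first letter names the part of \<open>F1\<close> and the second the part of
  \<open>F2\<close>, so that \<open>PM\<close> is the tensor product of \<open>P1\<close> and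
  \<open>M2\<close>; \<open>p1\<close>, \<open>m1\<close>, \<open>p2\<close>, \<open>m2\<close> are
  the kernels of the parts.\<close>

locale krein_tensor =
  PP: hilbert_tensor P1 P2 PP X1 p1 X2 p2 + MM: hilbert_tensor M1 M2 MM X1 m1 X2 m2 +
  PM: hilbert_tensor P1 M2 PM X1 p1 X2 m2 + MP: hilbert_tensor M1 P2 MP X1 m1 X2 p2
  for F1 P1 M1 :: "('a \<Rightarrow> real) ip_space" and F2 P2 M2 :: "('b \<Rightarrow> real) ip_space"
    and PP MM PM MP :: "('a \<times> 'b \<Rightarrow> real) ip_space"
    and X1 :: "'a set" and p1 m1 and X2 :: "'b set" and p2 m2 +
  assumes K1: "krein_decomposition F1 P1 M1" and K2: "krein_decomposition F2 P2 M2"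
begin

lemma left_trivial:
  assumes "\<And>y. (\<lambda>x. f (x, y)) \<in> vecs P1" "\<And>y. (\<lambda>x. f (x, y)) \<in> vecs M1"
  shows "f = 0"
proof -
  have "(\<lambda>x. f (x, y)) = 0" for y
    using assms krein_decomposition_mem(3)[OF K1] by blast
  then have "f (x, y) = 0" for x y by (metis zero_fun_apply)
  then show ?thesis by auto
qed

lemma right_trivial:
  assumes "\<And>x. (\<lambda>y. f (x, y)) \<in> vecs P2" "\<And>x. (\<lambda>y. f (x, y)) \<in> vecs M2"
  shows "f = 0"
proof -
  have "(\<lambda>y. f (x, y)) = 0" for x
    using assms krein_decomposition_mem(3)[OF K2] by blast
  then have "f (x, y) = 0" for x y by (metis zero_fun_apply)
  then show ?thesis by auto
qed

lemma PP_MM: "vecs PP \<inter> vecs MM = {0}"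
proof -
  have "f = 0" if "f \<in> vecs PP" "f \<in> vecs MM" for f
    by (rule left_trivial) (rule PP.section_left MM.section_left, fact that)+
  then show ?thesis using PP.H.zero_mem MM.H.zero_mem by blast
qed

lemma PM_MP: "vecs PM \<inter> vecs MP = {0}"
proof -
  have "f = 0" if "f \<in> vecs PM" "f \<in> vecs MP" for f
    by (rule left_trivial) (rule PM.section_left MP.section_left, fact that)+
  then show ?thesis using PM.H.zero_mem MP.H.zero_mem by blast
qed

text \<open>From \<open>a + b = c + d\<close> follows \<open>a - c = d - b\<close>. Its sections in
  the first coordinate lie in \<open>P1\<close> by the left side and in \<open>M1\<close> by the
  right side, so \<open>a = c\<close> and \<open>b = d\<close>. Then the sections of both in the
  second coordinate lie in \<open>P2\<close> and in \<open>M2\<close>.\<close>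

lemma sum_trivial:
  assumes Tp: "is_direct_sum PP MM Tp" and Tm: "is_direct_sum PM MP Tm"
  shows "vecs Tp \<inter> vecs Tm = {0}"
proof (intro equalityI subsetI)
  interpret Tp: direct_sum PP MM Tp using Tp by unfold_locales
  interpret Tm: direct_sum PM MP Tm using Tm by unfold_locales
  fix f assume "f \<in> vecs Tp \<inter> vecs Tm"
  then obtain a b c d where f: "f = a + b" "f = c + d"
    and m: "a \<in> vecs PP" "b \<in> vecs MM" "c \<in> vecs PM" "d \<in> vecs MP"
    unfolding Int_iff Tp.mem_iff Tm.mem_iff by metis
  have "a z + b z = c z + d z" for z
    using f by (metis plus_fun_apply)
  then have e: "a z - c z = d z - b z" for z
    by (simp add: algebra_simps)
  have "a - c = 0"
  proof (rule left_trivial)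
    fix y
    show "(\<lambda>x. (a - c) (x, y)) \<in> vecs P1"
      using PP.H1.diff_mem[OF PP.section_left[OF m(1)] PM.section_left[OF m(3)], of y]
      by (simp add: fun_diff_def)
    show "(\<lambda>x. (a - c) (x, y)) \<in> vecs M1"
      using MM.H1.diff_mem[OF MP.section_left[OF m(4)] MM.section_left[OF m(2)], of y]
      by (simp add: fun_diff_def e)
  qed
  then have ac: "a = c" by (simp only: right_minus_eq)
  with f have bd: "b = d" by simp
  have "a = 0"
    using PP.section_right[OF m(1)] PM.section_right[OF m(3)] unfolding ac by (rule right_trivial)
  moreover have "b = 0"
    using MP.section_right[OF m(4)] MM.section_right[OF m(2)] unfolding bd by (rule right_trivial)
  ultimately show "f \<in> {0}" using f by simp
next
  interpret Tp: direct_sum PP MM Tp using Tp by unfold_locales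
  interpret Tm: direct_sum PM MP Tm using Tm by unfold_locales
  fix f :: "'a \<times> 'b \<Rightarrow> real" assume "f \<in> {0}"
  then show "f \<in> vecs Tp \<inter> vecs Tm"
    using Tp.mem_left[OF PP.H.zero_mem] Tm.mem_left[OF PM.H.zero_mem] by blast
qed

context
  fixes Tp Tm T
  assumes Tp: "is_direct_sum PP MM Tp" and Tm: "is_direct_sum PM MP Tm"
    and T: "krein_decomposition T Tp Tm"
begin

lemma reproducing_kernel_T:
  "reproducing_kernel (X1 \<times> X2) T (kernel_tensor (\<lambda>x y. p1 x y - m1 x y) (\<lambda>x y. p2 x y - m2 x y))"
proof -
  have "reproducing_kernel (X1 \<times> X2) Tp (\<lambda>x y. kernel_tensor p1 p2 x y + kernel_tensor m1 m2 x y)"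
    "reproducing_kernel (X1 \<times> X2) Tm (\<lambda>x y. kernel_tensor p1 m2 x y + kernel_tensor m1 p2 x y)"
    using direct_sum_kernel[OF PP.H.bilinear_space_axioms MM.H.bilinear_space_axioms Tp
        PP.reproducing_kernel MM.reproducing_kernel]
      direct_sum_kernel[OF PM.H.bilinear_space_axioms MP.H.bilinear_space_axioms Tm
        PM.reproducing_kernel MP.reproducing_kernel] .
  from krein_kernel[OF T this] show ?thesis
    by (rule reproducing_kernel_cong) (auto simp: kernel_tensor_def algebra_simps)
qed

text \<open>One sum in two groupings: the first brackets the terms that share a part of
  \<open>F1\<close>, the second those that share a part of \<open>F2\<close>, as the two section
  lemmas require.\<close>

lemma mem_T:
  assumes "f \<in> vecs T"
  obtains a b c d where "\<And>x y. f (x, y) = (a (x, y) + c (x, y)) + (b (x, y) + d (x, y))"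
    "\<And>x y. f (x, y) = (a (x, y) + d (x, y)) + (b (x, y) + c (x, y))"
    "a \<in> vecs PP" "b \<in> vecs MM" "c \<in> vecs PM" "d \<in> vecs MP"
proof -
  obtain g k where "f = g + k" "g \<in> vecs Tp" "k \<in> vecs Tm"
    using krein_decomposition_mem(2)[OF T assms] by blast
  moreover obtain a b where "g = a + b" "a \<in> vecs PP" "b \<in> vecs MM"
    using \<open>g \<in> vecs Tp\<close> Tp unfolding is_direct_sum_def by blast
  moreover obtain c d where "k = c + d" "c \<in> vecs PM" "d \<in> vecs MP"
    using \<open>k \<in> vecs Tm\<close> Tm unfolding is_direct_sum_def by blast
  ultimately show ?thesis by (intro that[of a c b d]) auto
qed

lemma section_left:
  assumes "f \<in> vecs T"
  shows "(\<lambda>x. f (x, y)) \<in> vecs F1"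
proof -
  obtain a b c d where f: "\<And>x y. f (x, y) = (a (x, y) + c (x, y)) + (b (x, y) + d (x, y))"
    and m: "a \<in> vecs PP" "b \<in> vecs MM" "c \<in> vecs PM" "d \<in> vecs MP"
    using mem_T[OF assms] by metis
  have "(\<lambda>x. f (x, y)) = ((\<lambda>x. a (x, y)) + (\<lambda>x. c (x, y))) + ((\<lambda>x. b (x, y)) + (\<lambda>x. d (x, y)))"
    by (simp add: fun_eq_iff f)
  also have "\<dots> \<in> vecs F1"
    using m by (intro krein_decomposition_mem(1)[OF K1] PP.H1.add_mem MM.H1.add_mem
        PP.section_left MM.section_left PM.section_left MP.section_left)
  finally show ?thesis .
qed

lemma section_right:
  assumes "f \<in> vecs T"
  shows "(\<lambda>y. f (x, y)) \<in> vecs F2"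
proof -
  obtain a b c d where f: "\<And>x y. f (x, y) = (a (x, y) + d (x, y)) + (b (x, y) + c (x, y))"
    and m: "a \<in> vecs PP" "b \<in> vecs MM" "c \<in> vecs PM" "d \<in> vecs MP"
    using mem_T[OF assms] by metis
  have "(\<lambda>y. f (x, y)) = ((\<lambda>y. a (x, y)) + (\<lambda>y. d (x, y))) + ((\<lambda>y. b (x, y)) + (\<lambda>y. c (x, y)))"
    by (simp add: fun_eq_iff f)
  also have "\<dots> \<in> vecs F2"
    using m by (intro krein_decomposition_mem(1)[OF K2] PP.H2.add_mem MM.H2.add_mem
        PP.section_right MM.section_right PM.section_right MP.section_right)
  finally show ?thesis .
qed

end

end

lemma rkks_decomposition:
  assumes K: "krein_decomposition F Hp Hm" and F: "rkks X F h"
  obtains p m where "hilbert Hp" "hilbert Hm" "reproducing_kernel X Hp p" "reproducing_kernel X Hm m"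
    "\<And>x y. x \<in> X \<Longrightarrow> y \<in> X \<Longrightarrow> h x y = p x y - m x y"
  using krein_kernels[OF K] K F unfolding rkks_def krein_decomposition_iff by metis

lemma ex_krein_tensor:
  assumes F1: "rkks X1 F1 h1" and F2: "rkks X2 F2 h2"
  shows "\<exists>T. is_krein_tensor X1 F1 X2 F2 T"
proof -
  obtain P1 M1 P2 M2 where K1: "krein_decomposition F1 P1 M1" and K2: "krein_decomposition F2 P2 M2"
    using F1 F2 by (auto simp: rkks_def krein_space_def)
  obtain p1 m1 where H1: "hilbert P1" "hilbert M1" "reproducing_kernel X1 P1 p1" "reproducing_kernel X1 M1 m1"
    using rkks_decomposition[OF K1 F1] by metis
  obtain p2 m2 where H2: "hilbert P2" "hilbert M2" "reproducing_kernel X2 P2 p2" "reproducing_kernel X2 M2 m2"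
    using rkks_decomposition[OF K2 F2] by metis
  have ex: "\<exists>H. is_hilbert_tensor X1 A X2 B H"
    if "hilbert A" "reproducing_kernel X1 A k" "hilbert B" "reproducing_kernel X2 B l" for A B k l
    using that by (intro ex_hilbert_tensor) (auto simp: hilbert_space_iff)
  obtain PP MM PM MP where t: "is_hilbert_tensor X1 P1 X2 P2 PP" "is_hilbert_tensor X1 M1 X2 M2 MM"
    "is_hilbert_tensor X1 P1 X2 M2 PM" "is_hilbert_tensor X1 M1 X2 P2 MP"
    using ex[OF H1(1,3) H2(1,3)] ex[OF H1(2,4) H2(2,4)] ex[OF H1(1,3) H2(2,4)] ex[OF H1(2,4) H2(1,3)]
    by metis
  interpret krein_tensor F1 P1 M1 F2 P2 M2 PP MM PM MP X1 p1 m1 X2 p2 m2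
    using H1 H2 t K1 K2 by (intro krein_tensor.intro hilbert_tensorI krein_tensor_axioms.intro)
  obtain Tp Tm where Tp: "is_direct_sum PP MM Tp" and Tm: "is_direct_sum PM MP Tm"
    using ex_direct_sum[OF PP.H.subspace MM.H.subspace PP_MM]
      ex_direct_sum[OF PM.H.subspace MP.H.subspace PM_MP] by metis
  have "hilbert Tp" "hilbert Tm"
    using direct_sum_hilbert[OF PP.H.hilbert_axioms MM.H.hilbert_axioms Tp]
      direct_sum_hilbert[OF PM.H.hilbert_axioms MP.H.hilbert_axioms Tm] .
  then obtain T where "krein_decomposition T Tp Tm"
    using ex_krein_decomposition sum_trivial[OF Tp Tm] by metis
  then show ?thesis
    unfolding is_krein_tensor_def using K1 K2 t Tp Tm by blast
qed

text \<open>Whatever decompositions \<open>T\<close> comes from, they split \<open>h1\<close> as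
  \<open>p1 - m1\<close> and \<open>h2\<close> as \<open>p2 - m2\<close>, so the kernel depends on
  \<open>h1\<close> and \<open>h2\<close> alone. These splittings hold only on \<open>X1\<close> and
  \<open>X2\<close>, hence the passage through \<open>reproducing_kernel_cong\<close>.\<close>

lemma krein_tensor_facts:
  assumes F1: "rkks X1 F1 h1" and F2: "rkks X2 F2 h2" and T: "is_krein_tensor X1 F1 X2 F2 T"
  shows krein_tensor_rkks: "rkks (X1 \<times> X2) T (kernel_tensor h1 h2)"
    and krein_tensor_section_left: "f \<in> vecs T \<Longrightarrow> (\<lambda>x. f (x, y)) \<in> vecs F1"
    and krein_tensor_section_right: "f \<in> vecs T \<Longrightarrow> (\<lambda>y. f (x, y)) \<in> vecs F2"
proof -
  obtain P1 M1 P2 M2 PP MM PM MP Tp Tm where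
    K1: "krein_decomposition F1 P1 M1" and K2: "krein_decomposition F2 P2 M2" and
    t: "is_hilbert_tensor X1 P1 X2 P2 PP" "is_hilbert_tensor X1 M1 X2 M2 MM"
    "is_hilbert_tensor X1 P1 X2 M2 PM" "is_hilbert_tensor X1 M1 X2 P2 MP" and
    d: "is_direct_sum PP MM Tp" "is_direct_sum PM MP Tm" "krein_decomposition T Tp Tm"
    using T unfolding is_krein_tensor_def by blast
  obtain p1 m1 where H1: "hilbert P1" "hilbert M1" "reproducing_kernel X1 P1 p1" "reproducing_kernel X1 M1 m1"
    and h1: "\<And>x y. x \<in> X1 \<Longrightarrow> y \<in> X1 \<Longrightarrow> h1 x y = p1 x y - m1 x y"
    using rkks_decomposition[OF K1 F1] by metis
  obtain p2 m2 where H2: "hilbert P2" "hilbert M2" "reproducing_kernel X2 P2 p2" "reproducing_kernel X2 M2 m2"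
    and h2: "\<And>x y. x \<in> X2 \<Longrightarrow> y \<in> X2 \<Longrightarrow> h2 x y = p2 x y - m2 x y"
    using rkks_decomposition[OF K2 F2] by metis
  interpret krein_tensor F1 P1 M1 F2 P2 M2 PP MM PM MP X1 p1 m1 X2 p2 m2
    using H1 H2 t K1 K2 by (intro krein_tensor.intro hilbert_tensorI krein_tensor_axioms.intro)
  have "reproducing_kernel (X1 \<times> X2) T (kernel_tensor h1 h2)"
    by (rule reproducing_kernel_cong[OF reproducing_kernel_T[OF d]])
       (auto simp: kernel_tensor_def h1 h2)
  then show "rkks (X1 \<times> X2) T (kernel_tensor h1 h2)"
    using d(3) by (auto simp: rkks_def krein_space_def)
  show "f \<in> vecs T \<Longrightarrow> (\<lambda>x. f (x, y)) \<in> vecs F1" by (rule section_left[OF d])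
  show "f \<in> vecs T \<Longrightarrow> (\<lambda>y. f (x, y)) \<in> vecs F2" by (rule section_right[OF d])
qed

subsection \<open>Isometries\<close>

text \<open>Linearity is global, but injectivity is asked only on \<open>vecs H\<close>, because
  \<open>pull_back\<close> ignores all values outside the product set.\<close>

definition isometry :: "('f::real_vector \<Rightarrow> 'g::real_vector) \<Rightarrow> 'f ip_space \<Rightarrow> 'g ip_space \<Rightarrow> bool" where
  "isometry \<phi> H K \<longleftrightarrow> linear \<phi> \<and> inj_on \<phi> (vecs H) \<and> vecs K = \<phi> ` vecs H \<and>
     (\<forall>f\<in>vecs H. \<forall>g\<in>vecs H. ip K (\<phi> f) (\<phi> g) = ip H f g)"

lemma ex_isometry:
  assumes "linear \<phi>" "inj_on \<phi> (vecs H)"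
  shows "\<exists>K. isometry \<phi> H K"
  by (rule exI[of _ "\<lparr>vecs = \<phi> ` vecs H,
        ip = \<lambda>f g. ip H (inv_into (vecs H) \<phi> f) (inv_into (vecs H) \<phi> g)\<rparr>"])
     (use assms in \<open>simp add: isometry_def inv_into_f_f\<close>)

lemma isometry_hilbert:
  assumes i: "isometry \<phi> H K" and "hilbert H"
  shows "hilbert K"
proof -
  interpret H: hilbert H by fact
  have lin: "linear \<phi>" and v: "vecs K = \<phi> ` vecs H"
    and ip: "\<And>f g. f \<in> vecs H \<Longrightarrow> g \<in> vecs H \<Longrightarrow> ip K (\<phi> f) (\<phi> g) = ip H f g"
    using i by (auto simp: isometry_def)
  interpret K: bilinear_space K
  proof
    show "subspace (vecs K)" unfolding v using lin H.subspace by (rule linear_subspace_image)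
  next
    fix f g assume "f \<in> vecs K" "g \<in> vecs K"
    then obtain f' g' where f: "f = \<phi> f'" "f' \<in> vecs H" and g: "g = \<phi> g'" "g' \<in> vecs H"
      unfolding v by blast
    show "ip K f g = ip K g f" using f g by (simp add: ip H.ip_commute[of f' g'])
    show "ip K (a *\<^sub>R f) g = a * ip K f g" for a
      using f g by (simp add: ip H.ip_scale_left flip: linear_scale[OF lin])
    fix k assume "k \<in> vecs K"
    then obtain k' where k: "k = \<phi> k'" "k' \<in> vecs H" unfolding v by blast
    show "ip K (f + g) k = ip K f k + ip K g k"
      using f g k by (simp add: ip H.ip_add_left flip: linear_add[OF lin])
  qed
  interpret K: pre_hilbert K
  proof
    fix f assume "f \<in> vecs K" "f \<noteq> 0"
    then obtain f' where f: "f = \<phi> f'" "f' \<in> vecs H" "f' \<noteq> 0" unfolding v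
      using linear_0[OF lin] by blast
    then show "0 < ip K f f" by (simp add: ip H.ip_pos)
  qed
  have nrm: "K.nrm (\<phi> f - \<phi> g) = H.nrm (f - g)" if "f \<in> vecs H" "g \<in> vecs H" for f g
    using that by (simp add: ip_norm_def ip flip: linear_diff[OF lin])
  show ?thesis
  proof
    fix s assume s: "cauchy_in K s"
    then have "\<exists>f. f \<in> vecs H \<and> s n = \<phi> f" for n using cauchy_in_mem[OF s, of n] unfolding v by blast
    then obtain t where t: "\<And>n. t n \<in> vecs H" "\<And>n. s n = \<phi> (t n)" by metis
    have "cauchy_in H t" using s t by (simp add: cauchy_in_def nrm)
    then obtain f where "conv_in H t f" using H.complete by blast
    then have "conv_in K s (\<phi> f)" using t by (simp add: conv_in_def nrm v)
    then show "\<exists>f. conv_in K s f" ..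
  qed
qed

text \<open>Both Hilbert parts are transported by the same \<open>\<phi>\<close>; its injectivity on
  all of \<open>vecs F\<close> keeps their images independent.\<close>

lemma isometry_krein:
  assumes i: "isometry \<phi> F G" and "krein_space F"
  shows "krein_space G"
proof -
  obtain P M where K: "krein_decomposition F P M" using assms(2) by (auto simp: krein_space_def)
  then have H: "hilbert P" "hilbert M" and S: "is_direct_sum P (neg_ip M) F"
    by (simp_all add: krein_decomposition_iff)
  have sub: "vecs P \<subseteq> vecs F" "vecs M \<subseteq> vecs F" using K by (simp_all add: krein_decomposition_def)
  have lin: "linear \<phi>" and inj: "inj_on \<phi> (vecs F)" and v: "vecs G = \<phi> ` vecs F"
    and ip: "\<And>f g. f \<in> vecs F \<Longrightarrow> g \<in> vecs F \<Longrightarrow> ip G (\<phi> f) (\<phi> g) = ip F f g"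
    using i by (auto simp: isometry_def)
  obtain P' M' where P: "isometry \<phi> P P'" and M: "isometry \<phi> M M'"
    using ex_isometry[OF lin] inj_on_subset[OF inj] sub by metis
  have PM: "vecs P' = \<phi> ` vecs P" "vecs M' = \<phi> ` vecs M"
    "\<And>f g. f \<in> vecs P \<Longrightarrow> g \<in> vecs P \<Longrightarrow> ip P' (\<phi> f) (\<phi> g) = ip P f g"
    "\<And>f g. f \<in> vecs M \<Longrightarrow> g \<in> vecs M \<Longrightarrow> ip M' (\<phi> f) (\<phi> g) = ip M f g"
    using P M by (auto simp: isometry_def)
  have "is_direct_sum P' (neg_ip M') G"
    unfolding is_direct_sum_def neg_ip_simps
  proof (intro conjI ballI)
    have "vecs P' \<inter> vecs M' = \<phi> ` (vecs P \<inter> vecs M)"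
      unfolding PM using inj_on_image_Int[OF inj sub] by simp
    also have "\<dots> = {0}" using krein_decomposition_mem(3)[OF K] linear_0[OF lin] by simp
    finally show "vecs P' \<inter> vecs M' = {0}" .
    show "vecs G = {f1 + f2 |f1 f2. f1 \<in> vecs P' \<and> f2 \<in> vecs M'}"
    proof (intro equalityI subsetI)
      fix g assume "g \<in> vecs G"
      then obtain f where "g = \<phi> f" "f \<in> vecs F" unfolding v by blast
      moreover from this obtain a b where "f = a + b" "a \<in> vecs P" "b \<in> vecs M"
        using krein_decomposition_mem(2)[OF K] by blast
      ultimately show "g \<in> {f1 + f2 |f1 f2. f1 \<in> vecs P' \<and> f2 \<in> vecs M'}"
        using linear_add[OF lin] unfolding PM by blast
    next
      fix g assume "g \<in> {f1 + f2 |f1 f2. f1 \<in> vecs P' \<and> f2 \<in> vecs M'}"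
      then obtain a b where "g = \<phi> a + \<phi> b" "a \<in> vecs P" "b \<in> vecs M"
        unfolding PM by blast
      then show "g \<in> vecs G"
        using krein_decomposition_mem(1)[OF K, of a b] unfolding v linear_add[OF lin, symmetric] by blast
    qed
  next
    fix f1 f2 g1 g2
    assume "f1 \<in> vecs P'" "f2 \<in> vecs M'" "g1 \<in> vecs P'" "g2 \<in> vecs M'"
    then obtain a b c d where e: "f1 = \<phi> a" "f2 = \<phi> b" "g1 = \<phi> c" "g2 = \<phi> d"
      and m: "a \<in> vecs P" "b \<in> vecs M" "c \<in> vecs P" "d \<in> vecs M"
      unfolding PM by blast
    have "ip G (f1 + f2) (g1 + g2) = ip F (a + b) (c + d)"
      unfolding e linear_add[OF lin, symmetric]
      using m by (intro ip krein_decomposition_mem(1)[OF K])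
    also have "\<dots> = ip P a c - ip M b d"
      using K m by (simp add: krein_decomposition_def)
    also have "\<dots> = ip P' f1 g1 + - ip M' f2 g2"
      using m by (simp add: e PM)
    finally show "ip G (f1 + f2) (g1 + g2) = ip P' f1 g1 + - ip M' f2 g2" .
  qed
  then have "krein_decomposition G P' M'"
    unfolding krein_decomposition_iff using isometry_hilbert P M H by blast
  then show ?thesis by (auto simp: krein_space_def)
qed

section \<open>Iterated tensor products\<close>

lemma hilbert_zero_space:
  assumes "vecs Z = {0}" "ip Z 0 0 = 0"
  shows "hilbert Z"
proof -
  interpret pre_hilbert Z
    by unfold_locales (auto simp: assms subspace_single_0)
  show ?thesis
  proof
    fix s assume s: "cauchy_in Z s"
    then have "s n = 0" for n using cauchy_in_mem[OF s] assms by simp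
    then show "\<exists>f. conv_in Z s f" by (intro exI[of _ 0]) (simp add: conv_in_def)
  qed
qed

lemma hilbert_krein:
  assumes "hilbert H"
  shows "krein_space H"
proof -
  interpret hilbert H by fact
  define Z :: "'a ip_space" where "Z = \<lparr>vecs = {0}, ip = \<lambda>_ _. 0\<rparr>"
  have "hilbert Z" by (rule hilbert_zero_space) (simp_all add: Z_def)
  moreover have "is_direct_sum H (neg_ip Z) H"
    by (auto simp: is_direct_sum_def Z_def)
  ultimately have "krein_decomposition H H Z"
    using assms by (simp add: krein_decomposition_iff)
  then show ?thesis by (auto simp: krein_space_def)
qed

text \<open>Serves the empty tensor product: evaluation at \<open>u\<close> identifies the space
  with the real line, whose completeness carries over.\<close>

lemma hilbert_functions_on_singleton:
  assumes v: "vecs T = functions_on {u}" and ip: "\<And>f g. f \<in> vecs T \<Longrightarrow> g \<in> vecs T \<Longrightarrow> ip T f g = f u * g u"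
  shows "hilbert T"
proof -
  interpret bilinear_space T
  proof
    show s: "subspace (vecs T)" by (auto simp: v subspace_def functions_on_def)
    fix f g assume f: "f \<in> vecs T" and g: "g \<in> vecs T"
    then show "ip T f g = ip T g f" by (simp add: ip)
    show "ip T (a *\<^sub>R f) g = a * ip T f g" for a
      using f g subspace_mul[OF s f] by (simp only: ip) simp
    fix k assume k: "k \<in> vecs T"
    show "ip T (f + g) k = ip T f k + ip T g k"
      using f g k subspace_add[OF s f g] by (simp only: ip) (simp add: algebra_simps)
  qed
  interpret pre_hilbert T
  proof
    fix f assume f: "f \<in> vecs T" "f \<noteq> 0"
    then have "f u \<noteq> 0" by (force simp: v functions_on_def fun_eq_iff)
    then have "0 < f u * f u" by (metis not_real_square_gt_zero)
    then show "0 < ip T f f" using f by (simp add: ip)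
  qed
  have nrm: "nrm f = \<bar>f u\<bar>" if "f \<in> vecs T" for f
    using that by (simp add: ip_norm_def ip)
  show ?thesis
  proof
    fix s assume s: "cauchy_in T s"
    have "nrm (s m - s n) = \<bar>s m u - s n u\<bar>" for m n
      using nrm[of "s m - s n"] s by (simp add: cauchy_in_mem)
    then have "Cauchy (\<lambda>n. s n u)"
      using s unfolding cauchy_in_def Cauchy_def dist_real_def by simp
    then obtain a where a: "(\<lambda>n. s n u) \<longlonglongrightarrow> a"
      using Cauchy_convergent convergent_def by blast
    define f where "f = restr {u} (\<lambda>_. a)"
    have f: "f \<in> vecs T" "f u = a" by (auto simp: f_def v functions_on_def restr_def)
    have "nrm (s n - f) = \<bar>s n u - a\<bar>" for n
      using nrm[of "s n - f"] s f by (simp add: cauchy_in_mem)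
    moreover have "(\<lambda>n. \<bar>s n u - a\<bar>) \<longlonglongrightarrow> 0"
      using a by (simp add: LIM_zero tendsto_rabs_zero)
    ultimately have "conv_in T s f"
      using s f by (simp add: conv_in_def cauchy_in_mem)
    then show "\<exists>f. conv_in T s f" by (rule exI[of "conv_in T s"])
  qed
qed

lemma linear_pull_back: "linear (pull_back X v W)"
  by (rule linearI) (auto simp: pull_back_def restr_def fun_eq_iff)

lemma pull_back_apply:
  "x \<in> Pi\<^sub>E (insert v W) X \<Longrightarrow> pull_back X v W f x = f (x v, restrict x W)"
  by (simp add: pull_back_def restr_def)

lemma inj_on_pull_back:
  assumes v: "v \<notin> W" and T: "vecs T \<subseteq> functions_on (X v \<times> Pi\<^sub>E W X)"
  shows "inj_on (pull_back X v W) (vecs T)"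
proof (rule inj_onI)
  fix f g assume fg: "f \<in> vecs T" "g \<in> vecs T" and e: "pull_back X v W f = pull_back X v W g"
  have "f (a, y) = g (a, y)" for a y
  proof (cases "a \<in> X v \<and> y \<in> Pi\<^sub>E W X")
    case True
    \<comment> \<open>The point \<open>y(v := a)\<close> corresponds to the pair
      \<open>(a, y)\<close>, so \<open>f\<close> can be read off from its pull-back;
      \<open>v \<notin> W\<close> keeps the coordinates in \<open>W\<close> unchanged.\<close>
    then have "y(v := a) \<in> Pi\<^sub>E (insert v W) X" by (auto simp: PiE_iff extensional_def)
    moreover have "restrict (y(v := a)) W = y"
      using True v by (auto simp: PiE_iff extensional_def fun_eq_iff)
    ultimately show ?thesis using fun_cong[OF e, of "y(v := a)"] by (simp add: pull_back_apply)
  next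
    case False
    then have "(a, y) \<notin> X v \<times> Pi\<^sub>E W X" by blast
    then have "f (a, y) = 0" "g (a, y) = 0"
      using subsetD[OF T fg(1)] subsetD[OF T fg(2)] unfolding functions_on_def by blast+
    then show ?thesis by simp
  qed
  then show "f = g" by auto
qed

lemma pull_back_rkks:
  assumes v: "v \<notin> W" and T: "rkks (X v \<times> Pi\<^sub>E W X) T k" and i: "isometry (pull_back X v W) T T'"
  shows "rkks (Pi\<^sub>E (insert v W) X) T' (\<lambda>x y. k (x v, restrict x W) (y v, restrict y W))"
  unfolding rkks_def
proof
  show "krein_space T'" using isometry_krein[OF i] T by (simp add: rkks_def)
  let ?Z = "Pi\<^sub>E (insert v W) X"
  have k: "reproducing_kernel (X v \<times> Pi\<^sub>E W X) T k" using T by (simp add: rkks_def)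
  have mem: "(x v, restrict x W) \<in> X v \<times> Pi\<^sub>E W X" if "x \<in> ?Z" for x
    using that by auto
  have v: "vecs T' = pull_back X v W ` vecs T" and
    ip: "\<And>f g. f \<in> vecs T \<Longrightarrow> g \<in> vecs T \<Longrightarrow> ip T' (pull_back X v W f) (pull_back X v W g) = ip T f g"
    using i by (auto simp: isometry_def)
  have r: "restr ?Z (\<lambda>y. k (x v, restrict x W) (y v, restrict y W)) =
      pull_back X v W (restr (X v \<times> Pi\<^sub>E W X) (k (x v, restrict x W)))" for x
  proof
    fix y
    show "restr ?Z (\<lambda>y. k (x v, restrict x W) (y v, restrict y W)) y =
        pull_back X v W (restr (X v \<times> Pi\<^sub>E W X) (k (x v, restrict x W))) y"
      using mem[of y] by (cases "y \<in> ?Z") (simp_all only: pull_back_def restr_def if_True if_False)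
  qed
  show "reproducing_kernel ?Z T' (\<lambda>x y. k (x v, restrict x W) (y v, restrict y W))"
  proof (rule reproducing_kernelI)
    show "vecs T' \<subseteq> functions_on ?Z"
      unfolding v functions_on_def pull_back_def restr_def by force
    show "k (x v, restrict x W) (y v, restrict y W) = k (y v, restrict y W) (x v, restrict x W)"
      if "x \<in> ?Z" "y \<in> ?Z" for x y
      using reproducing_kernel_commute[OF k mem[OF that(1)] mem[OF that(2)]] .
    fix x assume x: "x \<in> ?Z"
    note kx = reproducing_kernel_mem[OF k mem[OF x]]
    show "restr ?Z (\<lambda>y. k (x v, restrict x W) (y v, restrict y W)) \<in> vecs T'"
      unfolding r v using kx by (rule imageI)
    fix f assume "f \<in> vecs T'"
    then obtain g where g: "f = pull_back X v W g" "g \<in> vecs T" unfolding v by blast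
    have "f x = ip T g (restr (X v \<times> Pi\<^sub>E W X) (k (x v, restrict x W)))"
      using reproducing_kernel_eval[OF k mem[OF x] g(2)] by (simp only: g(1) pull_back_apply[OF x])
    also have "\<dots> = ip T' f (restr ?Z (\<lambda>y. k (x v, restrict x W) (y v, restrict y W)))"
      unfolding r g(1) using g(2) kx by (simp only: ip)
    finally show "f x = ip T' f (restr ?Z (\<lambda>y. k (x v, restrict x W) (y v, restrict y W)))" .
  qed
qed

lemma prod_kernel_insert:
  fixes g :: "'v \<Rightarrow> 'a \<Rightarrow> 'a \<Rightarrow> real"
  assumes "finite W" "v \<notin> W"
  shows "kernel_tensor (g v) (\<lambda>x y. \<Prod>w\<in>W. g w (x w) (y w)) (x v, restrict x W) (y v, restrict y W) =
    (\<Prod>w\<in>insert v W. g w (x w) (y w))"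
  using assms by (simp add: kernel_tensor_def cong: prod.cong)

lemma is_tensor_product_rkks:
  assumes "is_tensor_product X G vs T" and "distinct vs"
    and "\<And>v. v \<in> set vs \<Longrightarrow> rkks (X v) (G v) (g v)"
  shows "rkks (Pi\<^sub>E (set vs) X) T (\<lambda>x y. \<Prod>v\<in>set vs. g v (x v) (y v))"
  using assms
proof (induction rule: is_tensor_product.induct)
  case (Nil T)
  let ?u = "\<lambda>_. undefined"
  have v: "vecs T = functions_on {?u}" using Nil.hyps(1) by (simp only: PiE_empty_domain)
  have "hilbert T" using hilbert_functions_on_singleton[OF v] Nil.hyps(2) by blast
  moreover have "restr {?u} (\<lambda>_. 1) \<in> vecs T" by (auto simp: v functions_on_def restr_def)
  ultimately show ?case
    using Nil.hyps(2)
    by (auto simp: rkks_def hilbert_krein reproducing_kernel_def v PiE_empty_domain) (simp add: restr_def)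
next
  case (Cons vs T v T' T'')
  have v: "v \<notin> set vs" using Cons.prems by simp
  have "rkks (X v \<times> Pi\<^sub>E (set vs) X) T'
      (kernel_tensor (g v) (\<lambda>x y. \<Prod>w\<in>set vs. g w (x w) (y w)))"
    using Cons by (intro krein_tensor_rkks[OF _ _ Cons.hyps(2)]) auto
  \<comment> \<open>Injectivity is not part of \<open>is_tensor_product\<close>; it holds because
    the elements of \<open>T'\<close> vanish outside the product set.\<close>
  moreover from this have "inj_on (pull_back X v (set vs)) (vecs T')"
    by (intro inj_on_pull_back[OF v]) (simp add: rkks_def reproducing_kernel_def)
  then have "isometry (pull_back X v (set vs)) T' T''"
    using Cons.hyps(3,4) linear_pull_back by (simp add: isometry_def)
  ultimately have "rkks (Pi\<^sub>E (insert v (set vs)) X) T''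
    (\<lambda>x y. kernel_tensor (g v) (\<lambda>x y. \<Prod>w\<in>set vs. g w (x w) (y w))
      (x v, restrict x (set vs)) (y v, restrict y (set vs)))"
    using v by (intro pull_back_rkks)
  then show ?case unfolding prod_kernel_insert[OF finite_set v] by simp
qed

lemma ex_tensor_product:
  assumes "distinct vs" and "\<And>v. v \<in> set vs \<Longrightarrow> rkks (X v) (G v) (g v)"
  shows "\<exists>T. is_tensor_product X G vs T"
  using assms
proof (induction vs)
  case Nil
  show ?case
    by (rule exI, rule is_tensor_product.Nil[where T = "\<lparr>vecs = functions_on (Pi\<^sub>E {} X),
      ip = \<lambda>f g. f (\<lambda>_. undefined) * g (\<lambda>_. undefined)\<rparr>"]) simp_all
next
  case (Cons v vs)
  then obtain T where T: "is_tensor_product X G vs T" by auto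
  have v: "v \<notin> set vs" using Cons.prems by simp
  have r: "rkks (X v) (G v) (g v)" "rkks (Pi\<^sub>E (set vs) X) T (\<lambda>x y. \<Prod>v\<in>set vs. g v (x v) (y v))"
    using Cons.prems is_tensor_product_rkks[OF T] by auto
  then obtain T' where T': "is_krein_tensor (X v) (G v) (Pi\<^sub>E (set vs) X) T T'"
    using ex_krein_tensor by blast
  have "inj_on (pull_back X v (set vs)) (vecs T')"
    using krein_tensor_rkks[OF r T']
    by (intro inj_on_pull_back[OF v]) (simp add: rkks_def reproducing_kernel_def)
  from ex_isometry[OF linear_pull_back this]
  obtain T'' where "isometry (pull_back X v (set vs)) T' T''" ..
  then show ?case
    by (intro exI[of _ T''] is_tensor_product.Cons[OF T T']) (simp_all add: isometry_def)
qed

section \<open>Sections in one coordinate\<close>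

definition coordinate_section ::
    "('v \<Rightarrow> 'a set) \<Rightarrow> 'v \<Rightarrow> ('v \<Rightarrow> 'a) \<Rightarrow> (('v \<Rightarrow> 'a) \<Rightarrow> real) \<Rightarrow> 'a \<Rightarrow> real" where
  "coordinate_section X v x f = restr (X v) (\<lambda>t. f (x(v := t)))"

lemma coordinate_section_zero: "coordinate_section X v x 0 = 0"
  by (auto simp: coordinate_section_def restr_def)

lemma coordinate_section_add:
  "coordinate_section X v x (f + g) = coordinate_section X v x f + coordinate_section X v x g"
  by (auto simp: coordinate_section_def restr_def)

text \<open>The head of the list is the left factor of a Krein tensor product, so its sections are
  left sections. For a later coordinate, fixing the head coordinate gives a right section, which
  lies in the tensor product of the tail, where the induction hypothesis applies.\<close>

lemma is_tensor_product_section: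
  assumes "is_tensor_product X G vs T" and "distinct vs"
    and "\<And>v. v \<in> set vs \<Longrightarrow> rkks (X v) (G v) (g v)"
    and "f \<in> vecs T" "v \<in> set vs" "x \<in> Pi\<^sub>E (set vs) X"
  shows "coordinate_section X v x f \<in> vecs (G v)"
  using assms
proof (induction arbitrary: f v x rule: is_tensor_product.induct)
  case (Cons vs T u T' T'')
  let ?W = "set vs"
  have u: "u \<notin> ?W" using Cons.prems by simp
  have r: "rkks (X u) (G u) (g u)" "rkks (Pi\<^sub>E ?W X) T (\<lambda>x y. \<Prod>v\<in>?W. g v (x v) (y v))"
    using Cons.prems is_tensor_product_rkks[OF Cons.hyps(1)] by auto
  obtain f' where f: "f = pull_back X u ?W f'" "f' \<in> vecs T'"
    using Cons.prems Cons.hyps(3) by auto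
  note left = krein_tensor_section_left[OF r Cons.hyps(2) f(2)]
    and right = krein_tensor_section_right[OF r Cons.hyps(2) f(2)]
  have x: "x \<in> Pi\<^sub>E (insert u ?W) X" using Cons.prems by simp
  have upd: "x(v := t) \<in> Pi\<^sub>E (insert u ?W) X" if "t \<in> X v" for t
    using x that Cons.prems(4) by (auto simp: PiE_iff extensional_def)
  show ?case
  proof (cases "v = u")
    case True
    have "restrict (x(u := t)) ?W = restrict x ?W" for t using u by auto
    then have "coordinate_section X v x f = restr (X u) (\<lambda>t. f' (t, restrict x ?W))"
      using upd by (auto simp: coordinate_section_def restr_def True f pull_back_apply)
    also have "\<dots> = (\<lambda>t. f' (t, restrict x ?W))"
      using left[of "restrict x ?W"] r(1)
      by (auto simp: restr_def rkks_def reproducing_kernel_def functions_on_def fun_eq_iff subset_iff)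
    also have "\<dots> \<in> vecs (G v)" unfolding True by (rule left)
    finally show ?thesis .
  next
    case False
    then have v: "v \<in> ?W" using Cons.prems by simp
    have "restrict (x(v := t)) ?W = (restrict x ?W)(v := t)" for t using v by auto
    then have "coordinate_section X v x f = coordinate_section X v (restrict x ?W) (\<lambda>y. f' (x u, y))"
      using upd False by (auto simp: coordinate_section_def restr_def f pull_back_apply)
    also have "\<dots> \<in> vecs (G v)"
      using x Cons.prems v by (intro Cons.IH right) auto
    finally show ?thesis .
  qed
qed simp

section \<open>Directness and the reproducing kernel of the interaction space\<close>

text \<open>Splitting off one coordinate at a time separates the terms by whether they depend on it,
  since \<open>F v\<close> and \<open>C v\<close> are independent.\<close>

lemma independent_interactions:
  fixes f :: "'v set \<Rightarrow> ('v \<Rightarrow> 'a) \<Rightarrow> real"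
  assumes "finite V" "finite I" "I \<subseteq> Pow V"
    and FC: "\<And>v. v \<in> V \<Longrightarrow> subspace (FF v) \<and> subspace (CC v) \<and> FF v \<inter> CC v = {0}"
    and supp: "\<And>M. M \<in> I \<Longrightarrow> f M \<in> functions_on (Pi\<^sub>E V X)"
    and sec: "\<And>M v x. M \<in> I \<Longrightarrow> v \<in> V \<Longrightarrow> x \<in> Pi\<^sub>E V X \<Longrightarrow>
      coordinate_section X v x (f M) \<in> (if v \<in> M then FF v else CC v)"
    and sum: "(\<Sum>M\<in>I. f M) = 0"
    and M: "M \<in> I"
  shows "f M = 0"
proof -
  have sum_apply: "(\<Sum>M\<in>J. f M) x = (\<Sum>M\<in>J. f M x)" for J x
    by (induction J rule: infinite_finite_induct) auto
  have section_sum: "coordinate_section X v x (\<Sum>M\<in>J. f M) = (\<Sum>M\<in>J. coordinate_section X v x (f M))"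
    for J v x
  proof (induction J rule: infinite_finite_induct)
    case (insert M J)
    then show ?case by (simp only: sum.insert[OF insert.hyps] coordinate_section_add)
  next
    case (infinite J)
    then show ?case by (simp only: sum.infinite[OF infinite] coordinate_section_zero)
  qed (simp only: sum.empty coordinate_section_zero)
  \<comment> \<open>The sum is refined by the trace \<open>A\<close> of the index on a growing set
    \<open>W\<close> of coordinates: \<open>W = {}\<close> is the hypothesis \<open>sum\<close>, and
    \<open>W = V\<close> leaves a single term.\<close>
  have "(\<Sum>M\<in>{M \<in> I. M \<inter> W = A}. f M) = 0" if "finite W" "W \<subseteq> V" for W A
    using that
  proof (induction W arbitrary: A)
    case empty
    then show ?case using sum by (cases "A = {}") simp_all
  next
    case (insert v W)
    then have v: "v \<in> V" by simp
    \<comment> \<open>\<open>A - {v}\<close> fixes the trace on \<open>W\<close> alone; this class,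
      whose sum vanishes by induction, splits into the indices with \<open>v\<close> and those
      without.\<close>
    define J where "J = {M \<in> I. M \<inter> W = A - {v}}"
    define J1 J2 where "J1 = {M \<in> J. v \<in> M}" and "J2 = {M \<in> J. v \<notin> M}"
    have J: "J = J1 \<union> J2" "J1 \<inter> J2 = {}" "finite J1" "finite J2" "J1 \<subseteq> I" "J2 \<subseteq> I"
      using \<open>finite I\<close> by (auto simp: J1_def J2_def J_def)
    have sumJ: "(\<Sum>M\<in>J1. f M) + (\<Sum>M\<in>J2. f M) = 0"
    proof -
      have "sum f J = 0" using insert.IH[of "A - {v}"] insert.prems unfolding J_def by blast
      then show ?thesis unfolding J(1) sum.union_disjoint[OF J(3,4,2)] .
    qed
    have "(\<Sum>M\<in>J1. f M) x = 0" for x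
    proof (cases "x \<in> Pi\<^sub>E V X")
      case True
      let ?p = "\<Sum>M\<in>J1. coordinate_section X v x (f M)"
      let ?q = "\<Sum>M\<in>J2. coordinate_section X v x (f M)"
      have "coordinate_section X v x (f M) \<in> FF v" if "M \<in> J1" for M
        using sec[of M v x] that J(5) v True by (auto simp: J1_def)
      then have p: "?p \<in> FF v" using FC[OF v] by (intro subspace_sum) auto
      have "coordinate_section X v x (f M) \<in> CC v" if "M \<in> J2" for M
        using sec[of M v x] that J(6) v True by (auto simp: J2_def)
      then have q: "?q \<in> CC v" using FC[OF v] by (intro subspace_sum) auto
      have "?p + ?q = coordinate_section X v x ((\<Sum>M\<in>J1. f M) + (\<Sum>M\<in>J2. f M))"
        by (simp only: section_sum coordinate_section_add)
      also have "\<dots> = 0" unfolding sumJ by (rule coordinate_section_zero)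
      finally have "?p + ?q = 0" .
      then have "?p = 0"
        using direct_sum_unique[of "FF v" "CC v" ?p ?q 0 0] FC[OF v] p q subspace_0 add_0_right by metis
      \<comment> \<open>Evaluation at the coordinate \<open>x v\<close> turns the section back into
        the value at \<open>x\<close>.\<close>
      then have "coordinate_section X v x (\<Sum>M\<in>J1. f M) (x v) = 0"
        unfolding section_sum by simp
      moreover have "x v \<in> X v" using True v by auto
      ultimately show ?thesis by (simp add: coordinate_section_def restr_def)
    next
      case False
      then show ?thesis using supp J(5) unfolding sum_apply functions_on_def by (intro sum.neutral) blast
    qed
    then have J1: "(\<Sum>M\<in>J1. f M) = 0" by auto
    then have J2: "(\<Sum>M\<in>J2. f M) = 0" using sumJ by simp
    show ?case
    proof (cases "v \<in> A")
      case True
      then have "{M \<in> I. M \<inter> insert v W = A} = J1"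
        using insert.hyps by (auto simp: J1_def J_def)
      then show ?thesis using J1 by simp
    next
      case False
      then have "{M \<in> I. M \<inter> insert v W = A} = J2"
        using insert.hyps by (auto simp: J2_def J_def)
      then show ?thesis using J2 by simp
    qed
  qed
  from this[OF \<open>finite V\<close>, of M] have "(\<Sum>N\<in>{N \<in> I. N \<inter> V = M}. f N) = 0" by simp
  moreover have "{N \<in> I. N \<inter> V = M} = {M}" using \<open>I \<subseteq> Pow V\<close> M by auto
  ultimately show ?thesis by simp
qed

section \<open>Finite direct sums: existence and kernels\<close>

text \<open>The induction also carries that members of \<open>S\<close> are sums of members of the
  terms. Only so can a common element of \<open>T i\<close> and \<open>S\<close> be read as a
  relation among the terms, to which \<open>ind\<close> applies.\<close>

lemma ex_direct_sum_over:
  assumes "finite I" and T: "\<And>i. i \<in> I \<Longrightarrow> bilinear_space (T i)"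
    and ind: "\<And>f i. (\<And>i. i \<in> I \<Longrightarrow> f i \<in> vecs (T i)) \<Longrightarrow> (\<Sum>i\<in>I. f i) = 0 \<Longrightarrow> i \<in> I \<Longrightarrow> f i = 0"
  shows "\<exists>S. is_direct_sum_over T I S \<and> bilinear_space S \<and>
    (\<forall>g\<in>vecs S. \<exists>f. (\<forall>i\<in>I. f i \<in> vecs (T i)) \<and> g = (\<Sum>i\<in>I. f i))"
  using assms
proof (induction I)
  case empty
  define Z :: "'b ip_space" where "Z = \<lparr>vecs = {0}, ip = \<lambda>_ _. 0\<rparr>"
  have "hilbert Z" by (rule hilbert_zero_space) (simp_all add: Z_def)
  then show ?case
    by (intro exI[of _ Z]) (auto simp: Z_def hilbert_bilinear intro: is_direct_sum_over.empty)
next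
  case (insert i I)
  interpret Ti: bilinear_space "T i" using insert.prems(1) by simp
  have upd: "(\<Sum>j\<in>insert i I. (f(i := b)) j) = b + (\<Sum>j\<in>I. f j)" for f b
  proof -
    have "(\<Sum>j\<in>I. (f(i := b)) j) = (\<Sum>j\<in>I. f j)"
      using insert.hyps by (intro sum.cong) auto
    then show ?thesis unfolding sum.insert[OF insert.hyps] by simp
  qed
  have "f j = 0" if f: "\<And>j. j \<in> I \<Longrightarrow> f j \<in> vecs (T j)" "(\<Sum>j\<in>I. f j) = 0" "j \<in> I" for f j
  proof -
    have "(f(i := 0)) j = 0"
    proof (rule insert.prems(2)[of "f(i := 0)"])
      show "(f(i := 0)) k \<in> vecs (T k)" if "k \<in> insert i I" for k
        using that f(1) by (cases "k = i") simp_all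
      show "(\<Sum>j\<in>insert i I. (f(i := 0)) j) = 0" unfolding upd f(2) by simp
    qed (use f(3) in simp)
    then show ?thesis using f(3) insert.hyps by (cases "j = i") simp_all
  qed
  then have "\<exists>S. is_direct_sum_over T I S \<and> bilinear_space S \<and>
      (\<forall>g\<in>vecs S. \<exists>f. (\<forall>i\<in>I. f i \<in> vecs (T i)) \<and> g = (\<Sum>i\<in>I. f i))"
    using insert.prems(1) by (intro insert.IH) simp_all
  then obtain S where S: "is_direct_sum_over T I S" "bilinear_space S"
    "\<And>g. g \<in> vecs S \<Longrightarrow> \<exists>f. (\<forall>i\<in>I. f i \<in> vecs (T i)) \<and> g = (\<Sum>i\<in>I. f i)"
    by blast
  interpret S: bilinear_space S by fact
  have "g = 0" if g: "g \<in> vecs (T i)" "g \<in> vecs S" for g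
  proof -
    obtain f where f: "\<forall>j\<in>I. f j \<in> vecs (T j)" "g = (\<Sum>j\<in>I. f j)" using S(3)[OF g(2)] by blast
    \<comment> \<open>A common element \<open>g\<close> gives a vanishing sum over
      \<open>insert i I\<close> whose term at \<open>i\<close> is \<open>- g\<close>.\<close>
    have "(f(i := - g)) i = 0"
    proof (rule insert.prems(2)[of "f(i := - g)"])
      show "(f(i := - g)) j \<in> vecs (T j)" if "j \<in> insert i I" for j
        using that f(1) Ti.minus_mem[OF g(1)] by (cases "j = i") simp_all
      show "(\<Sum>j\<in>insert i I. (f(i := - g)) j) = 0"
        unfolding upd f(2)[symmetric] by simp
    qed simp
    then show "g = 0" by simp
  qed
  then have "vecs (T i) \<inter> vecs S = {0}" using Ti.zero_mem S.zero_mem by blast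
  then obtain S' where S': "is_direct_sum (T i) S S'"
    using ex_direct_sum[OF Ti.subspace S.subspace] by blast
  interpret direct_sum "T i" S S' using S' by unfold_locales
  have "\<exists>f. (\<forall>j\<in>insert i I. f j \<in> vecs (T j)) \<and> g = (\<Sum>j\<in>insert i I. f j)" if "g \<in> vecs S'" for g
  proof -
    obtain g1 g2 where g: "g = g1 + g2" "g1 \<in> vecs (T i)" "g2 \<in> vecs S"
      using \<open>g \<in> vecs S'\<close> unfolding mem_iff by blast
    obtain f where f: "\<forall>j\<in>I. f j \<in> vecs (T j)" "g2 = (\<Sum>j\<in>I. f j)" using S(3)[OF g(3)] by blast
    have "(f(i := g1)) j \<in> vecs (T j)" if "j \<in> insert i I" for j
      using that f(1) g(2) by (cases "j = i") simp_all
    moreover have "g = (\<Sum>j\<in>insert i I. (f(i := g1)) j)"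
      unfolding upd f(2)[symmetric] by (rule g(1))
    ultimately show ?thesis by blast
  qed
  then show ?case
    using is_direct_sum_over.insert[OF insert.hyps(2) S(1) S'] bilinear by blast
qed

text \<open>Finiteness of \<open>I\<close> is proved along with the kernel, because splitting the
  sum of kernels over \<open>insert i I\<close> relies on it.\<close>

lemma direct_sum_over_rkks:
  assumes "is_direct_sum_over T I S" and "\<And>i. i \<in> I \<Longrightarrow> rkks Z (T i) (k i)"
  shows "finite I \<and> rkks Z S (\<lambda>x y. \<Sum>i\<in>I. k i x y)"
  using assms
proof (induction rule: is_direct_sum_over.induct)
  case (empty S)
  then have "krein_space S" using hilbert_krein hilbert_zero_space by blast
  moreover have "restr Z (\<lambda>_. 0) = 0" by (auto simp: restr_def)
  ultimately show ?case
    using empty by (simp add: rkks_def reproducing_kernel_def functions_on_def)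
next
  case (insert i I S S')
  then have "rkks Z S' (\<lambda>x y. k i x y + (\<Sum>i\<in>I. k i x y))"
    by (intro direct_sum_rkks[OF _ _ insert.hyps(3)]) auto
  then show ?case using insert by simp
qed

lemma interaction_kernel_eq:
  assumes "finite V" "M \<subseteq> V"
  shows "interaction_kernel V h c M =
    (\<lambda>x y. \<Prod>v\<in>V. (if v \<in> M then h v else c v) (x v) (y v))"
proof (intro ext)
  fix x y
  have "(\<Prod>v\<in>V. (if v \<in> M then h v else c v) (x v) (y v)) =
      (\<Prod>v\<in>V. if v \<in> M then h v (x v) (y v) else c v (x v) (y v))"
    by (rule prod.cong) auto
  also have "\<dots> = interaction_kernel V h c M x y"
    using assms by (simp add: prod.If_cases interaction_kernel_def Int_absorb1 Diff_eq)
  finally show "interaction_kernel V h c M x y = (\<Prod>v\<in>V. (if v \<in> M then h v else c v) (x v) (y v))" ..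
qed

text \<open>As the spaces are described by predicates, the kernel formula alone might hold
  vacuously. The first two conjuncts exclude this, and the second does so for every choice of the
  terms.\<close>

theorem proposition3:
  fixes V :: "'v set" and vs :: "'v list" and MM :: "'v set set"
    and X :: "'v \<Rightarrow> 'a set"
    and F C :: "'v \<Rightarrow> ('a \<Rightarrow> real) ip_space"
    and h c :: "'v \<Rightarrow> 'a \<Rightarrow> 'a \<Rightarrow> real"
  assumes "finite V"
    and "distinct vs" and "set vs = V"
    and "sperner_family V MM"
    and "\<And>v. v \<in> V \<Longrightarrow> rkks (X v) (F v) (h v)"
    and "\<And>v. v \<in> V \<Longrightarrow> vecs (C v) = constant_functions (X v)"
    and "\<And>v. v \<in> V \<Longrightarrow> rkks (X v) (C v) (c v)"
    and "\<And>v. v \<in> V \<Longrightarrow> vecs (F v) \<inter> vecs (C v) = {0}"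
  shows "(\<forall>M\<in>subsets_of_members MM. \<exists>T. is_interaction_term vs X F C M T) \<and>
    (\<forall>T. (\<forall>M\<in>subsets_of_members MM. is_interaction_term vs X F C M (T M)) \<longrightarrow>
       (\<exists>S. is_direct_sum_over T (subsets_of_members MM) S)) \<and>
    (\<forall>S. is_interaction_space vs X F C MM S \<longrightarrow>
       rkks (Pi\<^sub>E V X) S
         (\<lambda>x x'. \<Sum>M\<in>subsets_of_members MM. interaction_kernel V h c M x x'))"
proof -
  let ?I = "subsets_of_members MM"
  let ?G = "\<lambda>M v. if v \<in> M then F v else C v"
  let ?g = "\<lambda>M v. if v \<in> M then h v else c v"
  have I: "?I \<subseteq> Pow V"
    using assms(4) by (auto simp: subsets_of_members_def sperner_family_def)
  then have "finite ?I" using assms(1) by (simp add: finite_subset)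
  have G: "rkks (X v) (?G M v) (?g M v)" if "v \<in> set vs" for M v
    using assms that by simp
  have term_rkks: "rkks (Pi\<^sub>E V X) T (interaction_kernel V h c M)"
    if "M \<in> ?I" "is_interaction_term vs X F C M T" for M T
    using is_tensor_product_rkks[OF that(2)[unfolded is_interaction_term_def] assms(2) G] that(1) I assms(1,3)
    by (simp add: interaction_kernel_eq subset_iff)
  have FC: "subspace (vecs (F v)) \<and> subspace (vecs (C v)) \<and> vecs (F v) \<inter> vecs (C v) = {0}"
    if "v \<in> V" for v
    using assms(5,7,8)[OF that] krein_space_bilinear by (auto simp: rkks_def bilinear_space_def)
  have 1: "\<exists>T. is_interaction_term vs X F C M T" for M
    unfolding is_interaction_term_def using ex_tensor_product[OF assms(2) G] .
  have 2: "\<exists>S. is_direct_sum_over T ?I S"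
    if T: "\<forall>M\<in>?I. is_interaction_term vs X F C M (T M)" for T
  proof -
    have bil: "bilinear_space (T M)" if "M \<in> ?I" for M
      using term_rkks[OF that] T that krein_space_bilinear by (auto simp: rkks_def)
    have ind: "f M = 0"
      if f: "\<And>M. M \<in> ?I \<Longrightarrow> f M \<in> vecs (T M)" and s: "(\<Sum>M\<in>?I. f M) = 0" and M: "M \<in> ?I" for f M
    proof (rule independent_interactions[where FF = "\<lambda>v. vecs (F v)" and CC = "\<lambda>v. vecs (C v)",
          OF assms(1) \<open>finite ?I\<close> I FC _ _ s M])
      show "f M \<in> functions_on (Pi\<^sub>E V X)" if "M \<in> ?I" for M
      proof -
        have "vecs (T M) \<subseteq> functions_on (Pi\<^sub>E V X)"
          using term_rkks[OF that T[rule_format, OF that]] unfolding rkks_def reproducing_kernel_def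
          by (elim conjE)
        with f[OF that] show ?thesis by blast
      qed
      show "coordinate_section X v x (f M) \<in> (if v \<in> M then vecs (F v) else vecs (C v))"
        if "M \<in> ?I" "v \<in> V" "x \<in> Pi\<^sub>E V X" for M v x
      proof -
        have "coordinate_section X v x (f M) \<in> vecs (?G M v)"
          by (rule is_tensor_product_section[OF T[rule_format, OF that(1), unfolded is_interaction_term_def]
              assms(2) G f[OF that(1)]]) (use that assms(3) in simp_all)
        then show ?thesis by (cases "v \<in> M") simp_all
      qed
    qed
    have "\<exists>S. is_direct_sum_over T ?I S \<and> bilinear_space S \<and>
        (\<forall>g\<in>vecs S. \<exists>f. (\<forall>M\<in>?I. f M \<in> vecs (T M)) \<and> g = (\<Sum>M\<in>?I. f M))"
      by (rule ex_direct_sum_over[OF \<open>finite ?I\<close>]) (fact bil, rule ind)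
    then show ?thesis by blast
  qed
  have 3: "rkks (Pi\<^sub>E V X) S (\<lambda>x x'. \<Sum>M\<in>?I. interaction_kernel V h c M x x')"
    if S: "is_interaction_space vs X F C MM S" for S
    using S direct_sum_over_rkks term_rkks unfolding is_interaction_space_def by blast
  from 1 2 3 show ?thesis by blast
qed

end
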